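(* Let $Y(t)$, $t\ge 0$, be a critical Markov branching process with non-homogeneous Poisson immigration, with offspring p.g.f. $f(s)=s+(1-s)^{\gamma+1}L(1/(1-s))$, $s\in[0,1)$, $\gamma\in(0,1]$, immigrant p.g.f. $g(s)=1-(1-s)^{\alpha}l(1/(1-s))$, $\alpha\in(0,1]$, and Poisson intensity $r(t)=t^{-\theta}L_R(t)$, where $L,l,L_R$ are slowly varying at infinity. Assume that $\theta\ge 1$ with $R=\int_0^\infty r(t)\,dt<\infty$, and that $\alpha/\gamma\ge 1$ with $Q=\int_0^\infty q(t)\,dt<\infty$. (i) If $q(t)=o(r(t))$ as $t\to\infty$, then for $s\in[0,1)$ $$\mathbf{E}[s^{Y(t)}\mid Y(t)>0]\to 1-\frac{\Delta(s)}{Q},\qquad t\to\infty .$$ (ii) If $r(t)=o(q(t))$ as $t\to\infty$, then for every $x\ge 0$ $$\mathbf{P}\{Y(t)/W(\mu t)\le x\mid Y(t)>0\}\to D(\alpha,\gamma;x),\qquad t\to\infty,$$ where $D(\alpha,\gamma;\cdot)$ is the distribution function on $[0,\infty)$ with Laplace transform $$\int_0^\infty e^{-\lambda x}\,\mathrm{d}D(\alpha,\gamma;x)=1-\frac{\lambda^{\alpha}}{(1+\lambda^{\gamma})^{\alpha/\gamma}},\qquad \lambda>0 .$$ (iii) If $r(t)/q(t)\to d\in(0,\infty)$ as $t\to\infty$, then, as $t\to\infty$, $$\mathbf{E}[s^{Y(t)}\mid Y(t)>0]\to\frac{dQ}{dQ+R}\left(1-\frac{\Delta(s)}{Q}\right),\qquad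 s\in[0,1),$$ $$\mathbf{P}\{Y(t)/W(\mu t)\le x\mid Y(t)>0\}\to\frac{dQ+R\,D(\alpha,\gamma;x)}{dQ+R},\qquad x>0,$$ with $D(\alpha,\gamma;\cdot)$ the distribution function with the Laplace transform given in (ii).
   Context: Model. In a Markov branching process each particle, independently of all others, lives an exponentially distributed time with parameter $\mu>0$ and at its death produces a random number $\xi\ge 0$ of new particles of the same type; $f(s)=\mathbf{E}[s^{\xi}]$ is the offspring p.g.f. Let $Z(t)$ be the number of particles at time $t$ and $F(t;s)=\mathbf{E}[s^{Z(t)}\mid Z(0)=1]$, so $\partial F(t;s)/\partial t=\mu[f(F(t;s))-F(t;s)]$, $F(0;s)=s$. Let $\nu(t)$ be a non-homogeneous Poisson process with intensity $r(t)$, mean measure $R(t)=\int_0^t r(u)\,du$ (finite for each $t$), and jump points $0=S_0<S_1<S_2<\cdots$. At each $S_k$, $k\ge1$, $I_k$ new particles immigrate, where $I_1,I_2,\dots$ are i.i.d. non-negative integer-valued with p.g.f. $g(s)=\mathbf{E}[s^{I_k}]$. The Markov branching process with non-homogeneous Poisson immigration is $$Y(t)=\sum_{k=1}^{\nu(t)}\sum_{j=1}^{I_k}Z^{(k,j)}(t-S_k),\qquad t\ge 0,$$ where $Z^{(k,j)}$ are i.i.d. copies of $Z$ started from one particle; the processes $Z^{(k,j)}$, the variables $I_k$ and the Poisson process $\nu$ are independent. Notation. $q(t;s)=1-g(F(t;s))$, $q(t)=q(t;0)$, $\Delta(s)=\int_0^\infty q(u;s)\,du$. $V(x)=\int_0^{1-1/x}\frac{du}{f(u)-u}=\int_1^x\frac{u^{\gamma-1}}{L(u)}\,du$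 for $x\ge1$, which is increasing from $[1,\infty)$ onto $[0,\infty)$, and $W:[0,\infty)\to[1,\infty)$ is the inverse function of $V$. *)

theory Defs
  imports "HOL-Probability.Probability" "HOL-Library.Landau_Symbols"
begin

definition pgf :: "nat pmf \<Rightarrow> real \<Rightarrow> real" where
  "pgf p s = measure_pmf.expectation p (\<lambda>n. s ^ n)"

(* Positivity and measurability are required only from some point on, so that nothing is
   imposed on the values outside a neighbourhood of infinity. *)
definition slowly_varying :: "(real \<Rightarrow> real) \<Rightarrow> bool" where
  "slowly_varying L \<longleftrightarrow>
     (\<exists>a. set_borel_measurable borel {a..} L \<and> (\<forall>x\<ge>a. 0 < L x)) \<and>
     (\<forall>c>0. ((\<lambda>x. L (c * x) / L x) \<longlongrightarrow> 1) at_top)"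


text \<open>
  A branching particle system started from one particle. Particles are labelled by finite words
  (Ulam--Harris): the ancestor is \<open>[]\<close> and \<open>u @ [i]\<close> is the child number \<open>i\<close>
  (counted from 0) of \<open>u\<close>. Particle \<open>u\<close> has lifetime \<open>\<tau> u\<close> and
  produces \<open>\<xi> u\<close> children at its death.
\<close>

definition in_family :: "(nat list \<Rightarrow> nat) \<Rightarrow> nat list \<Rightarrow> bool" where
  "in_family \<xi> u \<longleftrightarrow> (\<forall>i<length u. u ! i < \<xi> (take i u))"

definition birth_time :: "(nat list \<Rightarrow> real) \<Rightarrow> nat list \<Rightarrow> real" where
  "birth_time \<tau> u = (\<Sum>i<length u. \<tau> (take i u))"

(* If infinitely many particles are alive (explosion) the value is 0 by the convention for card;
   for a critical offspring law this has probability 0. *)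
definition population :: "(nat list \<Rightarrow> real) \<Rightarrow> (nat list \<Rightarrow> nat) \<Rightarrow> real \<Rightarrow> nat" where
  "population \<tau> \<xi> t =
     card {u. in_family \<xi> u \<and> birth_time \<tau> u \<le> t \<and> t < birth_time \<tau> u + \<tau> u}"

(* The law of all lifetimes and offspring numbers of one such system. *)
definition branching_law :: "real \<Rightarrow> nat pmf \<Rightarrow> ((nat list \<Rightarrow> real) \<times> (nat list \<Rightarrow> nat)) measure" where
  "branching_law \<mu> p =
     PiM UNIV (\<lambda>_. density lborel (exponential_density \<mu>)) \<Otimes>\<^sub>M PiM UNIV (\<lambda>_. measure_pmf p)"

(* F(t;s) = E[s^Z(t) | Z(0) = 1] *)
definition branching_pgf :: "real \<Rightarrow> nat pmf \<Rightarrow> real \<Rightarrow> real \<Rightarrow> real" where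
  "branching_pgf \<mu> p t s = (\<integral>(\<tau>, \<xi>). s ^ population \<tau> \<xi> t \<partial>branching_law \<mu> p)"


definition poisson_process :: "'a measure \<Rightarrow> (real \<Rightarrow> real) \<Rightarrow> (real \<Rightarrow> 'a \<Rightarrow> nat) \<Rightarrow> bool" where
  "poisson_process M r \<nu> \<longleftrightarrow>
     prob_space M \<and>
     (\<forall>t\<ge>0. \<nu> t \<in> measurable M (count_space UNIV)) \<and>
     \<comment> \<open>paths are right-continuous step functions starting at 0, with jumps of size 1\<close>
     (\<forall>\<omega>\<in>space M. \<nu> 0 \<omega> = 0 \<and>
        (\<forall>s t. 0 \<le> s \<longrightarrow> s \<le> t \<longrightarrow> \<nu> s \<omega> \<le> \<nu> t \<omega>) \<and>
        (\<forall>t\<ge>0. \<forall>\<^sub>F s in at_right t. \<nu> s \<omega> = \<nu> t \<omega>) \<and>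
        (\<forall>t>0. \<exists>s. 0 \<le> s \<and> s < t \<and> \<nu> t \<omega> \<le> Suc (\<nu> s \<omega>))) \<and>
     \<comment> \<open>independent increments\<close>
     (\<forall>(n::nat) (t::nat \<Rightarrow> real). 0 \<le> t 0 \<longrightarrow> mono t \<longrightarrow>
        prob_space.indep_vars M (\<lambda>_. count_space UNIV)
          (\<lambda>i \<omega>. \<nu> (t (Suc i)) \<omega> - \<nu> (t i) \<omega>) {..<n}) \<and>
     \<comment> \<open>increments over \<open>(s, t]\<close> are Poisson distributed with mean the integral of \<open>r\<close>\<close>
     (\<forall>t\<ge>0. 0 \<le> r t) \<and> (\<forall>t\<ge>0. set_integrable lborel {0..t} r) \<and>
     (\<forall>s t k. 0 \<le> s \<longrightarrow> s \<le> t \<longrightarrow>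
        \<P>(\<omega> in M. \<nu> t \<omega> - \<nu> s \<omega> = k) =
          (LINT u:{s..t}|lborel. r u) ^ k / fact k * exp (- (LINT u:{s..t}|lborel. r u)))"

(* S_k, meaningful when the path of the process reaches k, in particular for k <= nu(t) *)
definition jump_point :: "(real \<Rightarrow> 'a \<Rightarrow> nat) \<Rightarrow> nat \<Rightarrow> 'a \<Rightarrow> real" where
  "jump_point \<nu> k \<omega> = Inf {t. 0 \<le> t \<and> k \<le> \<nu> t \<omega>}"

(* Z^{(k,j)} is driven by the lifetimes T k j and the offspring numbers N k j. *)
definition immigration_process ::
  "(nat \<Rightarrow> nat \<Rightarrow> nat list \<Rightarrow> 'a \<Rightarrow> real) \<Rightarrow> (nat \<Rightarrow> nat \<Rightarrow> nat list \<Rightarrow> 'a \<Rightarrow> nat) \<Rightarrow>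
   (nat \<Rightarrow> 'a \<Rightarrow> nat) \<Rightarrow> (real \<Rightarrow> 'a \<Rightarrow> nat) \<Rightarrow> real \<Rightarrow> 'a \<Rightarrow> nat" where
  "immigration_process T N I \<nu> t \<omega> =
     (\<Sum>k = 1..\<nu> t \<omega>. \<Sum>j = 1..I k \<omega>.
        population (\<lambda>u. T k j u \<omega>) (\<lambda>u. N k j u \<omega>) (t - jump_point \<nu> k \<omega>))"

(* The independent sources of randomness, and the sigma-algebras they generate. *)
datatype source =
  Lifetime nat nat "nat list" | Offspring nat nat "nat list" | Group_size nat | Arrivals

fun source_events ::
  "'a measure \<Rightarrow> (nat \<Rightarrow> nat \<Rightarrow> nat list \<Rightarrow> 'a \<Rightarrow> real) \<Rightarrow> (nat \<Rightarrow> nat \<Rightarrow> nat list \<Rightarrow> 'a \<Rightarrow> nat) \<Rightarrow>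
   (nat \<Rightarrow> 'a \<Rightarrow> nat) \<Rightarrow> (real \<Rightarrow> 'a \<Rightarrow> nat) \<Rightarrow> source \<Rightarrow> 'a set set" where
  "source_events M T N I \<nu> (Lifetime k j u) = {T k j u -` A \<inter> space M | A. A \<in> sets borel}"
| "source_events M T N I \<nu> (Offspring k j u) = {N k j u -` A \<inter> space M | A. True}"
| "source_events M T N I \<nu> (Group_size k) = {I k -` A \<inter> space M | A. True}"
| "source_events M T N I \<nu> Arrivals =
     sigma_sets (space M) {\<nu> t -` A \<inter> space M | t A. 0 \<le> t}"

(* Immigration epochs k and the members j of each group are numbered from 1. *)
fun proper_source :: "source \<Rightarrow> bool" where
  "proper_source (Lifetime k j u) \<longleftrightarrow> 1 \<le> k \<and> 1 \<le> j"
| "proper_source (Offspring k j u) \<longleftrightarrow> 1 \<le> k \<and> 1 \<le> j"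
| "proper_source (Group_size k) \<longleftrightarrow> 1 \<le> k"
| "proper_source Arrivals \<longleftrightarrow> True"

text \<open>
  Markov branching with non-homogeneous Poisson immigration: death rate \<open>\<mu>\<close>, offspring law
  \<open>p\<close>, law \<open>h\<close> of the number of immigrants per epoch, immigration intensity
  \<open>r\<close>.
\<close>

locale mbp_poisson_immigration = prob_space M
  for M :: "'a measure" and \<mu> :: real and p h :: "nat pmf" and r :: "real \<Rightarrow> real"
    and T :: "nat \<Rightarrow> nat \<Rightarrow> nat list \<Rightarrow> 'a \<Rightarrow> real"
    and N :: "nat \<Rightarrow> nat \<Rightarrow> nat list \<Rightarrow> 'a \<Rightarrow> nat"
    and I :: "nat \<Rightarrow> 'a \<Rightarrow> nat"
    and \<nu> :: "real \<Rightarrow> 'a \<Rightarrow> nat" +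
  assumes rate_pos: "0 < \<mu>"
    and lifetime: "\<And>k j u. 1 \<le> k \<Longrightarrow> 1 \<le> j \<Longrightarrow>
          distributed M lborel (T k j u) (exponential_density \<mu>)"
    and offspring_rv: "\<And>k j u. 1 \<le> k \<Longrightarrow> 1 \<le> j \<Longrightarrow> N k j u \<in> measurable M (count_space UNIV)"
    and offspring: "\<And>k j u n. 1 \<le> k \<Longrightarrow> 1 \<le> j \<Longrightarrow> \<P>(\<omega> in M. N k j u \<omega> = n) = pmf p n"
    and immigrants_rv: "\<And>k. 1 \<le> k \<Longrightarrow> I k \<in> measurable M (count_space UNIV)"
    and immigrants: "\<And>k n. 1 \<le> k \<Longrightarrow> \<P>(\<omega> in M. I k \<omega> = n) = pmf h n"
    and arrivals: "poisson_process M r \<nu>"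
    and independent: "indep_sets (source_events M T N I \<nu>) {c. proper_source c}"


(* q(t;s), and Delta(s); in particular q(t) = q(t;0) *)
definition immigrant_q :: "real \<Rightarrow> nat pmf \<Rightarrow> nat pmf \<Rightarrow> real \<Rightarrow> real \<Rightarrow> real" where
  "immigrant_q \<mu> p h t s = 1 - pgf h (branching_pgf \<mu> p t s)"

definition immigrant_Delta :: "real \<Rightarrow> nat pmf \<Rightarrow> nat pmf \<Rightarrow> real \<Rightarrow> real" where
  "immigrant_Delta \<mu> p h s = (LINT u:{0..}|lborel. immigrant_q \<mu> p h u s)"

definition V_fun :: "nat pmf \<Rightarrow> real \<Rightarrow> real" where
  "V_fun p x = (LINT u:{0..1 - 1 / x}|lborel. 1 / (pgf p u - u))"

definition W_fun :: "nat pmf \<Rightarrow> real \<Rightarrow> real" where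
  "W_fun p = the_inv_into {1..} (V_fun p)"

(* The law on [0,\<infinity>) whose distribution function is D(\<alpha>,\<gamma>;.). *)
definition is_D_law :: "real \<Rightarrow> real \<Rightarrow> real measure \<Rightarrow> bool" where
  "is_D_law \<alpha> \<gamma> D \<longleftrightarrow>
     real_distribution D \<and> measure D {..<0} = 0 \<and>
     (\<forall>l>0. (\<integral>x. exp (- l * x) \<partial>D) = 1 - l powr \<alpha> / (1 + l powr \<gamma>) powr (\<alpha> / \<gamma>))"

(* E[X | A] for an event A *)
definition cond_expectation :: "'a measure \<Rightarrow> ('a \<Rightarrow> real) \<Rightarrow> ('a \<Rightarrow> bool) \<Rightarrow> real" where
  "cond_expectation M X A = (\<integral>\<omega>. X \<omega> \<partial>uniform_measure M {\<omega> \<in> space M. A \<omega>})"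

end

theory Submission
  imports Defs "HOL-Complex_Analysis.Complex_Analysis"
begin

text \<open>
  At a late time \<open>t\<close> the population can be alive for two reasons: a group has immigrated
  recently, or an early group has survived for a long time. The theorem says that these are the only
  reasons, and weighs them.

  Write \<open>q(u;s) = 1 - g(F(u;s))\<close>. The groups are marks of a Poisson process, hence
  \<open>E s^Y(t) = exp (- c(t,s))\<close> with \<open>c(t,s) = \<integral>\<^sub>0\<^sup>t r(t-u) q(u;s) du\<close>
  (\<open>immigration_pgf\<close>). Therefore
  \<open>1 - E[s^Y(t) | Y(t) > 0] = (1 - exp (- c(t,s))) / (1 - exp (- c(t,0)))\<close>, and since
  \<open>c(t,0)\<close> tends to 0 this is asymptotic to \<open>c(t,s) / c(t,0)\<close>. Both \<open>r\<close> and \<open>q\<close>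
  vary regularly and are integrable, so the convolution concentrates at its two ends
  (\<open>convolution_split\<close>): the recent arrivals contribute \<open>r(t) \<Delta>(s)\<close> and the early
  ones \<open>R q(t;s)\<close>. The ratio of \<open>r(t)\<close> and \<open>q(t)\<close> decides which end prevails,
  and this gives the three cases.

  The equation for \<open>F\<close> is separable: \<open>1 / (1 - F(t;s)) = W(\<mu> t + V(1/(1-s)))\<close>
  (\<open>branching_pgf_eq\<close>). Replacing 0 by \<open>s\<close> is thus a mere shift of time, and
  \<open>q(t;s) = q(t + V(1/(1-s)) / \<mu>)\<close>. So everything follows from the regular variation of
  \<open>q\<close> with index \<open>- \<alpha> / \<gamma>\<close> (\<open>q_ratio\<close>). For fixed \<open>s\<close> the shift is negligible and
  \<open>q(t;s)\<close> is asymptotic to \<open>q(t)\<close>. For \<open>s = exp (- x / W(\<mu> t))\<close> the shift is asymptotic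
  to \<open>x\<^sup>-\<^sup>\<gamma> t\<close>; then the recent arrivals contribute nothing, and \<open>q(t;s) / q(t)\<close> tends to
  \<open>x powr \<alpha> / (1 + x powr \<gamma>) powr (\<alpha> / \<gamma>)\<close>. The functions \<open>V\<close>, \<open>W\<close> and \<open>q\<close>
  are monotone, which makes pointwise regular variation sufficient for them; the intensity
  \<open>r\<close> is treated with the uniform convergence theorem (\<open>slowly_varying_uniform\<close>).

  The law \<open>D\<close> arises as the limit law of the scaled size of a single surviving group
  (\<open>D_law_exists\<close>). It has no atoms, because its Laplace transform extends to the right half-plane
  and vanishes at infinity along a vertical line (\<open>D_law_no_atom\<close>). Convergence of Laplace transforms
  at the positive integers therefore yields the convergence of the conditional distribution functions
  at every positive point (\<open>laplace_cdf_convergence\<close>).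

  The equation for \<open>F\<close> itself is derived from the genealogy. Conditioning on the death of the
  ancestor gives a recursion for the generating function of the number of living particles in the first
  \<open>n\<close> generations. In the critical case \<open>f(s) \<ge> s\<close> keeps these functions above \<open>s\<close>;
  this excludes explosion (\<open>no_explosion\<close>) and lets \<open>n\<close> tend to infinity.
\<close>

section \<open>Independent sources of randomness\<close>

text \<open>
  Independent sources of randomness, each given by a generator of its sigma-algebra. Random elements
  are tracked through the group of sources on which they depend.
\<close>

locale indep_sources = prob_space M for M :: "'a measure" +
  fixes E :: "'i \<Rightarrow> 'a set set" and C :: "'i set"
  assumes indep: "indep_sets E C"
    and stable: "\<And>c. c \<in> C \<Longrightarrow> Int_stable (E c)"
begin

text \<open>
  A group of sources as a measurable space of its own: to depend only on the sources in \<open>K\<close>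
  means to be measurable on \<open>Sig K\<close>.
\<close>

definition Sig :: "'i set \<Rightarrow> 'a measure" where
  "Sig K = sigma (space M) (\<Union>c\<in>K. E c)"

lemma space_Sig [simp]: "space (Sig K) = space M"
  by (simp add: Sig_def space_measure_of_conv)

lemma sources_events: "c \<in> C \<Longrightarrow> E c \<subseteq> events"
  using indep by (auto simp: indep_sets_def)

lemma sources_Pow: "K \<subseteq> C \<Longrightarrow> (\<Union>c\<in>K. E c) \<subseteq> Pow (space M)"
  using sources_events sets.space_closed by blast

lemma sets_Sig: "K \<subseteq> C \<Longrightarrow> sets (Sig K) = sigma_sets (space M) (\<Union>c\<in>K. E c)"
  by (simp add: Sig_def sets_measure_of[OF sources_Pow])

lemma sets_Sig_subset: "K \<subseteq> C \<Longrightarrow> sets (Sig K) \<subseteq> events"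
  unfolding sets_Sig by (rule sets.sigma_sets_subset) (use sources_events in blast)

lemma sets_Sig_mono: "K \<subseteq> K' \<Longrightarrow> K' \<subseteq> C \<Longrightarrow> sets (Sig K) \<subseteq> sets (Sig K')"
  by (subst sets_Sig, force)+ (rule sigma_sets_mono', auto)

lemma measurable_Sig_mono:
  "K \<subseteq> K' \<Longrightarrow> K' \<subseteq> C \<Longrightarrow> X \<in> measurable (Sig K) N \<Longrightarrow> X \<in> measurable (Sig K') N"
  using sets_Sig_mono[of K K'] unfolding measurable_def by auto

lemma measurable_Sig_imp: "K \<subseteq> C \<Longrightarrow> X \<in> measurable (Sig K) N \<Longrightarrow> X \<in> measurable M N"
  using sets_Sig_subset[of K] unfolding measurable_def by auto

lemma measurable_SigI:
  assumes "K \<subseteq> C" "c \<in> K" "X \<in> space M \<rightarrow> space N" "\<And>A. A \<in> sets N \<Longrightarrow> X -` A \<inter> space M \<in> E c"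
  shows "X \<in> measurable (Sig K) N"
  using assms by (intro measurableI) (auto simp: sets_Sig intro!: sigma_sets.Basic)

lemma indep_sets_Sig:
  assumes "disjoint_family_on K J" "\<And>j. j \<in> J \<Longrightarrow> K j \<subseteq> C"
  shows "indep_sets (\<lambda>j. sets (Sig (K j))) J"
proof -
  have "indep_sets (\<lambda>j. sigma_sets (space M) (\<Union>c\<in>K j. E c)) J"
    using assms by (intro indep_sets_collect_sigma indep_sets_mono_index[OF _ indep]) (auto intro: stable)
  then show ?thesis
    by (rule indep_sets_cong[THEN iffD1, rotated -1]) (use assms in \<open>auto simp: sets_Sig\<close>)
qed

lemma indep_vars_groups:
  assumes "disjoint_family_on K J" "\<And>j. j \<in> J \<Longrightarrow> K j \<subseteq> C"
    and X: "\<And>j. j \<in> J \<Longrightarrow> X j \<in> measurable (Sig (K j)) (N j)"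
  shows "indep_vars N X J"
  unfolding indep_vars_def2
proof (intro conjI ballI)
  fix j assume "j \<in> J" then show "random_variable (N j) (X j)"
    using X assms by (metis measurable_Sig_imp)
next
  show "indep_sets (\<lambda>i. {X i -` A \<inter> space M |A. A \<in> sets (N i)}) J"
    by (rule indep_sets_mono_sets[OF indep_sets_Sig[OF assms(1,2)]])
       (use measurable_sets[OF X] in \<open>auto\<close>)
qed

lemma indep_var_groups:
  assumes "K1 \<inter> K2 = {}" "K1 \<subseteq> C" "K2 \<subseteq> C"
    "X \<in> measurable (Sig K1) N1" "Y \<in> measurable (Sig K2) N2"
  shows "indep_var N1 X N2 Y"
  unfolding indep_var_def
proof (rule indep_vars_groups)
  show "disjoint_family_on (case_bool K1 K2) UNIV"
    using assms by (auto simp: disjoint_family_on_def split: bool.splits)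
qed (use assms in \<open>auto split: bool.splits\<close>)

text \<open>
  The identity is a random element of each of the two sub-sigma-algebras. In this form independence
  speaks about outcomes directly, without a space of values for the variables in each group.
\<close>

lemma diagonal_law:
  assumes K: "K1 \<inter> K2 = {}" "K1 \<subseteq> C" "K2 \<subseteq> C"
  shows "distr M (Sig K1 \<Otimes>\<^sub>M Sig K2) (\<lambda>x. (x, x)) = distr M (Sig K1) (\<lambda>x. x) \<Otimes>\<^sub>M distr M (Sig K2) (\<lambda>x. x)"
proof -
  have "indep_var (Sig K1) (\<lambda>x. x) (Sig K2) (\<lambda>x. x)"
    by (rule indep_var_groups[OF K]) auto
  then show ?thesis unfolding indep_var_distribution_eq by simp
qed

lemma joint_law_groups:
  assumes K: "K1 \<inter> K2 = {}" "K1 \<subseteq> C" "K2 \<subseteq> C"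
    and X: "X \<in> measurable (Sig K1) N1" and Y: "Y \<in> measurable (Sig K2) N2"
  shows "distr M (N1 \<Otimes>\<^sub>M N2) (\<lambda>x. (X x, Y x)) = distr M N1 X \<Otimes>\<^sub>M distr M N2 Y"
proof -
  let ?S = "Sig K1" and ?T = "Sig K2"
  have S: "(\<lambda>x. x) \<in> measurable M ?S" and T: "(\<lambda>x. x) \<in> measurable M ?T"
    using measurable_Sig_imp[OF K(2), of "\<lambda>x. x" ?S] measurable_Sig_imp[OF K(3), of "\<lambda>x. x" ?T] by auto
  have XY: "(\<lambda>z. (X (fst z), Y (snd z))) \<in> measurable (?S \<Otimes>\<^sub>M ?T) (N1 \<Otimes>\<^sub>M N2)"
    using X Y by measurable
  have "distr M (N1 \<Otimes>\<^sub>M N2) (\<lambda>x. (X x, Y x)) =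
      distr (distr M (?S \<Otimes>\<^sub>M ?T) (\<lambda>x. (x, x))) (N1 \<Otimes>\<^sub>M N2) (\<lambda>z. (X (fst z), Y (snd z)))"
    by (subst distr_distr[OF XY]) (auto intro: measurable_Pair S T simp: o_def)
  also have "\<dots> = distr (distr M ?S (\<lambda>x. x)) N1 X \<Otimes>\<^sub>M distr (distr M ?T (\<lambda>x. x)) N2 Y"
  proof (subst pair_measure_distr)
    interpret T: prob_space "distr (distr M ?T (\<lambda>x. x)) N2 Y"
      using Y by (intro prob_space.prob_space_distr prob_space_distr T) simp
    show "sigma_finite_measure (distr (distr M ?T (\<lambda>x. x)) N2 Y)" by unfold_locales
  qed (use X Y in \<open>auto simp: diagonal_law[OF K] split_beta'\<close>)
  also have "\<dots> = distr M N1 X \<Otimes>\<^sub>M distr M N2 Y"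
    using S T X Y by (simp add: distr_distr o_def)
  finally show ?thesis .
qed

text \<open>
  Conditioning on the first group of sources. This is how random times are handled: they are
  constants while the expectation over the processes started at them is taken.
\<close>

lemma freeze:
  fixes H :: "'a \<Rightarrow> 'a \<Rightarrow> real"
  assumes K: "K1 \<inter> K2 = {}" "K1 \<subseteq> C" "K2 \<subseteq> C"
    and H: "case_prod H \<in> borel_measurable (Sig K1 \<Otimes>\<^sub>M Sig K2)"
    and bound: "\<And>x y. x \<in> space M \<Longrightarrow> y \<in> space M \<Longrightarrow> \<bar>H x y\<bar> \<le> B"
  shows "(\<integral>x. H x x \<partial>M) = (\<integral>x. (\<integral>y. H x y \<partial>M) \<partial>M)"
proof -
  let ?S = "Sig K1" and ?T = "Sig K2"
  have S: "(\<lambda>x. x) \<in> measurable M ?S" and T: "(\<lambda>x. x) \<in> measurable M ?T"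
    using measurable_Sig_imp[OF K(2), of "\<lambda>x. x" "Sig K1"] measurable_Sig_imp[OF K(3), of "\<lambda>x. x" "Sig K2"] by auto
  note eq = diagonal_law[OF K]
  interpret S: prob_space "distr M ?S (\<lambda>x. x)" by (rule prob_space_distr) fact
  interpret T: prob_space "distr M ?T (\<lambda>x. x)" by (rule prob_space_distr) fact
  interpret ST: pair_prob_space "distr M ?S (\<lambda>x. x)" "distr M ?T (\<lambda>x. x)" ..
  have H2: "(\<lambda>y. H x y) \<in> borel_measurable ?T" if "x \<in> space M" for x
    using measurable_compose[OF measurable_Pair1'[of x ?S ?T] H] that by simp
  have H3: "(\<lambda>x. \<integral>y. H x y \<partial>distr M ?T (\<lambda>x. x)) \<in> borel_measurable ?S"
    by (rule T.borel_measurable_lebesgue_integral)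
       (use H in \<open>simp cong: measurable_cong_sets sets_pair_measure_cong\<close>)
  have "(\<integral>x. H x x \<partial>M) = (\<integral>z. case_prod H z \<partial>distr M (?S \<Otimes>\<^sub>M ?T) (\<lambda>x. (x, x)))"
    by (subst integral_distr[OF _ H]) (auto intro: measurable_Pair S T)
  also have "\<dots> = (\<integral>x. (\<integral>y. H x y \<partial>distr M ?T (\<lambda>x. x)) \<partial>distr M ?S (\<lambda>x. x))"
    unfolding eq
  proof (subst ST.integral_fst'[symmetric])
    show "integrable (distr M ?S (\<lambda>x. x) \<Otimes>\<^sub>M distr M ?T (\<lambda>x. x)) (case_prod H)"
      by (rule ST.P.integrable_const_bound[of _ B])
        (use H bound in \<open>auto simp: space_pair_measure cong: measurable_cong_sets sets_pair_measure_cong\<close>)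
  qed simp
  also have "\<dots> = (\<integral>x. (\<integral>y. H x y \<partial>distr M ?T (\<lambda>x. x)) \<partial>M)"
    by (subst integral_distr[OF S H3]) simp
  also have "\<dots> = (\<integral>x. (\<integral>y. H x y \<partial>M) \<partial>M)"
    by (intro Bochner_Integration.integral_cong refl integral_distr T H2)
  finally show ?thesis .
qed

lemma expectation_prod_groups:
  fixes X :: "'j \<Rightarrow> 'a \<Rightarrow> real"
  assumes "finite J" "disjoint_family_on K J" "\<And>j. j \<in> J \<Longrightarrow> K j \<subseteq> C"
    and X: "\<And>j. j \<in> J \<Longrightarrow> X j \<in> borel_measurable (Sig (K j))"
    and bound: "\<And>j x. j \<in> J \<Longrightarrow> x \<in> space M \<Longrightarrow> \<bar>X j x\<bar> \<le> B j"
  shows "(\<integral>x. (\<Prod>j\<in>J. X j x) \<partial>M) = (\<Prod>j\<in>J. \<integral>x. X j x \<partial>M)"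
proof (rule indep_vars_lebesgue_integral[OF assms(1)])
  show "indep_vars (\<lambda>_. borel) X J" by (rule indep_vars_groups[OF assms(2,3) X])
  show "integrable M (X j)" if "j \<in> J" for j
    by (rule integrable_const_bound[of _ "B j"])
       (use that bound measurable_Sig_imp[OF _ X] assms in \<open>auto\<close>)
qed

text \<open>
  Once the number of factors is frozen, independence leaves \<open>c ^ N\<close>.
\<close>

lemma expectation_random_product:
  fixes X :: "nat \<Rightarrow> 'a \<Rightarrow> real" and N :: "'a \<Rightarrow> nat"
  assumes K: "K0 \<subseteq> C" "\<And>j. K j \<subseteq> C" "\<And>j. K0 \<inter> K j = {}" "disjoint_family K"
    and N: "N \<in> measurable (Sig K0) (count_space UNIV)"
    and law: "\<And>n. prob {x\<in>space M. N x = n} = pmf h n"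
    and X: "\<And>j. X j \<in> borel_measurable (Sig (K j))"
    and bound: "\<And>j x. x \<in> space M \<Longrightarrow> 0 \<le> X j x \<and> X j x \<le> 1"
    and mean: "\<And>j. (\<integral>x. X j x \<partial>M) = c"
  shows "(\<integral>x. (\<Prod>j<N x. X j x) \<partial>M) = pgf h c"
proof -
  let ?K = "\<Union>j. K j"
  have XK: "X j \<in> borel_measurable (Sig ?K)" for j
    by (rule measurable_Sig_mono[OF _ _ X]) (use K in auto)
  have meas: "(\<lambda>z. \<Prod>j<N (fst z). X j (snd z)) \<in> borel_measurable (Sig K0 \<Otimes>\<^sub>M Sig ?K)"
    by (rule measurable_compose_countable[where g="\<lambda>z. N (fst z)" and f="\<lambda>n z. \<Prod>j<n. X j (snd z)"])
       (use N XK in measurable)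
  have Nm: "N \<in> measurable M (count_space UNIV)" using measurable_Sig_imp[OF K(1) N] .
  have distrN: "distr M (count_space UNIV) N = measure_pmf h"
  proof (rule measure_eqI_countable[where A=UNIV])
    fix n
    show "emeasure (distr M (count_space UNIV) N) {n} = emeasure (measure_pmf h) {n}"
      using law[of n] Nm by (simp add: emeasure_distr emeasure_pmf_single emeasure_eq_measure vimage_def Int_def conj_commute)
  qed auto
  have "(\<integral>x. (\<Prod>j<N x. X j x) \<partial>M) = (\<integral>x. (\<integral>y. (\<Prod>j<N x. X j y) \<partial>M) \<partial>M)"
  proof (rule freeze[of K0 ?K _ 1])
    show "(\<lambda>(x, y). \<Prod>j<N x. X j y) \<in> borel_measurable (Sig K0 \<Otimes>\<^sub>M Sig ?K)"
      using meas by (simp add: case_prod_beta)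
    show "K0 \<inter> (\<Union>j. K j) = {}" "(\<Union>j. K j) \<subseteq> C" using K(2,3) by blast+
  qed (use K(1) bound in \<open>auto simp: abs_prod intro!: prod_le_1\<close>)
  also have "\<dots> = (\<integral>x. c ^ N x \<partial>M)"
  proof (intro Bochner_Integration.integral_cong refl)
    fix x
    show "(\<integral>y. (\<Prod>j<N x. X j y) \<partial>M) = c ^ N x"
      using K bound by (subst expectation_prod_groups[where K=K and B="\<lambda>_. 1"])
        (auto simp: mean X disjoint_family_on_def)
  qed
  also have "\<dots> = (\<integral>n. c ^ n \<partial>distr M (count_space UNIV) N)"
    by (subst integral_distr) (auto simp: Nm)
  also have "\<dots> = pgf h c" by (simp add: distrN pgf_def)
  finally show ?thesis .
qed

end

section \<open>Genealogies and the generations alive\<close>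

text \<open>
  The data of the subtree of child \<open>i\<close> of the ancestor.
\<close>

definition shift :: "nat \<Rightarrow> (nat list \<Rightarrow> 'b) \<Rightarrow> nat list \<Rightarrow> 'b" where
  "shift i x u = x (i # u)"

text \<open>
  Generation by generation the family is finite for every realisation, so that the cardinality of this
  set obeys the branching recursion surely. For \<open>population\<close> itself the recursion fails when a
  subtree has exploded.
\<close>

definition alive :: "nat \<Rightarrow> (nat list \<Rightarrow> real) \<Rightarrow> (nat list \<Rightarrow> nat) \<Rightarrow> real \<Rightarrow> nat list set" where
  "alive n \<tau> \<xi> t = {u. length u < n \<and> in_family \<xi> u \<and> birth_time \<tau> u \<le> t \<and> t < birth_time \<tau> u + \<tau> u}"

lemma in_family_Nil [simp]: "in_family \<xi> []"
  by (simp add: in_family_def)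

lemma in_family_Cons: "in_family \<xi> (i # u) \<longleftrightarrow> i < \<xi> [] \<and> in_family (shift i \<xi>) u"
  unfolding in_family_def shift_def by (auto simp: less_Suc_eq_0_disj)

lemma birth_time_Nil [simp]: "birth_time \<tau> [] = 0"
  by (simp add: birth_time_def)

lemma birth_time_Cons: "birth_time \<tau> (i # u) = \<tau> [] + birth_time (shift i \<tau>) u"
  by (simp add: birth_time_def shift_def sum.lessThan_Suc_shift del: sum.lessThan_Suc)

lemma alive_0 [simp]: "alive 0 \<tau> \<xi> t = {}"
  by (simp add: alive_def)

lemma alive_Suc:
  "alive (Suc n) \<tau> \<xi> t = (if 0 \<le> t \<and> t < \<tau> [] then {[]} else {}) \<union>
     (\<Union>i<\<xi> []. (#) i ` alive n (shift i \<tau>) (shift i \<xi>) (t - \<tau> []))"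
  (is "?L = ?R")
proof (rule set_eqI)
  fix u show "u \<in> ?L \<longleftrightarrow> u \<in> ?R"
  proof (cases u)
    case Nil then show ?thesis by (auto simp: alive_def)
  next
    case (Cons i v)
    have "t < \<tau> [] + birth_time (shift i \<tau>) v + \<tau> (i # v) \<longleftrightarrow>
        t - \<tau> [] < birth_time (shift i \<tau>) v + shift i \<tau> v"
      "\<tau> [] + birth_time (shift i \<tau>) v \<le> t \<longleftrightarrow> birth_time (shift i \<tau>) v \<le> t - \<tau> []"
      by (auto simp: shift_def)
    then show ?thesis using Cons
      by (auto simp: alive_def in_family_Cons birth_time_Cons)
  qed
qed

lemma finite_alive [simp]: "finite (alive n \<tau> \<xi> t)"
  by (induction n arbitrary: \<tau> \<xi> t) (auto simp: alive_Suc)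

text \<open>
  The labels are decomposed by their first letter, so the recursion holds for every realisation and
  every real \<open>t\<close>.
\<close>

lemma card_alive_Suc:
  "card (alive (Suc n) \<tau> \<xi> t) = (if 0 \<le> t \<and> t < \<tau> [] then 1 else 0) +
     (\<Sum>i<\<xi> []. card (alive n (shift i \<tau>) (shift i \<xi>) (t - \<tau> [])))"
proof -
  have "card (\<Union>i<\<xi> []. (#) i ` alive n (shift i \<tau>) (shift i \<xi>) (t - \<tau> [])) =
    (\<Sum>i<\<xi> []. card (alive n (shift i \<tau>) (shift i \<xi>) (t - \<tau> [])))"
    by (subst card_UN_disjoint) (auto simp: card_image)
  then show ?thesis
    unfolding alive_Suc by (subst card_Un_disjoint) auto
qed

lemma population_eq_card_UN_alive: "population \<tau> \<xi> t = card (\<Union>n. alive n \<tau> \<xi> t)"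
proof -
  have "(\<Union>n. alive n \<tau> \<xi> t) = {u. in_family \<xi> u \<and> birth_time \<tau> u \<le> t \<and> t < birth_time \<tau> u + \<tau> u}"
    by (auto simp: alive_def)
  then show ?thesis by (simp add: population_def)
qed

lemma alive_eventually_constant:
  assumes "finite (\<Union>n. alive n \<tau> \<xi> t)"
  shows "\<forall>\<^sub>F n in sequentially. card (alive n \<tau> \<xi> t) = population \<tau> \<xi> t"
proof -
  let ?A = "\<lambda>n. alive n \<tau> \<xi> t"
  have "finite (length ` (\<Union>n. ?A n))" using assms by simp
  then obtain m where m: "\<And>u. u \<in> (\<Union>n. ?A n) \<Longrightarrow> length u < m"
    by (metis finite_nat_set_iff_bounded imageI)
  then have "?A n = (\<Union>n. ?A n)" if "m \<le> n" for n
    using that by (fastforce simp: alive_def)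
  then show ?thesis
    unfolding population_eq_card_UN_alive eventually_sequentially by (metis (no_types, lifting))
qed

lemma alive_unbounded:
  assumes "infinite (\<Union>n. alive n \<tau> \<xi> t)"
  shows "\<forall>\<^sub>F n in sequentially. k \<le> card (alive n \<tau> \<xi> t)"
proof -
  let ?A = "\<lambda>n. alive n \<tau> \<xi> t"
  obtain B where B: "B \<subseteq> (\<Union>n. ?A n)" "finite B" "card B = k"
    using infinite_arbitrarily_large[OF assms] by blast
  obtain m where m: "\<And>u. u \<in> B \<Longrightarrow> length u < m"
    using B(2) by (metis finite_nat_set_iff_bounded imageI finite_imageI)
  then have "B \<subseteq> ?A n" if "m \<le> n" for n
    using that B(1) by (fastforce simp: alive_def)
  then show ?thesis
    unfolding eventually_sequentially by (metis B(3) card_mono finite_alive)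
qed

text \<open>
  The value 0 is excluded because it also stands for an explosion.
\<close>

lemma population_eq_iff:
  assumes "0 < k"
  shows "population \<tau> \<xi> t = k \<longleftrightarrow> (\<exists>m. \<forall>n\<ge>m. card (alive n \<tau> \<xi> t) = k)"
proof (cases "finite (\<Union>n. alive n \<tau> \<xi> t)")
  case True
  from alive_eventually_constant[OF this] obtain m
    where m: "\<And>n. n \<ge> m \<Longrightarrow> card (alive n \<tau> \<xi> t) = population \<tau> \<xi> t"
    by (auto simp: eventually_sequentially)
  show ?thesis
  proof
    assume "\<exists>m. \<forall>n\<ge>m. card (alive n \<tau> \<xi> t) = k"
    then obtain m' where "\<forall>n\<ge>m'. card (alive n \<tau> \<xi> t) = k" by blast
    then show "population \<tau> \<xi> t = k" using m[of "max m m'"] by simp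
  qed (use m in auto)
next
  case False
  then have "population \<tau> \<xi> t = 0" by (simp add: population_eq_card_UN_alive)
  moreover from alive_unbounded[OF False, of "Suc k"] obtain m
    where m: "\<And>n. n \<ge> m \<Longrightarrow> Suc k \<le> card (alive n \<tau> \<xi> t)"
    by (auto simp: eventually_sequentially)
  have "\<not> (\<forall>n\<ge>m'. card (alive n \<tau> \<xi> t) = k)" for m'
    using m[of "max m m'"] by (metis max.cobounded1 max.cobounded2 not_less_eq_eq order_refl)
  ultimately show ?thesis using assms by auto
qed

text \<open>
  The measurable space that carries every branching law, whatever the death rate and the offspring law.
\<close>

abbreviation genealogies :: "((nat list \<Rightarrow> real) \<times> (nat list \<Rightarrow> nat)) measure" where
  "genealogies \<equiv> PiM UNIV (\<lambda>_. borel) \<Otimes>\<^sub>M PiM UNIV (\<lambda>_. count_space UNIV)"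

lemma sets_branching_law: "sets (branching_law \<mu> p) = sets genealogies"
  unfolding branching_law_def by (intro sets_pair_measure_cong sets_PiM_cong) auto

lemma measurable_shift:
  "shift i \<in> measurable (PiM UNIV (\<lambda>_. N)) (PiM UNIV (\<lambda>_. N))"
  by (rule measurable_PiM_single')
     (auto simp: shift_def[abs_def] space_PiM PiE_iff)

lemma measurable_card_alive:
  "(\<lambda>(t, \<tau>, \<xi>). card (alive n \<tau> \<xi> t)) \<in> measurable (borel \<Otimes>\<^sub>M genealogies) (count_space UNIV)"
proof (induction n)
  case 0 then show ?case by simp
next
  case (Suc n)
  let ?B = "borel \<Otimes>\<^sub>M genealogies"
  have t: "fst \<in> borel_measurable ?B" by measurable
  have tau: "(\<lambda>z. fst (snd z) u) \<in> borel_measurable ?B" for u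
    by (rule measurable_compose[OF _ measurable_component_singleton[where I=UNIV and M="\<lambda>_. borel"]]) auto
  have xi: "(\<lambda>z. snd (snd z) u) \<in> measurable ?B (count_space UNIV)" for u
    by (rule measurable_compose[OF _ measurable_component_singleton[where I=UNIV and M="\<lambda>_. count_space UNIV"]]) auto
  have "(\<lambda>z. (fst z - fst (snd z) [], shift i (fst (snd z)), shift i (snd (snd z)))) \<in> measurable ?B ?B" for i
    using t tau[of "[]"]
    by (intro measurable_Pair measurable_compose[OF _ measurable_shift]) (auto intro!: borel_measurable_diff)
  from measurable_compose[OF this Suc.IH]
  have rec: "(\<lambda>z. card (alive n (shift i (fst (snd z))) (shift i (snd (snd z))) (fst z - fst (snd z) []))) \<in>
      measurable ?B (count_space UNIV)" for i
    by (simp add: case_prod_beta)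
  have "(\<lambda>z. \<Sum>i<snd (snd z) []. card (alive n (shift i (fst (snd z))) (shift i (snd (snd z))) (fst z - fst (snd z) [])))
     \<in> measurable ?B (count_space UNIV)"
    by (rule measurable_compose_countable[OF _ xi]) (use rec in measurable)
  moreover have "(\<lambda>z. if 0 \<le> fst z \<and> fst z < fst (snd z) [] then 1 else 0::nat) \<in> measurable ?B (count_space UNIV)"
    using t tau[of "[]"] by measurable
  ultimately show ?case
    unfolding card_alive_Suc case_prod_beta by measurable
qed

lemma measurable_population:
  "(\<lambda>(t, \<tau>, \<xi>). population \<tau> \<xi> t) \<in> measurable (borel \<Otimes>\<^sub>M genealogies) (count_space UNIV)"
proof -
  let ?B = "borel \<Otimes>\<^sub>M genealogies"
  let ?f = "\<lambda>(t, \<tau>, \<xi>). population \<tau> \<xi> t"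
  have pos: "?f -` {k} \<inter> space ?B \<in> sets ?B" if "0 < k" for k
  proof -
    have "?f -` {k} \<inter> space ?B = {z \<in> space ?B. \<exists>m. \<forall>n\<ge>m. (\<lambda>(t, \<tau>, \<xi>). card (alive n \<tau> \<xi> t)) z = k}"
      by (rule set_eqI) (simp add: case_prod_beta population_eq_iff[OF that] conj_commute)
    also have "\<dots> \<in> sets ?B" using measurable_card_alive by measurable
    finally show ?thesis .
  qed
  have "?f -` {0} \<inter> space ?B = space ?B - (\<Union>k\<in>{0<..}. ?f -` {k} \<inter> space ?B)" by auto
  also have "\<dots> \<in> sets ?B" using pos by (intro sets.Diff sets.countable_UN'') auto
  finally have "?f -` {k} \<inter> space ?B \<in> sets ?B" for k using pos by (cases "k = 0") auto
  then show ?thesis by (intro measurable_count_space_eq2_countable[THEN iffD2]) auto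
qed

text \<open>
  An exploding realisation has \<open>s\<close> to an infinite power, that is 0, in the limit.
\<close>

lemma power_alive_tendsto:
  fixes s :: real
  assumes "0 \<le> s" "s < 1"
  shows "(\<lambda>n. s ^ card (alive n \<tau> \<xi> t)) \<longlonglongrightarrow>
    (if finite (\<Union>n. alive n \<tau> \<xi> t) then s ^ population \<tau> \<xi> t else 0)"
proof (cases "finite (\<Union>n. alive n \<tau> \<xi> t)")
  case True
  then show ?thesis
    by (auto intro!: tendsto_eventually eventually_mono[OF alive_eventually_constant])
next
  case False
  have "filterlim (\<lambda>n. card (alive n \<tau> \<xi> t)) sequentially sequentially"
    unfolding filterlim_at_top using alive_unbounded[OF False] by auto
  from filterlim_compose[OF LIMSEQ_realpow_zero[OF assms] this] False show ?thesis by simp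
qed

section \<open>Generating functions of one branching system\<close>

lemma integrable_power_pmf [simp]:
  "0 \<le> s \<Longrightarrow> s \<le> 1 \<Longrightarrow> integrable (measure_pmf p) (\<lambda>n. s ^ n :: real)"
  by (rule measure_pmf.integrable_const_bound[where B=1]) (auto simp: power_le_one)

lemma pgf_nonneg: "0 \<le> s \<Longrightarrow> 0 \<le> pgf p s"
  by (simp add: pgf_def)

lemma pgf_le_1: "0 \<le> s \<Longrightarrow> s \<le> 1 \<Longrightarrow> pgf p s \<le> 1"
  unfolding pgf_def by (rule measure_pmf.integral_le_const) (auto simp: power_le_one)

lemma pgf_1 [simp]: "pgf p 1 = 1"
  by (simp add: pgf_def)

lemma pgf_mono: "0 \<le> s \<Longrightarrow> s \<le> t \<Longrightarrow> t \<le> 1 \<Longrightarrow> pgf p s \<le> pgf p t"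
  unfolding pgf_def by (intro integral_mono) (auto simp: power_mono)

text \<open>
  Bernoulli's inequality \<open>s ^ n \<ge> 1 - n (1 - s)\<close>, averaged.
\<close>

lemma pgf_ge_arg:
  assumes "measure_pmf.expectation p real = 1" "0 \<le> s" "s \<le> 1"
  shows "s \<le> pgf p s"
proof -
  have int: "integrable (measure_pmf p) real"
    using assms(1) not_integrable_integral_eq by fastforce
  have "1 - (1 - s) * real n \<le> s ^ n" for n
    using Bernoulli_inequality[of "s - 1" n] assms by (simp add: algebra_simps)
  then have "measure_pmf.expectation p (\<lambda>n. 1 - (1 - s) * real n) \<le> pgf p s"
    unfolding pgf_def using assms int by (intro integral_mono) auto
  then show ?thesis using assms int by simp
qed

lemma borel_measurable_pgf [measurable]: "pgf p \<in> borel_measurable borel"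
  unfolding pgf_def[abs_def]
proof (rule measure_pmf.borel_measurable_lebesgue_integral)
  have "(\<lambda>z. fst z ^ snd z :: real) \<in> borel_measurable (borel \<Otimes>\<^sub>M measure_pmf p)"
  proof (rule measurable_compose_countable[where g=snd and f="\<lambda>n z. fst z ^ n"])
    show "snd \<in> measurable (borel \<Otimes>\<^sub>M measure_pmf p) (count_space UNIV)"
      by (rule measurable_compose[OF measurable_snd]) simp
  qed measurable
  then show "(\<lambda>(s, n). s ^ n :: real) \<in> borel_measurable (borel \<Otimes>\<^sub>M measure_pmf p)"
    by (simp add: split_beta')
qed

lemma continuous_on_pgf: "continuous_on {0..1} (pgf p)"
  unfolding continuous_on_sequentially
proof (intro allI ballI impI)
  fix x :: "nat \<Rightarrow> real" and a assume x: "a \<in> {0..1}" "(\<forall>n. x n \<in> {0..1}) \<and> x \<longlonglongrightarrow> a"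
  have "(\<lambda>n. measure_pmf.expectation p (\<lambda>k. x n ^ k)) \<longlonglongrightarrow> measure_pmf.expectation p (\<lambda>k. a ^ k)"
    by (rule integral_dominated_convergence[where w="\<lambda>_. 1"])
       (use x in \<open>auto intro!: tendsto_intros simp: power_le_one\<close>)
  then show "(pgf p \<circ> x) \<longlonglongrightarrow> pgf p a" by (simp add: pgf_def o_def)
qed

lemma prob_space_branching_law:
  assumes "0 < \<mu>" shows "prob_space (branching_law \<mu> p)"
proof -
  interpret E: prob_space "density lborel (exponential_density \<mu>)"
    using assms by (rule prob_space_exponential_density)
  interpret E': prob_space "PiM UNIV (\<lambda>_::nat list. density lborel (exponential_density \<mu>))"
    by (rule prob_space_PiM) (rule E.prob_space_axioms)
  interpret P': prob_space "PiM UNIV (\<lambda>_::nat list. measure_pmf p)"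
    by (rule prob_space_PiM) (rule measure_pmf.prob_space_axioms)
  interpret pair_prob_space "PiM UNIV (\<lambda>_::nat list. density lborel (exponential_density \<mu>))"
    "PiM UNIV (\<lambda>_::nat list. measure_pmf p)" ..
  show ?thesis unfolding branching_law_def by (rule prob_space_axioms)
qed

definition generation_pgf :: "real \<Rightarrow> nat pmf \<Rightarrow> nat \<Rightarrow> real \<Rightarrow> real \<Rightarrow> real" where
  "generation_pgf \<mu> p n t s = (\<integral>(\<tau>, \<xi>). s ^ card (alive n \<tau> \<xi> t) \<partial>branching_law \<mu> p)"

lemma borel_measurable_power_card_alive:
  "(\<lambda>(t, \<tau>, \<xi>). (s::real) ^ card (alive n \<tau> \<xi> t)) \<in> borel_measurable (borel \<Otimes>\<^sub>M genealogies)"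
  using measurable_compose[OF measurable_card_alive, of "\<lambda>k. s ^ k"] by (simp add: case_prod_beta)

lemma borel_measurable_power_population:
  "(\<lambda>(t, \<tau>, \<xi>). (s::real) ^ population \<tau> \<xi> t) \<in> borel_measurable (borel \<Otimes>\<^sub>M genealogies)"
  using measurable_compose[OF measurable_population, of "\<lambda>k. s ^ k"] by (simp add: case_prod_beta)

lemma power_card_alive_fixed:
  "(\<lambda>(\<tau>, \<xi>). (s::real) ^ card (alive n \<tau> \<xi> t)) \<in> borel_measurable genealogies"
  using measurable_compose[OF measurable_Pair1'[of t borel genealogies] borel_measurable_power_card_alive]
  by (simp add: case_prod_beta)

lemma power_population_fixed:
  "(\<lambda>(\<tau>, \<xi>). (s::real) ^ population \<tau> \<xi> t) \<in> borel_measurable genealogies"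
  using measurable_compose[OF measurable_Pair1'[of t borel genealogies] borel_measurable_power_population]
  by (simp add: case_prod_beta)

lemma
  assumes "0 < \<mu>"
  shows borel_measurable_generation_pgf: "(\<lambda>t. generation_pgf \<mu> p n t s) \<in> borel_measurable borel"
    and borel_measurable_branching_pgf: "(\<lambda>t. branching_pgf \<mu> p t s) \<in> borel_measurable borel"
proof -
  interpret prob_space "branching_law \<mu> p" by (rule prob_space_branching_law[OF assms])
  show "(\<lambda>t. generation_pgf \<mu> p n t s) \<in> borel_measurable borel"
    unfolding generation_pgf_def
    by (rule borel_measurable_lebesgue_integral)
       (use borel_measurable_power_card_alive[of s n] in
        \<open>simp add: split_beta' sets_branching_law cong: measurable_cong_sets sets_pair_measure_cong\<close>)
  show "(\<lambda>t. branching_pgf \<mu> p t s) \<in> borel_measurable borel"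
    unfolding branching_pgf_def
    by (rule borel_measurable_lebesgue_integral)
       (use borel_measurable_power_population[of s] in
        \<open>simp add: split_beta' sets_branching_law cong: measurable_cong_sets sets_pair_measure_cong\<close>)
qed

lemma
  assumes "0 < \<mu>" "0 \<le> s" "s \<le> 1"
  shows generation_pgf_bounds: "0 \<le> generation_pgf \<mu> p n t s" "generation_pgf \<mu> p n t s \<le> 1"
    and branching_pgf_bounds: "0 \<le> branching_pgf \<mu> p t s" "branching_pgf \<mu> p t s \<le> 1"
proof -
  interpret prob_space "branching_law \<mu> p" by (rule prob_space_branching_law[OF assms(1)])
  show "0 \<le> generation_pgf \<mu> p n t s" "0 \<le> branching_pgf \<mu> p t s"
    unfolding generation_pgf_def branching_pgf_def
    using assms by (auto intro!: Bochner_Integration.integral_nonneg)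
  have "integrable (branching_law \<mu> p) (\<lambda>(\<tau>, \<xi>). s ^ card (alive n \<tau> \<xi> t))"
    using power_card_alive_fixed assms
    by (intro integrable_const_bound[where B=1]) (auto simp: power_le_one cong: measurable_cong_sets[OF sets_branching_law])
  then show "generation_pgf \<mu> p n t s \<le> 1"
    unfolding generation_pgf_def using assms by (intro integral_le_const) (auto simp: power_le_one)
  have "integrable (branching_law \<mu> p) (\<lambda>(\<tau>, \<xi>). s ^ population \<tau> \<xi> t)"
    using power_population_fixed assms
    by (intro integrable_const_bound[where B=1]) (auto simp: power_le_one cong: measurable_cong_sets[OF sets_branching_law])
  then show "branching_pgf \<mu> p t s \<le> 1"
    unfolding branching_pgf_def using assms by (intro integral_le_const) (auto simp: power_le_one)
qed

context indep_sources
begin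

text \<open>
  Lifetimes \<open>T u\<close> with sources \<open>a u\<close> and offspring numbers \<open>N u\<close> with sources \<open>b u\<close>.
  The labelling of the sources is left open so that every subtree is again a system.
\<close>

definition branching_system ::
  "real \<Rightarrow> nat pmf \<Rightarrow> (nat list \<Rightarrow> 'a \<Rightarrow> real) \<Rightarrow> (nat list \<Rightarrow> 'a \<Rightarrow> nat) \<Rightarrow>
    (nat list \<Rightarrow> 'i) \<Rightarrow> (nat list \<Rightarrow> 'i) \<Rightarrow> bool" where
  "branching_system \<mu> p T N a b \<longleftrightarrow>
     (\<forall>u. a u \<in> C \<and> b u \<in> C \<and>
       E (a u) = {T u -` A \<inter> space M | A. A \<in> sets borel} \<and>
       E (b u) = {N u -` A \<inter> space M | A. True} \<and>
       distributed M lborel (T u) (exponential_density \<mu>) \<and>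
       N u \<in> measurable M (count_space UNIV) \<and> (\<forall>n. prob {x\<in>space M. N u x = n} = pmf p n)) \<and>
     inj a \<and> inj b \<and> range a \<inter> range b = {}"

lemma branching_system_shift:
  assumes "branching_system \<mu> p T N a b"
  shows "branching_system \<mu> p (shift i T) (shift i N) (shift i a) (shift i b)"
proof -
  have sys: "\<And>u. a u \<in> C \<and> b u \<in> C \<and>
       E (a u) = {T u -` A \<inter> space M | A. A \<in> sets borel} \<and>
       E (b u) = {N u -` A \<inter> space M | A. True} \<and>
       distributed M lborel (T u) (exponential_density \<mu>) \<and>
       N u \<in> measurable M (count_space UNIV) \<and> (\<forall>n. prob {x\<in>space M. N u x = n} = pmf p n)"
    and inj: "inj a" "inj b" and disj: "range a \<inter> range b = {}"
    using assms unfolding branching_system_def by simp_all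
  have "inj (shift i a)" "inj (shift i b)"
    using inj by (auto simp: shift_def inj_def)
  moreover have "range (shift i a) \<inter> range (shift i b) = {}"
    using disj unfolding shift_def by blast
  ultimately show ?thesis
    unfolding branching_system_def using sys[of "i # _"] by (simp add: shift_def)
qed

lemma measurable_lifetime:
  assumes "branching_system \<mu> p T N a b"
  shows "T u \<in> measurable (Sig {a u}) borel"
  by (rule measurable_SigI[where c="a u"]) (use assms in \<open>auto simp: branching_system_def\<close>)

lemma measurable_offspring:
  assumes "branching_system \<mu> p T N a b"
  shows "N u \<in> measurable (Sig {b u}) (count_space UNIV)"
  by (rule measurable_SigI[where c="b u"]) (use assms in \<open>auto simp: branching_system_def\<close>)

lemma measurable_lifetimes:
  assumes "branching_system \<mu> p T N a b" "range a \<subseteq> K" "K \<subseteq> C"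
  shows "(\<lambda>x u. T u x) \<in> measurable (Sig K) (PiM UNIV (\<lambda>_. borel))"
  by (rule measurable_PiM_single')
     (use measurable_Sig_mono[OF _ assms(3) measurable_lifetime[OF assms(1)]] assms(2) in auto)

lemma measurable_offsprings:
  assumes "branching_system \<mu> p T N a b" "range b \<subseteq> K" "K \<subseteq> C"
  shows "(\<lambda>x u. N u x) \<in> measurable (Sig K) (PiM UNIV (\<lambda>_. count_space UNIV))"
  by (rule measurable_PiM_single')
     (use measurable_Sig_mono[OF _ assms(3) measurable_offspring[OF assms(1)]] assms(2) in auto)

lemma measurable_system:
  assumes "branching_system \<mu> p T N a b" "range a \<union> range b \<subseteq> K" "K \<subseteq> C"
  shows "(\<lambda>x. (\<lambda>u. T u x, \<lambda>u. N u x)) \<in> measurable (Sig K) genealogies"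
  using measurable_lifetimes[OF assms(1)] measurable_offsprings[OF assms(1)] assms by auto

text \<open>
  All systems, on whatever probability space, have the law \<open>branching_law\<close>; so a subtree has the
  generating functions of the whole tree.
\<close>

lemma branching_system_law:
  assumes sys: "branching_system \<mu> p T N a b"
  shows "distr M genealogies (\<lambda>x. (\<lambda>u. T u x, \<lambda>u. N u x)) = branching_law \<mu> p"
proof -
  have C: "range a \<subseteq> C" "range b \<subseteq> C" "range a \<inter> range b = {}" "\<And>u. {a u} \<subseteq> C" "\<And>u. {b u} \<subseteq> C"
    and inj: "inj a" "inj b"
    using sys by (auto simp: branching_system_def)
  let ?T = "\<lambda>x u. T u x" and ?N = "\<lambda>x u. N u x"
  let ?PT = "PiM UNIV (\<lambda>_::nat list. borel :: real measure)"
  let ?PN = "PiM UNIV (\<lambda>_::nat list. count_space (UNIV :: nat set))"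
  have "indep_vars (\<lambda>_. borel) T UNIV"
    by (rule indep_vars_groups[OF _ _ measurable_lifetime[OF sys]])
       (use C inj in \<open>auto simp: disjoint_family_on_def inj_def\<close>)
  then have T: "distr M ?PT ?T = PiM UNIV (\<lambda>u. distr M borel (T u))"
    by (subst (asm) indep_vars_iff_distr_eq_PiM)
       (auto simp: restrict_def intro: measurable_Sig_imp[OF C(4) measurable_lifetime[OF sys]])
  have "indep_vars (\<lambda>_. count_space UNIV) N UNIV"
    by (rule indep_vars_groups[OF _ _ measurable_offspring[OF sys]])
       (use C inj in \<open>auto simp: disjoint_family_on_def inj_def\<close>)
  then have N: "distr M ?PN ?N = PiM UNIV (\<lambda>u. distr M (count_space UNIV) (N u))"
    by (subst (asm) indep_vars_iff_distr_eq_PiM)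
       (auto simp: restrict_def intro: measurable_Sig_imp[OF C(5) measurable_offspring[OF sys]])
  have T1: "distr M borel (T u) = density lborel (exponential_density \<mu>)" for u
  proof -
    have "distr M borel (T u) = distr M lborel (T u)" by (rule distr_cong) auto
    then show ?thesis using sys by (simp add: branching_system_def distributed_def)
  qed
  have N1: "distr M (count_space UNIV) (N u) = measure_pmf p" for u
  proof (rule measure_eqI_countable[where A=UNIV])
    fix n
    have "N u \<in> measurable M (count_space UNIV)" "prob {x\<in>space M. N u x = n} = pmf p n"
      using sys by (auto simp: branching_system_def)
    then show "emeasure (distr M (count_space UNIV) (N u)) {n} = emeasure (measure_pmf p) {n}"
      by (simp add: emeasure_distr emeasure_pmf_single emeasure_eq_measure vimage_def Int_def conj_commute)
  qed auto
  have "distr M genealogies (\<lambda>x. (?T x, ?N x)) = distr M ?PT ?T \<Otimes>\<^sub>M distr M ?PN ?N"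
    by (rule joint_law_groups[OF C(3,1,2) measurable_lifetimes[OF sys] measurable_offsprings[OF sys]])
       (use C in auto)
  then show ?thesis by (simp add: T N T1 N1 branching_law_def)
qed

lemma branching_system_expectation:
  fixes H :: "(nat list \<Rightarrow> real) \<times> (nat list \<Rightarrow> nat) \<Rightarrow> real"
  assumes sys: "branching_system \<mu> p T N a b" and H: "H \<in> borel_measurable genealogies"
  shows "(\<integral>x. H (\<lambda>u. T u x, \<lambda>u. N u x) \<partial>M) = (\<integral>z. H z \<partial>branching_law \<mu> p)"
proof -
  have "range a \<union> range b \<subseteq> C" using sys by (auto simp: branching_system_def)
  then have "(\<lambda>x. (\<lambda>u. T u x, \<lambda>u. N u x)) \<in> measurable M genealogies"
    by (intro measurable_Sig_imp[OF order_refl] measurable_system[OF sys]) auto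
  from integral_distr[OF this H] show ?thesis
    by (simp add: branching_system_law[OF sys])
qed

lemma generation_pgf_system:
  assumes "branching_system \<mu> p T N a b"
  shows "(\<integral>x. s ^ card (alive n (\<lambda>u. T u x) (\<lambda>u. N u x) t) \<partial>M) = generation_pgf \<mu> p n t s"
  using branching_system_expectation[OF assms power_card_alive_fixed] by (simp add: generation_pgf_def)

lemma branching_pgf_system:
  assumes "branching_system \<mu> p T N a b"
  shows "(\<integral>x. s ^ population (\<lambda>u. T u x) (\<lambda>u. N u x) t \<partial>M) = branching_pgf \<mu> p t s"
  using branching_system_expectation[OF assms power_population_fixed] by (simp add: branching_pgf_def)

text \<open>
  Conditioning on the death of the ancestor: its lifetime is frozen first, then its offspring number,
  and the subtrees are independent systems. The ancestor contributes a factor \<open>s\<close> while alive.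
\<close>

lemma generation_pgf_Suc:
  assumes sys: "branching_system \<mu> p T N a b" and mu: "0 < \<mu>" and s: "0 \<le> s" "s \<le> 1"
  shows "generation_pgf \<mu> p (Suc n) t s =
    (\<integral>v. exponential_density \<mu> v *
       (s ^ (if 0 \<le> t \<and> t < v then 1 else 0) * pgf p (generation_pgf \<mu> p n (t - v) s)) \<partial>lborel)"
proof -
  define G where "G v i x = s ^ card (alive n (\<lambda>u. shift i T u x) (\<lambda>u. shift i N u x) v)" for v i x
  define e where "e v = s ^ (if 0 \<le> t \<and> t < v then 1 else 0::nat)" for v
  let ?R = "\<lambda>i. range (shift i a) \<union> range (shift i b)"
  let ?K = "{b []} \<union> (\<Union>i. ?R i)"
  have C: "range a \<subseteq> C" "range b \<subseteq> C" "range a \<inter> range b = {}"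
    and inj: "inj a" "inj b"
    using sys by (auto simp: branching_system_def)
  have ab: "a u \<noteq> b v" for u v using C(3) by blast
  have RC: "?R i \<subseteq> C" for i using C by (auto simp: shift_def)
  have disj: "{a []} \<inter> ?K = {}"
  proof -
    have "a [] \<noteq> b u" "a [] = a u \<longleftrightarrow> u = []" for u using ab inj by (auto simp: inj_eq)
    then show ?thesis using ab[of "[]" "[]", symmetric] by (auto simp: shift_def)
  qed
  have disj2: "{b []} \<inter> ?R i = {}" for i
  proof -
    have "b [] \<noteq> a u" "b [] = b u \<longleftrightarrow> u = []" for u using ab[of u "[]"] inj by (auto simp: inj_eq)
    then show ?thesis by (auto simp: shift_def)
  qed
  have disj3: "disjoint_family ?R"
  proof -
    have "a u \<noteq> b v" "a u = a v \<longleftrightarrow> u = v" "b u = b v \<longleftrightarrow> u = v" for u v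
      using ab inj by (auto simp: inj_eq)
    then show ?thesis unfolding disjoint_family_on_def by (auto simp: shift_def) metis+
  qed
  have sysi: "branching_system \<mu> p (shift i T) (shift i N) (shift i a) (shift i b)" for i
    by (rule branching_system_shift[OF sys])
  have Gjoint: "(\<lambda>z. G (fst z) i (snd z)) \<in> borel_measurable (borel \<Otimes>\<^sub>M Sig (?R i))" for i
  proof -
    have "(\<lambda>z. (fst z, (\<lambda>u. shift i T u (snd z), \<lambda>u. shift i N u (snd z)))) \<in>
        measurable (borel \<Otimes>\<^sub>M Sig (?R i)) (borel \<Otimes>\<^sub>M genealogies)"
      using RC[of i] by (intro measurable_Pair measurable_fst measurable_compose[OF measurable_snd measurable_system[OF sysi]]) auto
    from measurable_compose[OF this borel_measurable_power_card_alive[of s n]]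
    show ?thesis by (simp add: G_def case_prod_beta)
  qed
  have Gfix: "G v i \<in> borel_measurable (Sig (?R i))" for v i
    using measurable_compose[OF measurable_Pair1'[of v borel] Gjoint[of i]] by simp
  have G01: "0 \<le> G v i x" "G v i x \<le> 1" for v i x
    using s by (auto simp: G_def power_le_one)
  have e01: "0 \<le> e v" "e v \<le> 1" for v using s by (auto simp: e_def)
  have e_meas [measurable]: "e \<in> borel_measurable borel" unfolding e_def by measurable
  have Nb: "N [] \<in> measurable (Sig {b []}) (count_space UNIV)"
    by (rule measurable_offspring[OF sys])
  have Ta: "T [] \<in> measurable (Sig {a []}) borel"
    by (rule measurable_lifetime[OF sys])
  have step: "s ^ card (alive (Suc n) (\<lambda>u. T u x) (\<lambda>u. N u x) t) =
      e (T [] x) * (\<Prod>i<N [] x. G (t - T [] x) i x)" for x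
    by (simp add: card_alive_Suc e_def G_def power_add power_sum shift_def[abs_def])
  have "generation_pgf \<mu> p (Suc n) t s =
      (\<integral>x. e (T [] x) * (\<Prod>i<N [] x. G (t - T [] x) i x) \<partial>M)"
    unfolding generation_pgf_system[OF sys, symmetric] step ..
  also have "\<dots> = (\<integral>x. (\<integral>y. e (T [] x) * (\<Prod>i<N [] y. G (t - T [] x) i y) \<partial>M) \<partial>M)"
  proof (rule freeze[OF disj, where B=1])
    show "{a []} \<subseteq> C" using C by auto
    show KC: "?K \<subseteq> C" using C RC by blast
    have T1: "(\<lambda>z. T [] (fst z)) \<in> borel_measurable (Sig {a []} \<Otimes>\<^sub>M Sig ?K)"
      by (rule measurable_compose[OF measurable_fst Ta])
    have N1: "(\<lambda>z. N [] (snd z)) \<in> measurable (Sig {a []} \<Otimes>\<^sub>M Sig ?K) (count_space UNIV)"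
      by (rule measurable_compose[OF measurable_snd measurable_Sig_mono[OF _ KC Nb]]) auto
    have G1: "(\<lambda>z. G (t - T [] (fst z)) i (snd z)) \<in> borel_measurable (Sig {a []} \<Otimes>\<^sub>M Sig ?K)" for i
    proof -
      have id: "(\<lambda>y. y) \<in> measurable (Sig ?K) (Sig (?R i))"
        by (rule measurable_Sig_mono[OF _ KC, of "?R i"]) auto
      have "(\<lambda>z. (t - T [] (fst z), snd z)) \<in> measurable (Sig {a []} \<Otimes>\<^sub>M Sig ?K) (borel \<Otimes>\<^sub>M Sig (?R i))"
        using T1 measurable_compose[OF measurable_snd id] by (intro measurable_Pair) auto
      from measurable_compose[OF this Gjoint[of i]] show ?thesis by simp
    qed
    have "(\<lambda>z. \<Prod>i<N [] (snd z). G (t - T [] (fst z)) i (snd z)) \<in> borel_measurable (Sig {a []} \<Otimes>\<^sub>M Sig ?K)"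
      by (rule measurable_compose_countable[OF _ N1]) (use G1 in measurable)
    then show "(\<lambda>(x, y). e (T [] x) * (\<Prod>i<N [] y. G (t - T [] x) i y)) \<in> borel_measurable (Sig {a []} \<Otimes>\<^sub>M Sig ?K)"
      using measurable_compose[OF T1 e_meas] by (simp add: case_prod_beta)
    show "\<bar>e (T [] x) * (\<Prod>i<N [] y. G (t - T [] x) i y)\<bar> \<le> 1" for x y
      using e01[of "T [] x"] G01 by (auto simp: abs_mult abs_prod intro!: mult_le_one prod_le_1 prod_nonneg)
  qed
  also have "\<dots> = (\<integral>x. e (T [] x) * pgf p (generation_pgf \<mu> p n (t - T [] x) s) \<partial>M)"
  proof (intro Bochner_Integration.integral_cong refl)
    fix x
    have "(\<integral>y. (\<Prod>i<N [] y. G (t - T [] x) i y) \<partial>M) = pgf p (generation_pgf \<mu> p n (t - T [] x) s)"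
    proof (rule expectation_random_product[of "{b []}" ?R])
      show "(\<integral>y. G (t - T [] x) i y \<partial>M) = generation_pgf \<mu> p n (t - T [] x) s" for i
        unfolding G_def by (rule generation_pgf_system[OF sysi])
    qed (use C RC disj2 disj3 Nb sys Gfix G01 in \<open>auto simp: branching_system_def\<close>)
    then show "(\<integral>y. e (T [] x) * (\<Prod>i<N [] y. G (t - T [] x) i y) \<partial>M) =
        e (T [] x) * pgf p (generation_pgf \<mu> p n (t - T [] x) s)" by simp
  qed
  also have "\<dots> = (\<integral>v. exponential_density \<mu> v * (e v * pgf p (generation_pgf \<mu> p n (t - v) s)) \<partial>lborel)"
  proof (rule distributed_integral[symmetric])
    show "distributed M lborel (T []) (exponential_density \<mu>)" using sys by (simp add: branching_system_def)
    have "(\<lambda>v. generation_pgf \<mu> p n (t - v) s) \<in> borel_measurable borel"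
      by (rule measurable_compose[OF _ borel_measurable_generation_pgf[OF mu]]) measurable
    then show "(\<lambda>v. e v * pgf p (generation_pgf \<mu> p n (t - v) s)) \<in> borel_measurable lborel"
      by measurable
    show "0 \<le> exponential_density \<mu> v" for v using mu by (simp add: exponential_density_def)
  qed
  finally show ?thesis unfolding e_def .
qed

end

section \<open>The renewal equation\<close>

lemma
  assumes "0 < \<mu>"
  shows integrable_exponential_density: "integrable lborel (exponential_density \<mu>)"
    and integral_exponential_density: "(\<integral>v. exponential_density \<mu> v \<partial>lborel) = 1"
proof -
  interpret prob_space "density lborel (exponential_density \<mu>)"
    using assms by (rule prob_space_exponential_density)
  have nn: "0 \<le> exponential_density \<mu> v" for v using assms by (simp add: exponential_density_def)
  have "(\<integral>\<^sup>+v. ennreal (exponential_density \<mu> v) \<partial>lborel) = ennreal 1"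
    using emeasure_space_1 by (simp add: emeasure_density)
  from nn_integral_eq_integrable[THEN iffD1, OF _ _ _ this] nn
  show "integrable lborel (exponential_density \<mu>)" "(\<integral>v. exponential_density \<mu> v \<partial>lborel) = 1"
    by auto
qed

lemma measurable_branching_law: "measurable (branching_law \<mu> p) N = measurable genealogies N"
  by (rule measurable_cong_sets[OF sets_branching_law refl])

lemma finite_alive_iff_bounded:
  "finite (\<Union>n. alive n \<tau> \<xi> t) \<longleftrightarrow> (\<exists>k. \<forall>n. card (alive n \<tau> \<xi> t) \<le> k)"
proof
  assume "finite (\<Union>n. alive n \<tau> \<xi> t)"
  then show "\<exists>k. \<forall>n. card (alive n \<tau> \<xi> t) \<le> k"
    by (intro exI[of _ "card (\<Union>n. alive n \<tau> \<xi> t)"] allI card_mono) auto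
next
  assume "\<exists>k. \<forall>n. card (alive n \<tau> \<xi> t) \<le> k"
  then obtain k where "\<And>n. card (alive n \<tau> \<xi> t) \<le> k" by blast
  then show "finite (\<Union>n. alive n \<tau> \<xi> t)"
    using alive_unbounded[of \<tau> \<xi> t "Suc k"] unfolding eventually_sequentially
    by (metis not_less_eq_eq order_refl)
qed

context indep_sources
begin

context
  fixes \<mu> p T N a b
  assumes sys: "branching_system \<mu> p T N a b" and mu: "0 < \<mu>"
    and critical: "measure_pmf.expectation p real = 1"
begin

interpretation B: prob_space "branching_law \<mu> p"
  by (rule prob_space_branching_law[OF mu])

lemma density_nonneg: "0 \<le> exponential_density \<mu> v"
  using mu by (simp add: exponential_density_def)

text \<open>
  Negative times occur in the recursion when the ancestor outlives \<open>t\<close>; nobody is alive then.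
\<close>

lemma generation_pgf_negative:
  assumes "0 \<le> s" "s \<le> 1" "t < 0"
  shows "generation_pgf \<mu> p n t s = 1"
  using assms(3)
proof (induction n arbitrary: t)
  case 0 then show ?case by (simp add: generation_pgf_def split_beta' B.prob_space)
next
  case (Suc n)
  have "generation_pgf \<mu> p (Suc n) t s = (\<integral>v. exponential_density \<mu> v \<partial>lborel)"
    unfolding generation_pgf_Suc[OF sys mu assms(1,2)]
    by (intro Bochner_Integration.integral_cong refl)
       (use Suc in \<open>auto simp: exponential_density_def\<close>)
  then show ?case by (simp add: integral_exponential_density mu)
qed

lemma borel_measurable_pgf_generation:
  "(\<lambda>v. pgf p (generation_pgf \<mu> p n (t - v) s)) \<in> borel_measurable borel"
  "(\<lambda>v. pgf p (branching_pgf \<mu> p (t - v) s)) \<in> borel_measurable borel"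
proof -
  have t: "(\<lambda>v. t - v) \<in> borel_measurable borel" by measurable
  show "(\<lambda>v. pgf p (generation_pgf \<mu> p n (t - v) s)) \<in> borel_measurable borel"
    by (rule measurable_compose[OF measurable_compose[OF t borel_measurable_generation_pgf[OF mu]] borel_measurable_pgf])
  show "(\<lambda>v. pgf p (branching_pgf \<mu> p (t - v) s)) \<in> borel_measurable borel"
    by (rule measurable_compose[OF measurable_compose[OF t borel_measurable_branching_pgf[OF mu]] borel_measurable_pgf])
qed

lemma integrable_renewal:
  assumes "0 \<le> s" "s \<le> 1"
  shows "integrable lborel (\<lambda>v. exponential_density \<mu> v *
       (s ^ (if 0 \<le> t \<and> t < v then 1 else 0) * pgf p (generation_pgf \<mu> p n (t - v) s)))"
proof (rule Bochner_Integration.integrable_bound[OF integrable_exponential_density[OF mu]])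
  have [measurable]: "(\<lambda>v. pgf p (generation_pgf \<mu> p n (t - v) s)) \<in> borel_measurable borel"
    by (rule borel_measurable_pgf_generation)
  show "(\<lambda>v. exponential_density \<mu> v *
       (s ^ (if 0 \<le> t \<and> t < v then 1 else 0) * pgf p (generation_pgf \<mu> p n (t - v) s))) \<in> borel_measurable lborel"
    by measurable
  show "AE v in lborel. norm (exponential_density \<mu> v *
       (s ^ (if 0 \<le> t \<and> t < v then 1 else 0) * pgf p (generation_pgf \<mu> p n (t - v) s))) \<le> norm (exponential_density \<mu> v)"
    using assms density_nonneg generation_pgf_bounds[OF mu assms]
    by (intro AE_I2) (auto simp: abs_mult pgf_nonneg pgf_le_1 intro!: mult_left_le mult_le_one)
qed

text \<open>
  By \<open>f(s) \<ge> s\<close> the constant \<open>s\<close> is a subsolution of the recursion.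
\<close>

lemma generation_pgf_ge:
  assumes s: "0 \<le> s" "s \<le> 1"
  shows "s \<le> generation_pgf \<mu> p n t s"
proof (induction n arbitrary: t)
  case 0 then show ?case using s by (simp add: generation_pgf_def split_beta' B.prob_space)
next
  case (Suc n)
  have "s = (\<integral>v. exponential_density \<mu> v * s \<partial>lborel)"
    by (simp add: integral_exponential_density mu)
  also have "\<dots> \<le> generation_pgf \<mu> p (Suc n) t s"
    unfolding generation_pgf_Suc[OF sys mu s]
  proof (intro integral_mono integrable_renewal s integrable_mult_left integrable_exponential_density mu mult_left_mono density_nonneg)
    fix v
    have "s \<le> pgf p (generation_pgf \<mu> p n (t - v) s)"
      using pgf_ge_arg[OF critical generation_pgf_bounds[OF mu s]] Suc order_trans by blast
    then show "s \<le> s ^ (if 0 \<le> t \<and> t < v then 1 else 0) * pgf p (generation_pgf \<mu> p n (t - v) s)"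
      using generation_pgf_negative[OF s, of "t - v"] by auto
  qed
  finally show ?case .
qed

lemma generation_pgf_tendsto_nonexploding:
  assumes s: "0 \<le> s" "s < 1"
  shows "(\<lambda>n. generation_pgf \<mu> p n t s) \<longlonglongrightarrow>
    (\<integral>(\<tau>, \<xi>). (if finite (\<Union>n. alive n \<tau> \<xi> t) then s ^ population \<tau> \<xi> t else 0) \<partial>branching_law \<mu> p)"
    "(\<lambda>(\<tau>, \<xi>). (if finite (\<Union>n. alive n \<tau> \<xi> t) then s ^ population \<tau> \<xi> t else 0)) \<in> borel_measurable (branching_law \<mu> p)"
proof -
  have m: "(\<lambda>(\<tau>, \<xi>). s ^ card (alive n \<tau> \<xi> t)) \<in> borel_measurable (branching_law \<mu> p)" for n
    using power_card_alive_fixed by (simp add: measurable_branching_law)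
  show m2: "(\<lambda>(\<tau>, \<xi>). (if finite (\<Union>n. alive n \<tau> \<xi> t) then s ^ population \<tau> \<xi> t else 0)) \<in> borel_measurable (branching_law \<mu> p)"
    by (rule borel_measurable_LIMSEQ_real[where u="\<lambda>n (\<tau>, \<xi>). s ^ card (alive n \<tau> \<xi> t)", OF _ m]) (use power_alive_tendsto[OF s] in \<open>auto split: prod.splits\<close>)
  show "(\<lambda>n. generation_pgf \<mu> p n t s) \<longlonglongrightarrow>
    (\<integral>(\<tau>, \<xi>). (if finite (\<Union>n. alive n \<tau> \<xi> t) then s ^ population \<tau> \<xi> t else 0) \<partial>branching_law \<mu> p)"
    unfolding generation_pgf_def
    by (rule integral_dominated_convergence[OF m2 m, where w="\<lambda>_. 1"])
       (use power_alive_tendsto[OF s] s in \<open>auto split: prod.splits simp: power_le_one\<close>)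
qed

text \<open>
  In the limit \<open>generation_pgf_ge\<close> says that \<open>s\<close> is at most the expectation of \<open>s ^ Z\<close> over
  the event without explosion. The probability of this event is therefore at least every \<open>s < 1\<close>.
\<close>

lemma no_explosion: "AE z in branching_law \<mu> p. finite (\<Union>n. alive n (fst z) (snd z) t)"
proof -
  let ?F = "{z \<in> space (branching_law \<mu> p). finite (\<Union>n. alive n (fst z) (snd z) t)}"
  have [measurable]: "(\<lambda>z. card (alive n (fst z) (snd z) t)) \<in> measurable (branching_law \<mu> p) (count_space UNIV)" for n
    using measurable_compose[OF measurable_Pair1'[of t borel genealogies] measurable_card_alive, of n]
    by (simp add: case_prod_beta measurable_branching_law)
  have F: "?F \<in> sets (branching_law \<mu> p)"
    unfolding finite_alive_iff_bounded by measurable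
  have ge: "s \<le> B.prob ?F" if s: "0 \<le> s" "s < 1" for s
  proof -
    have "s \<le> (\<integral>(\<tau>, \<xi>). (if finite (\<Union>n. alive n \<tau> \<xi> t) then s ^ population \<tau> \<xi> t else 0) \<partial>branching_law \<mu> p)"
      by (rule LIMSEQ_le_const[OF generation_pgf_tendsto_nonexploding(1)[OF s]]) (use generation_pgf_ge s in auto)
    also have "\<dots> \<le> (\<integral>z. indicator ?F z \<partial>branching_law \<mu> p)"
    proof (rule integral_mono)
      show "integrable (branching_law \<mu> p) (\<lambda>(\<tau>, \<xi>). if finite (\<Union>n. alive n \<tau> \<xi> t) then s ^ population \<tau> \<xi> t else 0)"
        by (rule B.integrable_const_bound[where B=1, OF _ generation_pgf_tendsto_nonexploding(2)[OF s]])
           (use s in \<open>auto simp: power_le_one split: prod.splits\<close>)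
      show "integrable (branching_law \<mu> p) (\<lambda>z. indicator ?F z :: real)"
        by (rule B.integrable_const_bound[where B=1]) (use F in auto)
    qed (use s in \<open>auto simp: power_le_one indicator_def split: prod.splits\<close>)
    also have "\<dots> = B.prob ?F" using F by simp
    finally show ?thesis .
  qed
  have "1 \<le> B.prob ?F"
  proof (rule field_le_epsilon)
    fix e :: real assume "0 < e"
    then show "1 \<le> B.prob ?F + e"
      using ge[of "1 - e"] ge[of 0] by (cases "e \<le> 1") (auto intro: order_trans[of 1 e])
  qed
  then have "B.prob ?F = 1" using B.prob_le_1[of ?F] by linarith
  from B.prob_eq_1[THEN iffD1, OF F this] show ?thesis by auto
qed

lemma generation_pgf_tendsto:
  assumes s: "0 \<le> s" "s < 1"
  shows "(\<lambda>n. generation_pgf \<mu> p n t s) \<longlonglongrightarrow> branching_pgf \<mu> p t s"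
proof -
  have "(\<integral>(\<tau>, \<xi>). (if finite (\<Union>n. alive n \<tau> \<xi> t) then s ^ population \<tau> \<xi> t else 0) \<partial>branching_law \<mu> p)
      = branching_pgf \<mu> p t s"
    unfolding branching_pgf_def
  proof (rule integral_cong_AE)
    show "(\<lambda>(\<tau>, \<xi>). s ^ population \<tau> \<xi> t) \<in> borel_measurable (branching_law \<mu> p)"
      using power_population_fixed by (simp add: measurable_branching_law)
  qed (use generation_pgf_tendsto_nonexploding(2)[OF s] no_explosion[of t] in \<open>auto simp: split_beta'\<close>)
  then show ?thesis using generation_pgf_tendsto_nonexploding(1)[OF s, of t] by (simp only:)
qed

lemma branching_pgf_ge:
  assumes s: "0 \<le> s" "s < 1"
  shows "s \<le> branching_pgf \<mu> p t s"
  by (rule LIMSEQ_le_const[OF generation_pgf_tendsto[OF s]]) (use generation_pgf_ge s in auto)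

lemma branching_pgf_negative:
  assumes s: "0 \<le> s" "s < 1" "t < 0"
  shows "branching_pgf \<mu> p t s = 1"
  by (rule LIMSEQ_unique[OF generation_pgf_tendsto[OF s(1,2)]]) (use generation_pgf_negative s in auto)

lemma branching_pgf_renewal:
  assumes s: "0 \<le> s" "s < 1"
  shows "branching_pgf \<mu> p t s =
    (\<integral>v. exponential_density \<mu> v *
       (s ^ (if 0 \<le> t \<and> t < v then 1 else 0) * pgf p (branching_pgf \<mu> p (t - v) s)) \<partial>lborel)"
proof (rule LIMSEQ_unique[OF LIMSEQ_Suc[OF generation_pgf_tendsto[OF s]]])
  have s1: "s \<le> 1" using s by simp
  have [measurable]: "(\<lambda>v. pgf p (generation_pgf \<mu> p n (t - v) s)) \<in> borel_measurable borel"
      "(\<lambda>v. pgf p (branching_pgf \<mu> p (t - v) s)) \<in> borel_measurable borel" for n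
    by (rule borel_measurable_pgf_generation)+
  show "(\<lambda>n. generation_pgf \<mu> p (Suc n) t s) \<longlonglongrightarrow>
    (\<integral>v. exponential_density \<mu> v *
       (s ^ (if 0 \<le> t \<and> t < v then 1 else 0) * pgf p (branching_pgf \<mu> p (t - v) s)) \<partial>lborel)"
    unfolding generation_pgf_Suc[OF sys mu s(1) s1]
  proof (rule integral_dominated_convergence[OF _ _ integrable_exponential_density[OF mu]])
    show "AE v in lborel. (\<lambda>n. exponential_density \<mu> v *
       (s ^ (if 0 \<le> t \<and> t < v then 1 else 0) * pgf p (generation_pgf \<mu> p n (t - v) s))) \<longlonglongrightarrow>
       exponential_density \<mu> v *
       (s ^ (if 0 \<le> t \<and> t < v then 1 else 0) * pgf p (branching_pgf \<mu> p (t - v) s))"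
    proof (intro AE_I2 tendsto_intros)
      fix v
      show "(\<lambda>n. pgf p (generation_pgf \<mu> p n (t - v) s)) \<longlonglongrightarrow> pgf p (branching_pgf \<mu> p (t - v) s)"
        by (rule continuous_on_tendsto_compose[OF continuous_on_pgf generation_pgf_tendsto[OF s]])
           (use generation_pgf_bounds[OF mu s(1) s1] branching_pgf_bounds[OF mu s(1) s1] in auto)
    qed
    show "AE v in lborel. norm (exponential_density \<mu> v *
       (s ^ (if 0 \<le> t \<and> t < v then 1 else 0) * pgf p (generation_pgf \<mu> p n (t - v) s))) \<le> exponential_density \<mu> v" for n
      using s s1 density_nonneg generation_pgf_bounds[OF mu s(1) s1]
      by (intro AE_I2) (auto simp: abs_mult pgf_nonneg pgf_le_1 intro!: mult_left_le mult_le_one)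
  qed measurable
qed

text \<open>
  Reversing time in the renewal equation takes \<open>t\<close> out of the integrand, so that the solution can
  be differentiated.
\<close>

lemma branching_pgf_integral_equation:
  assumes s: "0 \<le> s" "s < 1" and t: "0 \<le> t"
  shows "branching_pgf \<mu> p t s =
    exp (- \<mu> * t) * (s + (LINT v:{0..t}|lborel. \<mu> * exp (\<mu> * v) * pgf p (branching_pgf \<mu> p v s)))"
proof -
  have s1: "s \<le> 1" using s by simp
  have bounds: "0 \<le> pgf p (branching_pgf \<mu> p v s)" "pgf p (branching_pgf \<mu> p v s) \<le> 1" for v
    using branching_pgf_bounds[OF mu s(1) s1] by (auto simp: pgf_nonneg pgf_le_1)
  have [measurable]: "(\<lambda>v. pgf p (branching_pgf \<mu> p (t - v) s)) \<in> borel_measurable borel"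
    by (rule borel_measurable_pgf_generation)
  note int_d = integrable_exponential_density[OF mu]
  let ?g = "\<lambda>v. exponential_density \<mu> v * pgf p (branching_pgf \<mu> p (t - v) s)"
  have int_g: "integrable lborel ?g"
    by (rule Bochner_Integration.integrable_bound[OF int_d])
       (use bounds density_nonneg in \<open>auto simp: abs_mult intro!: mult_left_le\<close>)
  have tail: "(LINT v:{t<..}|lborel. exponential_density \<mu> v) = exp (- \<mu> * t)"
  proof -
    have D: "distributed M lborel (T []) (exponential_density \<mu>)"
      using sys by (simp add: branching_system_def)
    then have T: "T [] \<in> borel_measurable M" by (simp add: distributed_def)
    have "(\<integral>v. exponential_density \<mu> v * indicator {t<..} v \<partial>lborel) = (\<integral>x. indicator {t<..} (T [] x) \<partial>M)"
      by (rule distributed_integral[OF D]) (auto simp: density_nonneg)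
    also have "\<dots> = (\<integral>x. indicator {x\<in>space M. t < T [] x} x \<partial>M)"
      by (intro Bochner_Integration.integral_cong) (auto simp: indicator_def)
    also have "\<dots> = exp (- \<mu> * t)"
      using exponential_distributedD_gt[OF D t mu] T by (simp add: mult.commute)
    finally show ?thesis by (simp add: set_lebesgue_integral_def mult.commute)
  qed
  have "branching_pgf \<mu> p t s =
     (\<integral>v. s * (indicator {t<..} v * exponential_density \<mu> v) + indicator {0..t} v * ?g v \<partial>lborel)"
    by (subst branching_pgf_renewal[OF s], intro Bochner_Integration.integral_cong refl)
       (use t branching_pgf_negative[OF s] in \<open>auto simp: exponential_density_def indicator_def\<close>)
  also have "\<dots> = s * exp (- \<mu> * t) + (LINT v:{0..t}|lborel. ?g v)"
    using tail int_d int_g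
    by (subst Bochner_Integration.integral_add)
       (auto simp: set_lebesgue_integral_def intro: integrable_real_mult_indicator[of _ _ "\<lambda>x. _ x", simplified mult.commute] integrable_mult_indicator[where 'b=real, simplified])
  also have "(LINT v:{0..t}|lborel. ?g v) =
     (\<integral>v. indicator {0..t} (t - v) * ?g (t - v) \<partial>lborel)"
    unfolding set_lebesgue_integral_def
    by (subst lborel_integral_real_affine[where c="-1" and t=t]) auto
  also have "\<dots> = (\<integral>v. exp (- \<mu> * t) * (indicator {0..t} v * (\<mu> * exp (\<mu> * v) * pgf p (branching_pgf \<mu> p v s))) \<partial>lborel)"
    by (intro Bochner_Integration.integral_cong refl)
       (auto simp: exponential_density_def indicator_def exp_diff exp_minus field_simps)
  also have "\<dots> = exp (- \<mu> * t) * (LINT v:{0..t}|lborel. \<mu> * exp (\<mu> * v) * pgf p (branching_pgf \<mu> p v s))"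
    unfolding set_lebesgue_integral_def by simp
  finally show ?thesis by (simp add: distrib_left)
qed

end

end

section \<open>Products over the points of a Poisson process\<close>

text \<open>
  A bounded measurable solution is an indefinite integral, hence continuous; then the integrand is
  continuous too, and the solution is differentiable. The final estimate, which comes from \<open>P \<le> 1\<close>,
  keeps the solution below 1 if it starts below 1.
\<close>

lemma renewal_ODE:
  fixes F :: "real \<Rightarrow> real"
  assumes eq: "\<And>t. 0 \<le> t \<Longrightarrow> F t = exp (- \<mu> * t) * (s + (LINT v:{0..t}|lborel. \<mu> * exp (\<mu> * v) * P (F v)))"
    and F: "F \<in> borel_measurable borel" "\<And>t. 0 \<le> F t" "\<And>t. F t \<le> 1"
    and P: "continuous_on {0..1} P" "P \<in> borel_measurable borel" "\<And>x. 0 \<le> x \<Longrightarrow> x \<le> 1 \<Longrightarrow> 0 \<le> P x \<and> P x \<le> 1"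
    and mu: "0 < \<mu>" and s: "0 \<le> s"
  shows "F 0 = s" "continuous_on {0..} F"
    "0 \<le> t \<Longrightarrow> (F has_real_derivative \<mu> * (P (F t) - F t)) (at t within {0..})"
    "0 \<le> t \<Longrightarrow> F t \<le> 1 - (1 - s) * exp (- \<mu> * t)"
proof -
  define k where "k v = \<mu> * exp (\<mu> * v) * P (F v)" for v
  define J where "J t = integral {0..t} k" for t
  have [measurable]: "k \<in> borel_measurable borel"
    unfolding k_def using F(1) P(2) by measurable
  have k0: "0 \<le> k v" and k1: "k v \<le> \<mu> * exp (\<mu> * v)" for v
    using P(3) F mu by (auto simp: k_def mult_left_le)
  have intk: "set_integrable lborel {0..t} k" for t
  proof (rule set_integrable_bound)
    show "set_integrable lborel {0..t} (\<lambda>v. \<mu> * exp (\<mu> * v))"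
      by (intro borel_integrable_atLeastAtMost') (auto intro!: continuous_intros)
  qed (use k0 k1 mu in \<open>auto simp: set_borel_measurable_def abs_mult\<close>)
  have Jeq: "(LINT v:{0..t}|lborel. \<mu> * exp (\<mu> * v) * P (F v)) = J t" for t
    using set_borel_integral_eq_integral(2)[OF intk] by (simp add: J_def k_def)
  have k_int: "k integrable_on {0..t}" for t
    using set_borel_integral_eq_integral(1)[OF intk] .
  have eq: "F t = exp (- \<mu> * t) * (s + J t)" if "0 \<le> t" for t
    using eq[OF that] Jeq by simp
  then show "F 0 = s" by (simp add: J_def)
  have contJ: "continuous_on {0..b} J" for b
    unfolding J_def using indefinite_integral_continuous_1[OF k_int[of b]] by simp
  have contF: "continuous_on {0..b} F" for b
    by (subst continuous_on_cong[OF refl eq]) (auto intro!: continuous_intros contJ)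
  then have contF': "continuous_on {0..} F"
    unfolding continuous_on_eq_continuous_within continuous_within
  proof (intro ballI)
    fix x :: real assume x: "x \<in> {0..}"
    have "(F \<longlongrightarrow> F x) (at x within {0..x+1})"
      using contF[of "x+1"] x by (auto simp: continuous_on_def)
    moreover have "at x within {0..} = at x within {0..x+1}"
      by (rule at_within_nhd[of _ "{x-1<..<x+1}"]) auto
    ultimately show "(F \<longlongrightarrow> F x) (at x within {0..})" by simp
  qed
  then show "continuous_on {0..} F" .
  have contk: "continuous_on {0..b} k" for b
  proof -
    have "continuous_on {0..b} (\<lambda>v. P (F v))"
      by (rule continuous_on_compose2[OF P(1) contF]) (use F in auto)
    then show ?thesis unfolding k_def by (intro continuous_intros)
  qed
  {
    assume t: "0 \<le> t"
    have "(J has_real_derivative k t) (at t within {0..t+1})"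
      unfolding J_def by (rule integral_has_real_derivative[OF contk]) (use t in auto)
    then have J': "(J has_real_derivative k t) (at t within {0..})"
      by (subst at_within_nhd[of _ "{t-1<..<t+1}" _ "{0..t+1}"]) auto
    have "((\<lambda>t. exp (- \<mu> * t) * (s + J t)) has_real_derivative
      (- \<mu>) * exp (- \<mu> * t) * (s + J t) + k t * exp (- \<mu> * t)) (at t within {0..})"
      by (auto intro!: derivative_eq_intros J')
    also have "(- \<mu>) * exp (- \<mu> * t) * (s + J t) + k t * exp (- \<mu> * t) = \<mu> * (P (F t) - F t)"
      using eq[OF t] by (simp add: k_def algebra_simps flip: exp_add)
    finally have "((\<lambda>t. exp (- \<mu> * t) * (s + J t)) has_real_derivative \<mu> * (P (F t) - F t)) (at t within {0..})" .
    then show "(F has_real_derivative \<mu> * (P (F t) - F t)) (at t within {0..})"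
      unfolding has_field_derivative_def by (rule has_derivative_transform[rotated 2]) (use t eq in auto)
    have "J t \<le> integral {0..t} (\<lambda>v. \<mu> * exp (\<mu> * v))"
      unfolding J_def
      by (intro integral_le k_int k1 integrable_continuous_interval continuous_intros)
    also have "\<dots> = exp (\<mu> * t) - exp (\<mu> * 0)"
      by (intro integral_unique fundamental_theorem_of_calculus t)
         (auto intro!: derivative_eq_intros simp flip: has_real_derivative_iff_has_vector_derivative)
    finally have "exp (- \<mu> * t) * (s + J t) \<le> exp (- \<mu> * t) * (s + (exp (\<mu> * t) - 1))"
      by (intro mult_left_mono) auto
    also have "\<dots> = 1 - (1 - s) * exp (- \<mu> * t)"
      by (simp add: algebra_simps flip: exp_add)
    finally show "F t \<le> 1 - (1 - s) * exp (- \<mu> * t)" using eq[OF t] by simp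
  }
qed

lemma prod_blocks:
  fixes m :: "nat \<Rightarrow> nat"
  assumes "mono m" "m 0 = 0"
  shows "(\<Prod>k=1..m n. f k) = (\<Prod>i<n. \<Prod>k\<in>{m i<..m (Suc i)}. f k :: 'b :: comm_monoid_mult)"
proof (induction n)
  case 0 then show ?case using assms by simp
next
  case (Suc n)
  have "m n \<le> m (Suc n)" using assms(1) by (simp add: mono_def)
  then have "{1..m (Suc n)} = {1..m n} \<union> {m n<..m (Suc n)}" by auto
  then have "(\<Prod>k=1..m (Suc n). f k) = (\<Prod>k=1..m n. f k) * (\<Prod>k\<in>{m n<..m (Suc n)}. f k)"
    by (simp only:) (intro prod.union_disjoint, auto)
  then show ?case using Suc by simp
qed

lemma (in prob_space) expectation_nat_valued:
  fixes g :: "nat \<Rightarrow> real"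
  assumes X: "X \<in> measurable M (count_space UNIV)" and B: "\<And>k. \<bar>g k\<bar> \<le> B"
  shows "(\<lambda>k. g k * prob {x\<in>space M. X x = k}) sums (\<integral>x. g (X x) \<partial>M)"
proof -
  let ?w = "\<lambda>k. prob {x\<in>space M. X x = k}"
  have eq: "distr M (count_space UNIV) X = density (count_space UNIV) (\<lambda>k. ennreal (?w k))"
  proof (rule measure_eqI_countable[where A=UNIV])
    fix k
    have "emeasure (density (count_space UNIV) (\<lambda>k. ennreal (?w k))) {k} = ?w k"
      by (simp add: emeasure_density nn_integral_count_space_indicator[symmetric] nn_integral_count_space_finite)
    then show "emeasure (distr M (count_space UNIV) X) {k} = emeasure (density (count_space UNIV) (\<lambda>k. ennreal (?w k))) {k}"
      using X by (simp add: emeasure_distr emeasure_eq_measure vimage_def Int_def conj_commute)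
  qed auto
  interpret D: prob_space "distr M (count_space UNIV) X" by (rule prob_space_distr[OF X])
  have "integrable (distr M (count_space UNIV) X) g"
    by (rule D.integrable_const_bound[where B=B]) (use B in auto)
  then have int: "integrable (count_space UNIV) (\<lambda>k. ?w k * g k)"
    unfolding eq by (subst (asm) integrable_real_density) auto
  have "(\<integral>x. g (X x) \<partial>M) = integral\<^sup>L (count_space UNIV) (\<lambda>k. ?w k * g k)"
    using integral_distr[OF X, of g] unfolding eq by (simp add: integral_real_density)
  then show ?thesis
    using sums_integral_count_space_nat[OF int] by (simp add: mult.commute)
qed

lemma (in prob_space) poisson_expectation_power:
  assumes X: "X \<in> measurable M (count_space UNIV)"
    and law: "\<And>k. prob {x\<in>space M. X x = k} = \<Lambda> ^ k / fact k * exp (- \<Lambda>)"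
    and c: "0 \<le> c" "c \<le> 1"
  shows "(\<integral>x. c ^ X x \<partial>M) = exp (- \<Lambda> * (1 - c))"
proof -
  have "(\<lambda>k. c ^ k * (\<Lambda> ^ k / fact k * exp (- \<Lambda>))) sums (\<integral>x. c ^ X x \<partial>M)"
    using expectation_nat_valued[OF X, of "\<lambda>k. c ^ k" 1] c by (simp add: law power_le_one)
  moreover have "(\<lambda>k. ((c * \<Lambda>) ^ k /\<^sub>R fact k) * exp (- \<Lambda>)) sums (exp (c * \<Lambda>) * exp (- \<Lambda>))"
    by (intro sums_mult2 exp_converges)
  then have "(\<lambda>k. c ^ k * (\<Lambda> ^ k / fact k * exp (- \<Lambda>))) sums (exp (c * \<Lambda>) * exp (- \<Lambda>))"
    by (simp add: power_mult_distrib field_simps)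
  ultimately have "(\<integral>x. c ^ X x \<partial>M) = exp (c * \<Lambda>) * exp (- \<Lambda>)"
    by (rule sums_unique2)
  then show ?thesis by (simp add: algebra_simps flip: exp_add)
qed


lemma set_integral_combine:
  fixes f :: "real \<Rightarrow> real"
  assumes "a \<le> b" "b \<le> c" "set_integrable lborel {a..c} f"
  shows "(LINT u:{a..c}|lborel. f u) = (LINT u:{a..b}|lborel. f u) + (LINT u:{b..c}|lborel. f u)"
proof -
  have "set_integrable lborel {a..b} f" "set_integrable lborel {b..c} f"
    using assms by (auto intro: set_integrable_subset[OF assms(3)])
  then show ?thesis
    using Henstock_Kurzweil_Integration.integral_combine[of a b c f] assms set_borel_integral_eq_integral
    by metis
qed

lemma set_integral_partition:
  fixes f :: "real \<Rightarrow> real" and x :: "nat \<Rightarrow> real"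
  assumes "mono x" "set_integrable lborel {x 0..x n} f"
  shows "(\<Sum>i<n. LINT u:{x i..x (Suc i)}|lborel. f u) = (LINT u:{x 0..x n}|lborel. f u)"
  using assms(2)
proof (induction n)
  case 0
  then show ?case using set_borel_integral_eq_integral(2)[OF 0] by simp
next
  case (Suc n)
  have "x 0 \<le> x n" "x n \<le> x (Suc n)" using assms(1) by (auto simp: mono_def)
  then show ?case
    using Suc set_integral_combine[of "x 0" "x n" "x (Suc n)" f]
      set_integrable_subset[OF Suc.prems, of "{x 0..x n}"] by auto
qed

lemma jump_point_le:
  assumes "0 \<le> u" "k \<le> \<nu> u \<omega>"
  shows "jump_point \<nu> k \<omega> \<le> u"
  unfolding jump_point_def by (rule cInf_lower) (use assms in \<open>auto intro: bdd_belowI[of _ 0]\<close>)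

text \<open>
  With \<open>jump_point_le\<close> this locates a jump between two points of a grid by the values of the path
  at these points alone.
\<close>

lemma jump_point_ge:
  assumes mono: "\<And>s t. 0 \<le> s \<Longrightarrow> s \<le> t \<Longrightarrow> \<nu> s \<omega> \<le> \<nu> t \<omega>"
    and "\<nu> v \<omega> < k" "k \<le> \<nu> u \<omega>" "0 \<le> u"
  shows "v \<le> jump_point \<nu> k \<omega>"
  unfolding jump_point_def
proof (rule cInf_greatest)
  show "{t. 0 \<le> t \<and> k \<le> \<nu> t \<omega>} \<noteq> {}" using assms by auto
  fix x assume "x \<in> {t. 0 \<le> t \<and> k \<le> \<nu> t \<omega>}"
  then show "v \<le> x" using mono[of x v] assms(2) by (cases "v \<le> x") auto
qed

text \<open>
  The second alternative is the path that never reaches \<open>k\<close>, where the jump point is the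
  unspecified infimum of the empty set. The first one involves countably many times only.
\<close>

lemma jump_point_less_iff:
  assumes mono: "\<And>s t. 0 \<le> s \<Longrightarrow> s \<le> t \<Longrightarrow> \<nu> s \<omega> \<le> \<nu> t \<omega>"
  shows "jump_point \<nu> k \<omega> < u \<longleftrightarrow>
    (\<exists>v\<in>\<rat>. 0 \<le> v \<and> v < u \<and> k \<le> \<nu> v \<omega>) \<or> ((\<forall>n::nat. \<nu> (real n) \<omega> < k) \<and> Inf {} < u)"
proof (cases "\<exists>t. 0 \<le> t \<and> k \<le> \<nu> t \<omega>")
  case True
  then obtain t where t: "0 \<le> t" "k \<le> \<nu> t \<omega>" by blast
  obtain n where n: "t \<le> real n" using real_arch_simple by blast
  have "\<not> (\<forall>n::nat. \<nu> (real n) \<omega> < k)" using mono[OF t(1) n] t by (metis leD order_trans)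
  moreover have "jump_point \<nu> k \<omega> < u \<longleftrightarrow> (\<exists>v\<in>{t. 0 \<le> t \<and> k \<le> \<nu> t \<omega>}. v < u)"
    unfolding jump_point_def using t by (intro cInf_less_iff) (auto intro: bdd_belowI[of _ 0])
  moreover have "(\<exists>v\<in>{t. 0 \<le> t \<and> k \<le> \<nu> t \<omega>}. v < u) \<longleftrightarrow> (\<exists>v\<in>\<rat>. 0 \<le> v \<and> v < u \<and> k \<le> \<nu> v \<omega>)"
  proof
    assume "\<exists>v\<in>{t. 0 \<le> t \<and> k \<le> \<nu> t \<omega>}. v < u"
    then obtain v where v: "0 \<le> v" "k \<le> \<nu> v \<omega>" "v < u" by auto
    obtain w where "w \<in> \<rat>" "v < w" "w < u" using Rats_dense_in_real[OF v(3)] by blast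
    then show "\<exists>v\<in>\<rat>. 0 \<le> v \<and> v < u \<and> k \<le> \<nu> v \<omega>"
      using v mono[of v w] by (intro bexI[of _ w]) auto
  qed auto
  ultimately show ?thesis by blast
next
  case False
  then have "{t. 0 \<le> t \<and> k \<le> \<nu> t \<omega>} = {}" by auto
  then have "jump_point \<nu> k \<omega> = Inf {}" unfolding jump_point_def by (simp only:)
  moreover have "\<nu> (real n) \<omega> < k" for n using False by (metis not_le of_nat_0_le_iff)
  ultimately show ?thesis using False by auto
qed

lemma borel_measurable_jump_point:
  assumes \<nu>: "\<And>t. 0 \<le> t \<Longrightarrow> \<nu> t \<in> measurable A (count_space UNIV)"
    and mono: "\<And>\<omega> s t. \<omega> \<in> space A \<Longrightarrow> 0 \<le> s \<Longrightarrow> s \<le> t \<Longrightarrow> \<nu> s \<omega> \<le> \<nu> t \<omega>"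
  shows "jump_point \<nu> k \<in> borel_measurable A"
  unfolding borel_measurable_iff_less
proof
  fix u :: real
  have R: "{\<omega>\<in>space A. k \<le> \<nu> v \<omega>} \<in> sets A" "{\<omega>\<in>space A. \<nu> v \<omega> < k} \<in> sets A" if "0 \<le> v" for v
    using \<nu>[OF that] by measurable
  have "{\<omega>\<in>space A. jump_point \<nu> k \<omega> < u} =
     (\<Union>v\<in>{v\<in>\<rat>. 0 \<le> v \<and> v < u}. {\<omega>\<in>space A. k \<le> \<nu> v \<omega>}) \<union>
     {\<omega>\<in>space A. (\<forall>n::nat. \<nu> (real n) \<omega> < k) \<and> Inf {} < u}"
    using jump_point_less_iff[of \<nu>, OF mono] by auto
  also have "\<dots> \<in> sets A"
  proof (intro sets.Un)
    show "(\<Union>v\<in>{v\<in>\<rat>. 0 \<le> v \<and> v < u}. {\<omega>\<in>space A. k \<le> \<nu> v \<omega>}) \<in> sets A"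
      by (intro sets.countable_UN'' countable_subset[OF _ countable_rat] R) auto
    have "{\<omega>\<in>space A. (\<forall>n::nat. \<nu> (real n) \<omega> < k)} \<in> sets A"
      using R(2) by (intro sets.sets_Collect_countable_All) auto
    then show "{\<omega>\<in>space A. (\<forall>n::nat. \<nu> (real n) \<omega> < k) \<and> Inf {} < u} \<in> sets A"
      by (cases "Inf {} < u") auto
  qed
  finally show "{\<omega>\<in>space A. jump_point \<nu> k \<omega> < u} \<in> sets A" .
qed

text \<open>
  The Laplace functional of a Poisson process. Moving every jump to the right end of its cell in a grid
  turns the product into powers of independent Poisson variables, whose expectations are known. As the
  grid is refined, continuity of \<open>\<phi>\<close> gives the limit on both sides.
\<close>

lemma poisson_process_product:
  fixes \<phi> :: "real \<Rightarrow> real"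
  assumes pp: "poisson_process M r \<nu>" and t: "0 \<le> t"
    and cont: "continuous_on {0..t} \<phi>" and \<phi>: "\<And>v. 0 \<le> v \<Longrightarrow> v \<le> t \<Longrightarrow> 0 \<le> \<phi> v \<and> \<phi> v \<le> 1"
  shows "(\<integral>\<omega>. (\<Prod>k=1..\<nu> t \<omega>. \<phi> (t - jump_point \<nu> k \<omega>)) \<partial>M) = exp (- (LINT u:{0..t}|lborel. r u * (1 - \<phi> (t - u))))"
proof -
  interpret prob_space M using pp by (simp add: poisson_process_def)
  have \<nu>_meas: "\<And>t. 0 \<le> t \<Longrightarrow> \<nu> t \<in> measurable M (count_space UNIV)"
    and \<nu>0: "\<And>\<omega>. \<omega> \<in> space M \<Longrightarrow> \<nu> 0 \<omega> = 0"
    and \<nu>_mono: "\<And>\<omega> s t. \<omega> \<in> space M \<Longrightarrow> 0 \<le> s \<Longrightarrow> s \<le> t \<Longrightarrow> \<nu> s \<omega> \<le> \<nu> t \<omega>"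
    and incr: "\<And>(n::nat) t. 0 \<le> t 0 \<Longrightarrow> mono t \<Longrightarrow>
        indep_vars (\<lambda>_. count_space UNIV) (\<lambda>i \<omega>. \<nu> (t (Suc i)) \<omega> - \<nu> (t i) \<omega>) {..<n}"
    and r0: "\<And>t. 0 \<le> t \<Longrightarrow> 0 \<le> r t" and r_int: "\<And>t. 0 \<le> t \<Longrightarrow> set_integrable lborel {0..t} r"
    and law: "\<And>s t k. 0 \<le> s \<Longrightarrow> s \<le> t \<Longrightarrow> \<P>(\<omega> in M. \<nu> t \<omega> - \<nu> s \<omega> = k) =
          (LINT u:{s..t}|lborel. r u) ^ k / fact k * exp (- (LINT u:{s..t}|lborel. r u))"
    using pp unfolding poisson_process_def by auto
  define x where "x n i = real i * t / real (Suc n)" for n i :: nat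
  have x0: "x n 0 = 0" and xn: "x n (Suc n) = t" and x_nonneg: "0 \<le> x n i" for n i
    using t by (auto simp: x_def)
  have x_mono: "mono (x n)" for n
    using t by (auto simp: x_def mono_def intro!: divide_right_mono mult_right_mono)
  have x_step: "x n (Suc i) = x n i + t / real (Suc n)" for n i
    by (simp add: x_def add_divide_distrib distrib_right)
  have x_le: "x n i \<le> t" if "i \<le> Suc n" for n i using x_mono[of n] xn[of n] that by (metis monoD)
  define D where "D n i \<omega> = \<nu> (x n (Suc i)) \<omega> - \<nu> (x n i) \<omega>" for n i \<omega>
  define P where "P n \<omega> = (\<Prod>i<Suc n. \<phi> (t - x n (Suc i)) ^ D n i \<omega>)" for n \<omega>
  define \<Lambda> where "\<Lambda> n i = (LINT u:{x n i..x n (Suc i)}|lborel. r u)" for n i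
  let ?Y = "\<lambda>\<omega>. \<Prod>k=1..\<nu> t \<omega>. \<phi> (t - jump_point \<nu> k \<omega>)"
  have \<phi>x: "0 \<le> \<phi> (t - x n (Suc i))" "\<phi> (t - x n (Suc i)) \<le> 1" if "i < Suc n" for n i
    using \<phi>[of "t - x n (Suc i)"] x_nonneg[of n "Suc i"] x_le[of "Suc i" n] that by auto
  have D_meas: "D n i \<in> measurable M (count_space UNIV)" for n i
    unfolding D_def using \<nu>_meas[OF x_nonneg] by measurable
  have P_meas: "P n \<in> borel_measurable M" for n
    unfolding P_def
    by (intro borel_measurable_prod measurable_compose[OF D_meas]) auto
  have P01: "0 \<le> P n \<omega>" "P n \<omega> \<le> 1" for n \<omega>
    unfolding P_def using \<phi>x by (auto intro!: prod_nonneg prod_le_1 power_le_one simp del: prod.lessThan_Suc)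
  have conv: "(\<lambda>n. P n \<omega>) \<longlonglongrightarrow> ?Y \<omega>" if \<omega>: "\<omega> \<in> space M" for \<omega>
  proof -
    \<comment> \<open>the right end of the cell that contains the \<open>k\<close>-th jump\<close>
    define c where "c n k = (LEAST i. k \<le> \<nu> (x n i) \<omega>)" for n k
    have c1: "c n k = Suc i" if "\<nu> (x n i) \<omega> < k" "k \<le> \<nu> (x n (Suc i)) \<omega>" for n k i
      unfolding c_def
    proof (rule Least_equality)
      fix j assume j: "k \<le> \<nu> (x n j) \<omega>"
      show "Suc i \<le> j"
      proof (rule ccontr)
        assume "\<not> Suc i \<le> j"
        then have "\<nu> (x n j) \<omega> \<le> \<nu> (x n i) \<omega>"
          using \<nu>_mono[OF \<omega> x_nonneg] x_mono[of n] by (simp add: monoD)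
        then show False using j that by simp
      qed
    qed fact
    have Peq: "P n \<omega> = (\<Prod>k=1..\<nu> t \<omega>. \<phi> (t - x n (c n k)))" for n
    proof -
      have "mono (\<lambda>i. \<nu> (x n i) \<omega>)"
        using \<nu>_mono[OF \<omega> x_nonneg] x_mono[of n] by (simp add: mono_def)
      from prod_blocks[OF this, of "\<lambda>k. \<phi> (t - x n (c n k))" "Suc n"]
      have "(\<Prod>k=1..\<nu> t \<omega>. \<phi> (t - x n (c n k))) =
         (\<Prod>i<Suc n. \<Prod>k\<in>{\<nu> (x n i) \<omega><..\<nu> (x n (Suc i)) \<omega>}. \<phi> (t - x n (c n k)))"
        using \<nu>0[OF \<omega>] by (simp add: x0 xn del: prod.lessThan_Suc)
      also have "\<dots> = P n \<omega>"
        unfolding P_def D_def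
      proof (intro prod.cong refl)
        fix i
        have "(\<Prod>k\<in>{\<nu> (x n i) \<omega><..\<nu> (x n (Suc i)) \<omega>}. \<phi> (t - x n (c n k))) =
            (\<Prod>k\<in>{\<nu> (x n i) \<omega><..\<nu> (x n (Suc i)) \<omega>}. \<phi> (t - x n (Suc i)))"
          by (intro prod.cong refl) (use c1[of n i] in auto)
        then show "(\<Prod>k\<in>{\<nu> (x n i) \<omega><..\<nu> (x n (Suc i)) \<omega>}. \<phi> (t - x n (c n k))) =
            \<phi> (t - x n (Suc i)) ^ (\<nu> (x n (Suc i)) \<omega> - \<nu> (x n i) \<omega>)" by simp
      qed
      finally show ?thesis ..
    qed
    have c2: "\<exists>i<Suc n. \<nu> (x n i) \<omega> < k \<and> k \<le> \<nu> (x n (Suc i)) \<omega>" if k: "k \<in> {1..\<nu> t \<omega>}" for n k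
    proof -
      have ex: "k \<le> \<nu> (x n (Suc n)) \<omega>" using k by (simp add: xn)
      then have le: "c n k \<le> Suc n" and ck: "k \<le> \<nu> (x n (c n k)) \<omega>"
        unfolding c_def by (auto intro: Least_le LeastI)
      have "c n k \<noteq> 0" using ck k \<nu>0[OF \<omega>] by (metis atLeastAtMost_iff not_one_le_zero le_zero_eq x0)
      then obtain i where i: "c n k = Suc i" using not0_implies_Suc by blast
      then have "\<not> k \<le> \<nu> (x n i) \<omega>" unfolding c_def by (metis lessI not_less_Least)
      then show ?thesis using i ck le by (intro exI[of _ i]) auto
    qed
    have near: "jump_point \<nu> k \<omega> \<le> x n (c n k) \<and> x n (c n k) \<le> jump_point \<nu> k \<omega> + t / real (Suc n) \<and> x n (c n k) \<le> t"
      if k: "k \<in> {1..\<nu> t \<omega>}" for n k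
    proof -
      obtain i where i: "i < Suc n" "\<nu> (x n i) \<omega> < k" "k \<le> \<nu> (x n (Suc i)) \<omega>" using c2[OF k] by blast
      have "jump_point \<nu> k \<omega> \<le> x n (Suc i)" by (rule jump_point_le[where \<nu>=\<nu>, OF x_nonneg i(3)])
      moreover have "x n i \<le> jump_point \<nu> k \<omega>"
        by (rule jump_point_ge[where \<nu>=\<nu>, OF \<nu>_mono[OF \<omega>] i(2,3) x_nonneg])
      ultimately show ?thesis using c1[OF i(2,3)] x_step[of n i] x_le[of "Suc i" n] i(1) by simp
    qed
    show ?thesis unfolding Peq
    proof (rule tendsto_prod)
      fix k assume k: "k \<in> {1..\<nu> t \<omega>}"
      have lim: "(\<lambda>n. x n (c n k)) \<longlonglongrightarrow> jump_point \<nu> k \<omega>"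
      proof (rule tendsto_sandwich[OF _ _ tendsto_const])
        show "(\<lambda>n. jump_point \<nu> k \<omega> + t / real (Suc n)) \<longlonglongrightarrow> jump_point \<nu> k \<omega>"
          using tendsto_add[OF tendsto_const LIMSEQ_Suc[OF lim_const_over_n[of t]], of "jump_point \<nu> k \<omega>"] by simp
      qed (use near[OF k] in auto)
      have "0 \<le> jump_point \<nu> k \<omega>" "jump_point \<nu> k \<omega> \<le> t"
        using jump_point_ge[of \<nu> \<omega> 0 k t, OF \<nu>_mono[OF \<omega>]] jump_point_le[of t k \<nu> \<omega>] \<nu>0[OF \<omega>] k t by auto
      then show "(\<lambda>n. \<phi> (t - x n (c n k))) \<longlonglongrightarrow> \<phi> (t - jump_point \<nu> k \<omega>)"
        using near[OF k] x_nonneg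
        by (intro continuous_on_tendsto_compose[OF cont] tendsto_intros lim) auto
    qed
  qed
  have EP: "(\<integral>\<omega>. P n \<omega> \<partial>M) = exp (- (\<Sum>i<Suc n. \<Lambda> n i * (1 - \<phi> (t - x n (Suc i)))))" for n
  proof -
    have ind: "indep_vars (\<lambda>_. count_space UNIV) (D n) {..<Suc n}"
      using incr[of "x n" "Suc n"] x0 x_mono by (simp add: D_def[abs_def])
    then have "indep_vars (\<lambda>_. borel) (\<lambda>i \<omega>. \<phi> (t - x n (Suc i)) ^ D n i \<omega>) {..<Suc n}"
      by (rule indep_vars_compose2) auto
    then have "(\<integral>\<omega>. P n \<omega> \<partial>M) = (\<Prod>i<Suc n. \<integral>\<omega>. \<phi> (t - x n (Suc i)) ^ D n i \<omega> \<partial>M)"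
      unfolding P_def
      by (intro indep_vars_lebesgue_integral integrable_const_bound[where B=1])
         (use \<phi>x in \<open>auto intro!: measurable_compose[OF D_meas] simp: power_le_one\<close>)
    also have "\<dots> = (\<Prod>i<Suc n. exp (- \<Lambda> n i * (1 - \<phi> (t - x n (Suc i)))))"
    proof (intro prod.cong refl poisson_expectation_power D_meas)
      show "prob {\<omega> \<in> space M. D n i \<omega> = k} = \<Lambda> n i ^ k / fact k * exp (- \<Lambda> n i)" for i k
        unfolding D_def \<Lambda>_def by (rule law) (use x_nonneg x_mono[of n] in \<open>auto simp: mono_def\<close>)
    qed (use \<phi>x in auto)
    finally show ?thesis by (simp add: exp_sum[symmetric] sum_negf[symmetric] del: sum.lessThan_Suc prod.lessThan_Suc)
  qed
  have lim_exponent: "(\<lambda>n. \<Sum>i<Suc n. \<Lambda> n i * (1 - \<phi> (t - x n (Suc i)))) \<longlonglongrightarrow> (LINT u:{0..t}|lborel. r u * (1 - \<phi> (t - u)))"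
  proof (rule LIMSEQ_I)
    fix e :: real assume e: "0 < e"
    define A where "A = (LINT u:{0..t}|lborel. r u)"
    have A0: "0 \<le> A" unfolding A_def set_lebesgue_integral_def
      by (rule Bochner_Integration.integral_nonneg) (auto simp: indicator_def r0)
    define e' where "e' = e / (A + 1)"
    have e': "0 < e'" "e' * A < e" using e A0 by (auto simp: e'_def field_simps)
    have "uniformly_continuous_on {0..t} \<phi>" by (rule compact_uniformly_continuous[OF cont]) simp
    then obtain d where d: "0 < d" "\<And>a b. a \<in> {0..t} \<Longrightarrow> b \<in> {0..t} \<Longrightarrow> \<bar>a - b\<bar> < d \<Longrightarrow> \<bar>\<phi> a - \<phi> b\<bar> < e'"
      unfolding uniformly_continuous_on_def dist_real_def using e' by metis
    obtain N where N: "t / real (Suc N) < d"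
      using LIMSEQ_Suc[OF lim_const_over_n[of t]] d(1) by (metis LIMSEQ_D abs_less_iff diff_zero order_refl real_norm_def)
    have intf: "set_integrable lborel {0..t} (\<lambda>u. r u * (1 - \<phi> (t - u)))"
    proof (rule set_integrable_bound[OF r_int[OF t]])
      have c: "set_borel_measurable lborel {0..t} (\<lambda>u. 1 - \<phi> (t - u))"
      proof -
        have "set_integrable lborel {0..t} (\<lambda>u. 1 - \<phi> (t - u))"
          by (intro borel_integrable_atLeastAtMost' continuous_intros continuous_on_compose2[OF cont]) auto
        then show ?thesis by (auto simp: set_integrable_def set_borel_measurable_def)
      qed
      have "set_borel_measurable lborel {0..t} (\<lambda>u. r u)"
        using r_int[OF t] by (auto simp: set_integrable_def set_borel_measurable_def)
      then have "(\<lambda>u. (indicator {0..t} u *\<^sub>R r u) * (indicator {0..t} u *\<^sub>R (1 - \<phi> (t - u)))) \<in> borel_measurable lborel"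
        using c unfolding set_borel_measurable_def by (rule borel_measurable_times)
      moreover have "(\<lambda>u. (indicator {0..t} u *\<^sub>R r u) * (indicator {0..t} u *\<^sub>R (1 - \<phi> (t - u)))) =
          (\<lambda>u. indicator {0..t} u *\<^sub>R (r u * (1 - \<phi> (t - u))))"
        by (auto simp: indicator_def)
      ultimately show "set_borel_measurable lborel {0..t} (\<lambda>u. r u * (1 - \<phi> (t - u)))"
        by (simp add: set_borel_measurable_def)
      show "AE u in lborel. u \<in> {0..t} \<longrightarrow> norm (r u * (1 - \<phi> (t - u))) \<le> norm (r u)"
      proof (intro AE_I2 impI)
        fix u assume u: "u \<in> {0..t}"
        then have "\<bar>1 - \<phi> (t - u)\<bar> \<le> 1" using \<phi>[of "t - u"] by auto
        then show "norm (r u * (1 - \<phi> (t - u))) \<le> norm (r u)"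
          by (simp add: abs_mult mult_left_le)
      qed
    qed
    show "\<exists>no. \<forall>n\<ge>no. norm ((\<Sum>i<Suc n. \<Lambda> n i * (1 - \<phi> (t - x n (Suc i)))) - (LINT u:{0..t}|lborel. r u * (1 - \<phi> (t - u)))) < e"
    proof (intro exI allI impI)
      fix n assume n: "N \<le> n"
      have step: "t / real (Suc n) < d"
        by (rule le_less_trans[OF divide_left_mono N]) (use n t in auto)
      have sub: "{x n i..x n (Suc i)} \<subseteq> {0..t}" if "i < Suc n" for i
        using x_nonneg[of n i] x_le[of "Suc i" n] that by auto
      have ri: "set_integrable lborel {x n i..x n (Suc i)} r" if "i < Suc n" for i
        by (rule set_integrable_subset[OF r_int[OF t]]) (use sub that in auto)
      have fi: "set_integrable lborel {x n i..x n (Suc i)} (\<lambda>u. r u * (1 - \<phi> (t - u)))" if "i < Suc n" for i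
        by (rule set_integrable_subset[OF intf]) (use sub that in auto)
      have "(LINT u:{0..t}|lborel. r u * (1 - \<phi> (t - u))) =
          (\<Sum>i<Suc n. LINT u:{x n i..x n (Suc i)}|lborel. r u * (1 - \<phi> (t - u)))"
        using set_integral_partition[OF x_mono, of n "Suc n" "\<lambda>u. r u * (1 - \<phi> (t - u))"] intf by (simp only: x0 xn)
      moreover have A: "A = (\<Sum>i<Suc n. \<Lambda> n i)"
        using set_integral_partition[OF x_mono, of n "Suc n" r] r_int[OF t] by (simp only: x0 xn \<Lambda>_def A_def)
      ultimately have "\<bar>(\<Sum>i<Suc n. \<Lambda> n i * (1 - \<phi> (t - x n (Suc i)))) - (LINT u:{0..t}|lborel. r u * (1 - \<phi> (t - u)))\<bar>
         = \<bar>\<Sum>i<Suc n. \<Lambda> n i * (1 - \<phi> (t - x n (Suc i))) - (LINT u:{x n i..x n (Suc i)}|lborel. r u * (1 - \<phi> (t - u)))\<bar>"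
        by (simp only: sum_subtractf)
      also have "\<dots> \<le> (\<Sum>i<Suc n. \<bar>\<Lambda> n i * (1 - \<phi> (t - x n (Suc i))) - (LINT u:{x n i..x n (Suc i)}|lborel. r u * (1 - \<phi> (t - u)))\<bar>)"
        by (rule sum_abs)
      also have "\<dots> \<le> (\<Sum>i<Suc n. e' * \<Lambda> n i)"
      proof (rule sum_mono)
        fix i assume i: "i \<in> {..<Suc n}"
        let ?S = "{x n i..x n (Suc i)}" and ?c = "1 - \<phi> (t - x n (Suc i))"
        have rci: "set_integrable lborel ?S (\<lambda>u. r u * ?c)"
          using ri[of i] i by (auto intro: set_integrable_mult_left)
        have rei: "set_integrable lborel ?S (\<lambda>u. e' * r u)"
          using ri[of i] i by (auto intro: set_integrable_mult_right)
        have pt: "\<bar>r u * ?c - r u * (1 - \<phi> (t - u))\<bar> \<le> e' * r u" if u: "u \<in> ?S" for u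
        proof -
          have u0: "0 \<le> u" "u \<le> t" using sub[of i] i u by auto
          have "\<bar>(t - u) - (t - x n (Suc i))\<bar> < d" using u step x_step[of n i] by auto
          then have "\<bar>\<phi> (t - u) - \<phi> (t - x n (Suc i))\<bar> < e'"
            using u0 i x_nonneg[of n "Suc i"] x_le[of "Suc i" n] by (intro d(2)) auto
          then have "r u * \<bar>\<phi> (t - u) - \<phi> (t - x n (Suc i))\<bar> \<le> r u * e'"
            using r0[OF u0(1)] by (intro mult_left_mono) auto
          moreover have "r u * ?c - r u * (1 - \<phi> (t - u)) = r u * (\<phi> (t - u) - \<phi> (t - x n (Suc i)))"
            by (simp add: algebra_simps)
          ultimately show ?thesis using r0[OF u0(1)] by (simp add: abs_mult mult.commute)
        qed
        have "\<Lambda> n i * ?c - (LINT u:?S|lborel. r u * (1 - \<phi> (t - u))) = (LINT u:?S|lborel. r u * ?c - r u * (1 - \<phi> (t - u)))"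
          using rci fi[of i] i by (simp add: set_integral_diff \<Lambda>_def)
        moreover have "\<bar>\<dots>\<bar> \<le> (LINT u:?S|lborel. e' * r u)"
        proof -
          have di: "set_integrable lborel ?S (\<lambda>u. r u * ?c - r u * (1 - \<phi> (t - u)))"
            using rci fi[of i] i by (auto intro: set_integral_diff)
          have "(LINT u:?S|lborel. r u * ?c - r u * (1 - \<phi> (t - u))) \<le> (LINT u:?S|lborel. e' * r u)"
            by (rule set_integral_mono[OF di rei]) (use pt in \<open>auto simp: abs_le_iff\<close>)
          moreover have "(LINT u:?S|lborel. - (e' * r u)) \<le> (LINT u:?S|lborel. r u * ?c - r u * (1 - \<phi> (t - u)))"
            by (rule set_integral_mono[OF _ di]) (use pt rei in \<open>auto simp: abs_le_iff set_integrable_def intro: minus_le_iff[THEN iffD1]\<close>)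
          moreover have "(LINT u:?S|lborel. - (e' * r u)) = - (LINT u:?S|lborel. e' * r u)"
            unfolding set_lebesgue_integral_def by (simp flip: Bochner_Integration.integral_minus)
          ultimately show ?thesis by linarith
        qed
        ultimately show "\<bar>\<Lambda> n i * ?c - (LINT u:?S|lborel. r u * (1 - \<phi> (t - u)))\<bar> \<le> e' * \<Lambda> n i"
          by (simp add: \<Lambda>_def)
      qed
      also have "\<dots> = e' * A" unfolding A sum_distrib_left ..
      finally show "norm ((\<Sum>i<Suc n. \<Lambda> n i * (1 - \<phi> (t - x n (Suc i)))) - (LINT u:{0..t}|lborel. r u * (1 - \<phi> (t - u)))) < e"
        using e'(2) by simp
    qed
  qed
  have Y_meas: "?Y \<in> borel_measurable M"
    by (rule borel_measurable_LIMSEQ_real[OF conv P_meas])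
  have "(\<lambda>n. \<integral>\<omega>. P n \<omega> \<partial>M) \<longlonglongrightarrow> (\<integral>\<omega>. ?Y \<omega> \<partial>M)"
    by (rule integral_dominated_convergence[where w="\<lambda>_. 1"]) (use Y_meas P_meas conv P01 in auto)
  moreover have "(\<lambda>n. \<integral>\<omega>. P n \<omega> \<partial>M) \<longlonglongrightarrow> exp (- (LINT u:{0..t}|lborel. r u * (1 - \<phi> (t - u))))"
    unfolding EP by (intro tendsto_intros lim_exponent)
  ultimately show ?thesis by (rule LIMSEQ_unique)
qed

section \<open>The generating function of the immigration process\<close>

lemma measurable_sum_nat:
  fixes f :: "'i \<Rightarrow> 'b \<Rightarrow> nat"
  assumes "\<And>i. i \<in> A \<Longrightarrow> f i \<in> measurable B (count_space UNIV)"
  shows "(\<lambda>x. \<Sum>i\<in>A. f i x) \<in> measurable B (count_space UNIV)"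
  using assms
proof (induction A rule: infinite_finite_induct)
  case (insert a A)
  then have [measurable]: "f a \<in> measurable B (count_space UNIV)"
      "(\<lambda>x. \<Sum>i\<in>A. f i x) \<in> measurable B (count_space UNIV)" by auto
  show ?case using insert(1,2) by simp
qed simp_all

context mbp_poisson_immigration
begin

lemma arrivals_facts:
  shows "\<And>t. 0 \<le> t \<Longrightarrow> \<nu> t \<in> measurable M (count_space UNIV)"
    and "\<And>\<omega>. \<omega> \<in> space M \<Longrightarrow> \<nu> 0 \<omega> = 0"
    and "\<And>\<omega> s t. \<omega> \<in> space M \<Longrightarrow> 0 \<le> s \<Longrightarrow> s \<le> t \<Longrightarrow> \<nu> s \<omega> \<le> \<nu> t \<omega>"
    and "\<And>t. 0 \<le> t \<Longrightarrow> 0 \<le> r t"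
  using arrivals unfolding poisson_process_def by auto

sublocale indep_sources M "source_events M T N I \<nu>" "{c. proper_source c}"
proof
  show "indep_sets (source_events M T N I \<nu>) {c. proper_source c}" by (rule independent)
  have vimage_stable: "Int_stable {X -` A \<inter> space M | A. A \<in> sets B}" for X :: "'a \<Rightarrow> 'c" and B
    unfolding Int_stable_def
  proof safe
    fix A A' assume "A \<in> sets B" "A' \<in> sets B"
    then show "\<exists>A''. X -` A \<inter> space M \<inter> (X -` A' \<inter> space M) = X -` A'' \<inter> space M \<and> A'' \<in> sets B"
      by (intro exI[of _ "A \<inter> A'"]) auto
  qed
  fix c assume "c \<in> {c. proper_source c}"
  show "Int_stable (source_events M T N I \<nu> c)"
  proof (cases c)
    case (Lifetime k j u) then show ?thesis using vimage_stable[of _ borel] by simp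
  next
    case (Offspring k j u) then show ?thesis using vimage_stable[of "N k j u" "count_space UNIV"] by simp
  next
    case (Group_size k) then show ?thesis using vimage_stable[of "I k" "count_space UNIV"] by simp
  next
    case Arrivals
    interpret sigma_algebra "space M" "sigma_sets (space M) {\<nu> t -` A \<inter> space M | t A. 0 \<le> t}"
      by (rule sigma_algebra_sigma_sets) auto
    show ?thesis unfolding Arrivals source_events.simps Int_stable_def using Int by blast
  qed
qed

abbreviation family_sources :: "nat \<Rightarrow> nat \<Rightarrow> source set" where
  "family_sources k j \<equiv> range (Lifetime k j) \<union> range (Offspring k j)"

lemma family_system:
  assumes "1 \<le> k" "1 \<le> j"
  shows "branching_system \<mu> p (T k j) (N k j) (Lifetime k j) (Offspring k j)"
  unfolding branching_system_def
  using assms lifetime offspring_rv offspring by (auto simp: inj_def)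

definition family_size :: "nat \<Rightarrow> nat \<Rightarrow> real \<Rightarrow> 'a \<Rightarrow> nat" where
  "family_size k j v \<omega> = population (\<lambda>u. T k j u \<omega>) (\<lambda>u. N k j u \<omega>) v"

text \<open>
  The number of descendants, at age \<open>v\<close>, of the group that arrives at the \<open>k\<close>-th epoch.
\<close>

definition group_total :: "nat \<Rightarrow> real \<Rightarrow> 'a \<Rightarrow> nat" where
  "group_total k v \<omega> = (\<Sum>j = 1..I k \<omega>. family_size k j v \<omega>)"

abbreviation group_sources :: "nat \<Rightarrow> source set" where
  "group_sources k \<equiv> {Group_size k} \<union> (\<Union>j\<in>{1..}. family_sources k j)"

lemma measurable_family_size:
  assumes "1 \<le> k" "1 \<le> j" "family_sources k j \<subseteq> K" "K \<subseteq> {c. proper_source c}"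
  shows "(\<lambda>z. family_size k j (fst z) (snd z)) \<in> measurable (borel \<Otimes>\<^sub>M Sig K) (count_space UNIV)"
proof -
  have "(\<lambda>z. (fst z, (\<lambda>u. T k j u (snd z), \<lambda>u. N k j u (snd z)))) \<in>
      measurable (borel \<Otimes>\<^sub>M Sig K) (borel \<Otimes>\<^sub>M genealogies)"
    by (intro measurable_Pair measurable_fst measurable_compose[OF measurable_snd
        measurable_system[OF family_system[OF assms(1,2)] assms(3,4)]])
  from measurable_compose[OF this measurable_population]
  show ?thesis by (simp add: family_size_def case_prod_beta)
qed

lemma group_sources_proper: "1 \<le> k \<Longrightarrow> group_sources k \<subseteq> {c. proper_source c}"
  by auto

lemma measurable_group_total:
  assumes "1 \<le> k" "group_sources k \<subseteq> K" "K \<subseteq> {c. proper_source c}"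
  shows "(\<lambda>z. group_total k (fst z) (snd z)) \<in> measurable (borel \<Otimes>\<^sub>M Sig K) (count_space UNIV)"
proof -
  have I: "I k \<in> measurable (Sig K) (count_space UNIV)"
    by (rule measurable_SigI[where c="Group_size k"]) (use assms in auto)
  have m: "(\<lambda>z. family_size k j (fst z) (snd z)) \<in> measurable (borel \<Otimes>\<^sub>M Sig K) (count_space UNIV)"
    if "j \<in> {1..n}" for j n
  proof (rule measurable_family_size[OF assms(1) _ _ assms(3)])
    show "1 \<le> j" "family_sources k j \<subseteq> K"
      using that by (auto intro!: subsetD[OF assms(2)])
  qed
  have "(\<lambda>z. \<Sum>j\<in>{1..n}. family_size k j (fst z) (snd z)) \<in> measurable (borel \<Otimes>\<^sub>M Sig K) (count_space UNIV)" for n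
    by (rule measurable_sum_nat) (rule m)
  then show ?thesis
    unfolding group_total_def
    by (rule measurable_compose_countable[where g="\<lambda>z. I k (snd z)"]) (rule measurable_compose[OF measurable_snd I])
qed

lemma measurable_group_total_fixed:
  assumes "1 \<le> k"
  shows "group_total k v \<in> measurable (Sig (group_sources k)) (count_space UNIV)"
  using measurable_compose[OF measurable_Pair1'[of v borel] measurable_group_total[OF assms order_refl group_sources_proper[OF assms]]]
  by simp

lemma group_pgf:
  assumes k: "1 \<le> k" and s: "0 \<le> s" "s \<le> 1"
  shows "(\<integral>\<omega>. s ^ group_total k v \<omega> \<partial>M) = pgf h (branching_pgf \<mu> p v s)"
proof -
  have "s ^ group_total k v \<omega> = (\<Prod>j<I k \<omega>. s ^ family_size k (Suc j) v \<omega>)" for \<omega>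
    by (simp add: group_total_def power_sum prod.atLeast1_atMost_eq)
  moreover have "(\<integral>\<omega>. (\<Prod>j<I k \<omega>. s ^ family_size k (Suc j) v \<omega>) \<partial>M) = pgf h (branching_pgf \<mu> p v s)"
  proof (rule expectation_random_product[of "{Group_size k}" "\<lambda>j. family_sources k (Suc j)"])
    show "I k \<in> measurable (Sig {Group_size k}) (count_space UNIV)"
      by (rule measurable_SigI[where c="Group_size k"]) (use k in auto)
    show "(\<lambda>\<omega>. s ^ family_size k (Suc j) v \<omega>) \<in> borel_measurable (Sig (family_sources k (Suc j)))" for j
    proof -
      have "family_sources k (Suc j) \<subseteq> {c. proper_source c}" using k by auto
      from measurable_compose[OF measurable_Pair1'[of v borel] measurable_family_size[OF k _ order_refl this]]
      have "(\<lambda>\<omega>. family_size k (Suc j) v \<omega>) \<in> measurable (Sig (family_sources k (Suc j))) (count_space UNIV)" by simp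
      from measurable_compose[OF this, of "\<lambda>n. s ^ n" borel] show ?thesis by simp
    qed
    show "(\<integral>\<omega>. s ^ family_size k (Suc j) v \<omega> \<partial>M) = branching_pgf \<mu> p v s" for j
      unfolding family_size_def by (rule branching_pgf_system[OF family_system[OF k]]) simp
  qed (use k s immigrants in \<open>auto simp: disjoint_family_on_def power_le_one\<close>)
  ultimately show ?thesis by simp
qed

lemma immigration_eq_groups:
  "immigration_process T N I \<nu> t \<omega> = (\<Sum>k = 1..\<nu> t \<omega>. group_total k (t - jump_point \<nu> k \<omega>) \<omega>)"
  by (simp add: immigration_process_def group_total_def family_size_def)

abbreviation "other_sources \<equiv> {c. proper_source c} - {Arrivals}"

lemma measurable_arrivals: "0 \<le> t \<Longrightarrow> \<nu> t \<in> measurable (Sig {Arrivals}) (count_space UNIV)"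
  by (rule measurable_SigI[where c=Arrivals]) (auto intro!: sigma_sets.Basic)

lemma measurable_jump_point_arrivals: "jump_point \<nu> k \<in> borel_measurable (Sig {Arrivals})"
  by (rule borel_measurable_jump_point) (auto intro: measurable_arrivals arrivals_facts)

lemma measurable_group_total_jump:
  assumes "1 \<le> k"
  shows "(\<lambda>z. group_total k (t - jump_point \<nu> k (fst z)) (snd z)) \<in>
    measurable (Sig {Arrivals} \<Otimes>\<^sub>M Sig other_sources) (count_space UNIV)"
proof -
  have S: "(\<lambda>z. jump_point \<nu> k (fst z)) \<in> borel_measurable (Sig {Arrivals} \<Otimes>\<^sub>M Sig other_sources)"
    by (rule measurable_compose[OF measurable_fst measurable_jump_point_arrivals])
  have *: "(\<lambda>z. (t - jump_point \<nu> k (fst z), snd z)) \<in> measurable (Sig {Arrivals} \<Otimes>\<^sub>M Sig other_sources) (borel \<Otimes>\<^sub>M Sig other_sources)"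
    using S by (intro measurable_Pair) auto
  have "group_sources k \<subseteq> other_sources"
  proof (rule subsetI)
    fix c assume "c \<in> group_sources k"
    then show "c \<in> other_sources" using assms by (cases c) auto
  qed
  from measurable_compose[OF * measurable_group_total[OF assms this Diff_subset]]
  show ?thesis unfolding fst_conv snd_conv .
qed

lemma measurable_immigration:
  assumes "0 \<le> t"
  shows "immigration_process T N I \<nu> t \<in> measurable M (count_space UNIV)"
proof -
  let ?P = "Sig {Arrivals} \<Otimes>\<^sub>M Sig other_sources"
  have "(\<lambda>z. \<Sum>k\<in>{1..n}. group_total k (t - jump_point \<nu> k (fst z)) (snd z)) \<in> measurable ?P (count_space UNIV)" for n
    by (rule measurable_sum_nat, rule measurable_group_total_jump) simp
  then have Y: "(\<lambda>z. \<Sum>k\<in>{1..\<nu> t (fst z)}. group_total k (t - jump_point \<nu> k (fst z)) (snd z)) \<in> measurable ?P (count_space UNIV)"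
    by (rule measurable_compose_countable[where g="\<lambda>z. \<nu> t (fst z)"])
       (rule measurable_compose[OF measurable_fst measurable_arrivals[OF assms]])
  have "(\<lambda>x. (x, x)) \<in> measurable M ?P"
  proof (rule measurable_Pair)
    show "(\<lambda>x. x) \<in> measurable M (Sig {Arrivals})"
      by (rule measurable_Sig_imp[OF _ measurable_ident_sets[OF refl]]) simp
    show "(\<lambda>x. x) \<in> measurable M (Sig other_sources)"
      by (rule measurable_Sig_imp[OF Diff_subset measurable_ident_sets[OF refl]])
  qed
  from measurable_compose[OF this Y] show ?thesis
    by (simp add: immigration_eq_groups[abs_def])
qed

text \<open>
  Given the arrivals the ages of the groups are constants, and the groups are independent.
\<close>

lemma immigration_pgf_conditioned:
  assumes t: "0 \<le> t" and s: "0 \<le> s" "s \<le> 1"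
  shows "(\<integral>\<omega>. s ^ immigration_process T N I \<nu> t \<omega> \<partial>M) =
    (\<integral>\<omega>. (\<Prod>k=1..\<nu> t \<omega>. pgf h (branching_pgf \<mu> p (t - jump_point \<nu> k \<omega>) s)) \<partial>M)"
proof -
  let ?P = "Sig {Arrivals} \<Otimes>\<^sub>M Sig other_sources"
  let ?H = "\<lambda>x y. \<Prod>k=1..\<nu> t x. s ^ group_total k (t - jump_point \<nu> k x) y"
  have "(\<integral>\<omega>. s ^ immigration_process T N I \<nu> t \<omega> \<partial>M) = (\<integral>\<omega>. ?H \<omega> \<omega> \<partial>M)"
    by (simp add: immigration_eq_groups power_sum)
  also have "\<dots> = (\<integral>x. (\<integral>y. ?H x y \<partial>M) \<partial>M)"
  proof (rule freeze[where B=1])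
    show "(\<lambda>(x, y). ?H x y) \<in> borel_measurable ?P"
      unfolding split_beta'
      by (rule measurable_compose_countable[where g="\<lambda>z. \<nu> t (fst z)" and f="\<lambda>n z. \<Prod>k=1..n. s ^ group_total k (t - jump_point \<nu> k (fst z)) (snd z)"])
         (auto intro!: borel_measurable_prod measurable_compose[OF measurable_group_total_jump, of _ "\<lambda>n. s ^ n"] 
               measurable_compose[OF measurable_fst measurable_arrivals[OF t]])
  qed (use s in \<open>auto simp: abs_prod power_le_one intro!: prod_le_1\<close>)
  also have "\<dots> = (\<integral>\<omega>. (\<Prod>k=1..\<nu> t \<omega>. pgf h (branching_pgf \<mu> p (t - jump_point \<nu> k \<omega>) s)) \<partial>M)"
  proof (intro Bochner_Integration.integral_cong refl)
    fix x
    have "(\<integral>y. ?H x y \<partial>M) = (\<Prod>k=1..\<nu> t x. \<integral>y. s ^ group_total k (t - jump_point \<nu> k x) y \<partial>M)"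
    proof (rule expectation_prod_groups[where K=group_sources and B="\<lambda>_. 1"])
      show "(\<lambda>y. s ^ group_total k (t - jump_point \<nu> k x) y) \<in> borel_measurable (Sig (group_sources k))" 
        if "k \<in> {1..\<nu> t x}" for k
        by (rule measurable_compose[OF measurable_group_total_fixed]) (use that in auto)
    qed (use s in \<open>auto simp: disjoint_family_on_def power_le_one\<close>)
    also have "\<dots> = (\<Prod>k=1..\<nu> t x. pgf h (branching_pgf \<mu> p (t - jump_point \<nu> k x) s))"
      using s by (intro prod.cong refl group_pgf) auto
    finally show "(\<integral>y. ?H x y \<partial>M) = \<dots>" .
  qed
  finally show ?thesis .
qed

context
  assumes critical: "measure_pmf.expectation p real = 1"
begin

lemma
  assumes s: "0 \<le> s" "s < 1"
  shows branching_pgf_0: "branching_pgf \<mu> p 0 s = s"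
    and continuous_on_branching_pgf: "continuous_on {0..} (\<lambda>t. branching_pgf \<mu> p t s)"
    and branching_pgf_ODE: "0 \<le> t \<Longrightarrow> ((\<lambda>t. branching_pgf \<mu> p t s) has_real_derivative
          \<mu> * (pgf p (branching_pgf \<mu> p t s) - branching_pgf \<mu> p t s)) (at t within {0..})"
    and branching_pgf_less_1: "0 \<le> t \<Longrightarrow> branching_pgf \<mu> p t s < 1"
    and branching_pgf_ge_arg: "s \<le> branching_pgf \<mu> p t s"
proof -
  note sys = family_system[OF order_refl order_refl]
  note ode = renewal_ODE[where F="\<lambda>t. branching_pgf \<mu> p t s" and P="pgf p" and s=s and \<mu>=\<mu>,
      OF branching_pgf_integral_equation[OF sys rate_pos critical s]
         borel_measurable_branching_pgf[OF rate_pos]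
         branching_pgf_bounds[OF rate_pos s(1) less_imp_le[OF s(2)]]
         continuous_on_pgf borel_measurable_pgf _ rate_pos s(1)]
  have P: "\<And>x. 0 \<le> x \<Longrightarrow> x \<le> 1 \<Longrightarrow> 0 \<le> pgf p x \<and> pgf p x \<le> 1"
    by (simp add: pgf_nonneg pgf_le_1)
  show "branching_pgf \<mu> p 0 s = s" by (rule ode(1)) (use P in auto)
  show "continuous_on {0..} (\<lambda>t. branching_pgf \<mu> p t s)" by (rule ode(2)) (use P in auto)
  show "0 \<le> t \<Longrightarrow> ((\<lambda>t. branching_pgf \<mu> p t s) has_real_derivative
          \<mu> * (pgf p (branching_pgf \<mu> p t s) - branching_pgf \<mu> p t s)) (at t within {0..})"
    by (rule ode(3)) (use P in auto)
  assume "0 \<le> t"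
  have "branching_pgf \<mu> p t s \<le> 1 - (1 - s) * exp (- \<mu> * t)" by (rule ode(4)) (use P \<open>0 \<le> t\<close> in auto)
  also have "\<dots> < 1" using s by simp
  finally show "branching_pgf \<mu> p t s < 1" .
next
  show "s \<le> branching_pgf \<mu> p t s"
    by (rule branching_pgf_ge[OF family_system[OF order_refl order_refl] rate_pos critical s])
qed

lemma immigration_pgf:
  assumes t: "0 \<le> t" and s: "0 \<le> s" "s < 1"
  shows "(\<integral>\<omega>. s ^ immigration_process T N I \<nu> t \<omega> \<partial>M) =
    exp (- (LINT u:{0..t}|lborel. r u * immigrant_q \<mu> p h (t - u) s))"
proof -
  have F: "0 \<le> branching_pgf \<mu> p v s" "branching_pgf \<mu> p v s \<le> 1" for v
    using branching_pgf_bounds[OF rate_pos s(1) less_imp_le[OF s(2)]] by auto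
  have "continuous_on {0..t} (\<lambda>v. pgf h (branching_pgf \<mu> p v s))"
    by (rule continuous_on_compose2[OF continuous_on_pgf continuous_on_subset[OF continuous_on_branching_pgf[OF s]]])
       (use F in auto)
  from poisson_process_product[OF arrivals t this] show ?thesis
    using s F immigration_pgf_conditioned[OF t, of s] by (simp add: immigrant_q_def pgf_nonneg pgf_le_1)
qed

end

end

section \<open>Regular variation\<close>

text \<open>
  The classical measure-theoretic argument. Suppose the claim fails along \<open>x n\<close> and \<open>u n\<close>.
  For large \<open>n\<close> the \<open>y\<close> in \<open>[0,2]\<close> with \<open>h (x n + y)\<close> close to \<open>h (x n)\<close> have measure
  above \<open>3/2\<close>, and so do those with \<open>h (x n + u n + y)\<close> close to \<open>h (x n + u n)\<close>. The
  translate by \<open>u n\<close> of the second set meets the first one, as both lie in \<open>[0,3]\<close>; a common point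
  compares \<open>h (x n)\<close> with \<open>h (x n + u n)\<close>.
\<close>

lemma uniform_convergence_additive:
  fixes h :: "real \<Rightarrow> real"
  assumes [measurable]: "h \<in> borel_measurable borel"
    and lim: "\<And>u. ((\<lambda>x. h (x + u) - h x) \<longlongrightarrow> 0) at_top" and e: "0 < e"
  shows "\<forall>\<^sub>F x in at_top. \<forall>u\<in>{0..1}. \<bar>h (x + u) - h x\<bar> < e"
proof (rule ccontr)
  assume "\<not> ?thesis"
  then have "\<exists>x\<ge>real n. \<exists>u\<in>{0..1}. e \<le> \<bar>h (x + u) - h x\<bar>" for n
    unfolding eventually_at_top_linorder by (metis not_less)
  then obtain x u where x: "\<And>n. real n \<le> x n" and u: "\<And>n. u n \<in> {0..1}"
    and bad: "\<And>n. e \<le> \<bar>h (x n + u n) - h (x n)\<bar>"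
    by metis
  have x_top: "filterlim x at_top sequentially"
    by (rule filterlim_at_top_mono[OF filterlim_real_sequentially]) (use x in auto)
  have xu_top: "filterlim (\<lambda>n. x n + u n) at_top sequentially"
    by (rule filterlim_at_top_mono[OF x_top]) (use u in auto)
  define A where "A z n = {y\<in>{0..2}. \<forall>m\<ge>n. \<bar>h (z m + y) - h (z m)\<bar> < e / 2}" for z :: "nat \<Rightarrow> real" and n
  have A_sets: "A z n \<in> sets lborel" for z n
    unfolding A_def by measurable
  have A_sub: "A z n \<subseteq> {0..2}" for z n by (auto simp: A_def)
  have fin: "emeasure lborel (A z n) \<noteq> \<infinity>" for z n
  proof -
    have "emeasure lborel (A z n) \<le> emeasure lborel {0..2::real}" by (rule emeasure_mono[OF A_sub]) simp
    then show ?thesis by (auto simp: top_unique)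
  qed
  have A_lim: "(\<lambda>n. measure lborel (A z n)) \<longlonglongrightarrow> 2" if z: "filterlim z at_top sequentially" for z
  proof -
    have "(\<Union>n. A z n) = {0..2}"
    proof (intro equalityI subsetI)
      fix y :: real assume y: "y \<in> {0..2}"
      have "(\<lambda>m. h (z m + y) - h (z m)) \<longlonglongrightarrow> 0"
        by (rule filterlim_compose[OF lim z])
      then have "\<forall>\<^sub>F m in sequentially. \<bar>h (z m + y) - h (z m)\<bar> < e / 2"
        using tendstoD[OF \<open>_ \<longlonglongrightarrow> 0\<close>, of "e / 2"] e by (simp add: dist_real_def)
      then show "y \<in> (\<Union>n. A z n)"
        using y by (auto simp: A_def eventually_sequentially)
    qed (auto simp: A_def)
    moreover have "incseq (A z)" by (auto simp: incseq_def A_def)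
    ultimately show ?thesis
      using Lim_measure_incseq[of "A z" lborel] A_sets by (auto simp: image_subset_iff)
  qed
  have "\<forall>\<^sub>F n in sequentially. 3/2 < measure lborel (A x n)" "\<forall>\<^sub>F n in sequentially. 3/2 < measure lborel (A (\<lambda>n. x n + u n) n)"
    by (rule order_tendstoD(1)[OF A_lim]; use x_top xu_top in simp)+
  then have "\<forall>\<^sub>F n in sequentially. 3/2 < measure lborel (A x n) \<and> 3/2 < measure lborel (A (\<lambda>n. x n + u n) n)"
    by (rule eventually_conj)
  then obtain n where n: "3/2 < measure lborel (A x n)" "3/2 < measure lborel (A (\<lambda>n. x n + u n) n)"
    by (auto simp: eventually_sequentially)
  let ?B = "(\<lambda>y. y + u n) ` A (\<lambda>n. x n + u n) n"
  have B_eq: "?B = (\<lambda>y. y - u n) -` A (\<lambda>n. x n + u n) n" by force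
  have B_sets: "?B \<in> sets lborel"
    unfolding B_eq using measurable_sets[of "\<lambda>y. y - u n" borel borel "A (\<lambda>n. x n + u n) n"] A_sets by simp
  have B_measure: "measure lborel ?B = measure lborel (A (\<lambda>n. x n + u n) n)"
  proof -
    have "lborel = distr lborel borel (\<lambda>y. y + u n)" 
    proof -
      have "(\<lambda>y. y + u n) = (+) (u n)" by (auto simp: add.commute)
      then show ?thesis using lborel_distr_plus[of "u n"] by (simp only:)
    qed
    then have "measure lborel ?B = measure (distr lborel borel (\<lambda>y. y + u n)) ?B" by simp
    also have "\<dots> = measure lborel ((\<lambda>y. y + u n) -` ?B)" using B_sets by (simp add: measure_distr)
    also have "(\<lambda>y. y + u n) -` ?B = A (\<lambda>n. x n + u n) n" by auto
    finally show ?thesis .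
  qed
  have "A x n \<inter> ?B \<noteq> {}"
  proof
    assume disj: "A x n \<inter> ?B = {}"
    have finB: "emeasure lborel ?B \<noteq> \<infinity>"
    proof -
      have "?B \<subseteq> {0..3}" using A_sub[of "\<lambda>n. x n + u n" n] u[of n] by force
      then have "emeasure lborel ?B \<le> emeasure lborel {0..3::real}" by (rule emeasure_mono) simp
      then show ?thesis by (auto simp: top_unique)
    qed
    have "measure lborel (A x n) + measure lborel ?B = measure lborel (A x n \<union> ?B)"
      using measure_Union[OF fin finB A_sets B_sets disj] by simp
    also have "\<dots> \<le> measure lborel {0..3::real}"
    proof (rule measure_mono_fmeasurable)
      show "A x n \<union> ?B \<subseteq> {0..3}" using A_sub[of x n] A_sub[of "\<lambda>n. x n + u n" n] u[of n] by force
    qed (use A_sets B_sets in \<open>auto simp: fmeasurable_def\<close>)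
    finally show False using n B_measure by simp
  qed
  then obtain y where "y \<in> A x n" "y \<in> ?B" by blast
  then have y: "y \<in> A x n" "y - u n \<in> A (\<lambda>n. x n + u n) n" unfolding B_eq by auto
  have "\<bar>h (x n + y) - h (x n)\<bar> < e / 2" "\<bar>h (x n + u n + (y - u n)) - h (x n + u n)\<bar> < e / 2"
    using y unfolding A_def by blast+
  then show False using bad[of n] by (simp add: abs_if split: if_splits)
qed

text \<open>
  The additive form for \<open>h x = ln (L (exp x))\<close>; the interval \<open>[1/2,1]\<close> corresponds to shifts in
  \<open>[0, ln 2]\<close>, which lies in \<open>[0,1]\<close>.
\<close>

lemma slowly_varying_uniform:
  assumes "slowly_varying L" "0 < e"
  shows "\<forall>\<^sub>F x in at_top. \<forall>c\<in>{1/2..1}. \<bar>L (c * x) / L x - 1\<bar> < e"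
proof -
  obtain a where a: "set_borel_measurable borel {a..} L" "\<And>x. a \<le> x \<Longrightarrow> 0 < L x"
    and lim: "\<And>c. 0 < c \<Longrightarrow> ((\<lambda>x. L (c * x) / L x) \<longlongrightarrow> 1) at_top"
    using assms(1) unfolding slowly_varying_def by blast
  define h where "h x = ln (indicator {a..} (exp x) * L (exp x))" for x
  have [measurable]: "(\<lambda>x. indicator {a..} x * L x) \<in> borel_measurable borel"
    using a(1) by (simp add: set_borel_measurable_def)
  have hm: "h \<in> borel_measurable borel"
    unfolding h_def
    by (rule measurable_compose[OF borel_measurable_exp
        borel_measurable_ln[OF \<open>(\<lambda>x. indicator {a..} x * L x) \<in> _\<close>]])
  have h_eq: "h x = ln (L (exp x))" if "a \<le> exp x" for x using that by (simp add: h_def)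
  have exp_top: "filterlim exp at_top (at_top :: real filter)" by (rule exp_at_top)
  have "((\<lambda>x. h (x + u) - h x) \<longlongrightarrow> 0) at_top" for u
  proof -
    have "((\<lambda>x. L (exp u * exp x) / L (exp x)) \<longlongrightarrow> 1) at_top"
      by (rule filterlim_compose[OF lim exp_top]) simp
    then have "((\<lambda>x. ln (L (exp u * exp x) / L (exp x))) \<longlongrightarrow> ln 1) at_top"
      by (rule tendsto_ln) simp
    moreover have "\<forall>\<^sub>F x in at_top. ln (L (exp u * exp x) / L (exp x)) = h (x + u) - h x"
    proof -
      have "\<forall>\<^sub>F x in at_top. a \<le> exp x" using exp_top by (simp add: filterlim_at_top)
      moreover have "\<forall>\<^sub>F x in at_top. a \<le> exp (x + u)"
        by (rule eventually_compose_filterlim[OF \<open>\<forall>\<^sub>F x in at_top. a \<le> exp x\<close>])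
           (subst add.commute, intro filterlim_tendsto_add_at_top[OF tendsto_const] filterlim_ident)
      ultimately show ?thesis
      proof eventually_elim
        case (elim x)
        then show ?case using a(2)[of "exp x"] a(2)[of "exp (x + u)"]
          by (simp add: h_eq exp_add mult.commute ln_div)
      qed
    qed
    ultimately show ?thesis by (simp add: tendsto_cong)
  qed
  \<comment> \<open>chosen so that \<open>exp d - 1\<close> and \<open>1 - exp (- d)\<close> are both at most \<open>e\<close>\<close>
  define d where "d = ln (1 + e / (1 + e))"
  have d: "0 < d" using assms(2) unfolding d_def by (intro ln_gt_zero) simp
  have "\<forall>\<^sub>F x in at_top. \<forall>u\<in>{0..1}. \<bar>h (x + u) - h x\<bar> < d"
    by (rule uniform_convergence_additive[OF hm _ d]) fact
  then obtain X where "\<forall>x\<ge>X. \<forall>u\<in>{0..1}. \<bar>h (x + u) - h x\<bar> < d"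
    unfolding eventually_at_top_linorder by blast
  then have X: "\<And>x u. X \<le> x \<Longrightarrow> 0 \<le> u \<Longrightarrow> u \<le> 1 \<Longrightarrow> \<bar>h (x + u) - h x\<bar> < d" by simp
  have "\<forall>\<^sub>F x in at_top. 2 * exp X \<le> x \<and> 2 * a \<le> x \<and> 0 < x \<and> a \<le> x"
    by (intro eventually_conj eventually_ge_at_top eventually_gt_at_top)
  then show ?thesis
  proof eventually_elim
    case (elim x)
    show ?case
    proof
      fix c :: real assume c: "c \<in> {1/2..1}"
      have cx: "exp X \<le> c * x" "a \<le> c * x" "0 < c * x" 
      proof -
        have "1 / 2 * x \<le> c * x" using elim c by (intro mult_right_mono) auto
        then show "exp X \<le> c * x" "a \<le> c * x" "0 < c * x" using elim by linarith+
      qed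
      have "ln 2 \<le> (1::real)" using ln_le_minus_one[of 2] by simp
      moreover have "ln c \<ge> ln (1/2)" using c by (subst ln_le_cancel_iff) auto
      ultimately have u: "0 \<le> - ln c" "- ln c \<le> 1" using c by (auto simp: ln_div ln_le_zero_iff)
      have X': "X \<le> ln (c * x)" using cx by (metis ln_exp ln_le_cancel_iff exp_gt_zero)
      have "ln (c * x) + - ln c = ln x" using c elim by (simp add: ln_mult)
      then have "\<bar>h (ln x) - h (ln (c * x))\<bar> < d" using X[OF X' u] by simp
      then have "\<bar>ln (L x) - ln (L (c * x))\<bar> < d" using h_eq cx elim by simp
      then have l: "\<bar>ln (L (c * x) / L x)\<bar> < d" using a(2)[OF cx(2)] a(2)[of x] elim by (simp add: ln_div abs_minus_commute)
      have pos: "0 < L (c * x) / L x" using a(2)[OF cx(2)] a(2)[of x] elim by simp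
      have up: "L (c * x) / L x < exp d" using l pos by (metis abs_less_iff exp_less_cancel_iff exp_ln)
      have lo: "exp (- d) < L (c * x) / L x" using l pos by (metis abs_less_iff exp_less_cancel_iff exp_ln minus_less_iff)
      have "exp d = 1 + e / (1 + e)" using assms(2) by (simp add: d_def add_pos_pos)
      moreover have "e / (1 + e) \<le> e" using assms(2) by (simp add: field_simps)
      moreover have "1 - e / (1 + e) \<le> exp (- d)"
      proof -
        define z where "z = e / (1 + e)"
        have z: "0 < z" using assms(2) by (simp add: z_def)
        have "(1 - z) * (1 + z) \<le> 1" by (simp add: algebra_simps)
        then have "1 - z \<le> 1 / (1 + z)" using z by (simp add: field_simps)
        then show ?thesis using \<open>exp d = _\<close> by (simp add: exp_minus inverse_eq_divide z_def)
      qed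
      ultimately show "\<bar>L (c * x) / L x - 1\<bar> < e" using up lo by linarith
    qed
  qed
qed

text \<open>
  Monotonicity stands in for uniformity: \<open>y\<close> is squeezed between constant multiples of \<open>x\<close>.
\<close>

lemma mono_regularly_varying_ratio:
  fixes g :: "real \<Rightarrow> real" and x y :: "'b \<Rightarrow> real"
  assumes mono: "mono_on {a..} g" and pos: "\<forall>\<^sub>F x in at_top. 0 < g x"
    and rv: "\<And>c. 0 < c \<Longrightarrow> ((\<lambda>x. g (c * x) / g x) \<longlongrightarrow> c powr \<rho>) at_top"
    and x: "filterlim x at_top F" and y: "((\<lambda>t. y t / x t) \<longlongrightarrow> k) F" and k: "0 < k"
  shows "((\<lambda>t. g (y t) / g (x t)) \<longlongrightarrow> k powr \<rho>) F"
proof -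
  have cont: "((\<lambda>c. c powr \<rho>) \<longlongrightarrow> k powr \<rho>) (at k)"
    by (intro tendsto_intros) (use k in auto)
  have large: "\<forall>\<^sub>F t in F. 0 < g (x t) \<and> \<bar>a\<bar> / c \<le> x t \<and> 0 < x t" for c :: real
    using eventually_compose_filterlim[OF pos x] filterlim_at_top[THEN iffD1, OF x]
      filterlim_at_top_dense[THEN iffD1, OF x] by (intro eventually_conj) auto
  have le: "g u / g w \<le> g v / g w" if "0 < g w" "a \<le> u" "u \<le> v" for u v w
    using monoD[of g] mono_onD[OF mono, of u v] that by (auto intro: divide_right_mono)
  show ?thesis
  proof (rule order_tendstoI)
    fix b assume b: "b < k powr \<rho>"
    have "\<forall>\<^sub>F c in at_left k. b < c powr \<rho>"
      by (rule order_tendstoD(1)[OF _ b]) (use cont in \<open>simp add: filterlim_at_split\<close>)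
    moreover have "\<forall>\<^sub>F c in at_left k. 0 < c \<and> c < k"
      using eventually_at_left_real[OF k] by simp
    ultimately obtain c where c: "b < c powr \<rho>" "0 < c" "c < k"
      by (metis (mono_tags, lifting) eventually_conj eventually_happens trivial_limit_at_left_real)
    have "\<forall>\<^sub>F t in F. b < g (c * x t) / g (x t)"
      by (rule order_tendstoD(1)[OF filterlim_compose[OF rv[OF c(2)] x] c(1)])
    moreover have "\<forall>\<^sub>F t in F. c < y t / x t" by (rule order_tendstoD(1)[OF y c(3)])
    ultimately show "\<forall>\<^sub>F t in F. b < g (y t) / g (x t)" using large[of c]
    proof eventually_elim
      case (elim t)
      then have "c * x t < y t" "a \<le> c * x t" using c(2) by (auto simp: field_simps)
      then show ?case using le[of "x t" "c * x t" "y t"] elim by linarith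
    qed
  next
    fix b assume b: "k powr \<rho> < b"
    have "\<forall>\<^sub>F c in at_right k. c powr \<rho> < b"
      by (rule order_tendstoD(2)[OF _ b]) (use cont in \<open>simp add: filterlim_at_split\<close>)
    moreover have "\<forall>\<^sub>F c in at_right k. k < c"
      by (rule eventually_at_right_less)
    ultimately obtain c where c: "c powr \<rho> < b" "k < c"
      by (metis (mono_tags, lifting) eventually_conj eventually_happens trivial_limit_at_right_real)
    have c0: "0 < c" using k c by simp
    have k2: "k / 2 < k" using k by simp
    have "\<forall>\<^sub>F t in F. g (c * x t) / g (x t) < b"
      by (rule order_tendstoD(2)[OF filterlim_compose[OF rv[OF c0] x] c(1)])
    moreover have "\<forall>\<^sub>F t in F. y t / x t < c" by (rule order_tendstoD(2)[OF y c(2)])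
    moreover have "\<forall>\<^sub>F t in F. k / 2 < y t / x t" by (rule order_tendstoD(1)[OF y k2])
    ultimately show "\<forall>\<^sub>F t in F. g (y t) / g (x t) < b" using large[of "k / 2"]
    proof eventually_elim
      case (elim t)
      then have "y t < c * x t" "k / 2 * x t < y t" "a \<le> k / 2 * x t" using k by (auto simp: field_simps)
      then show ?case using le[of "x t" "y t" "c * x t"] elim by linarith
    qed
  qed
qed

section \<open>The critical branching mechanism\<close>

locale critical_offspring =
  fixes p :: "nat pmf" and \<gamma> :: real and L :: "real \<Rightarrow> real"
  assumes critical: "measure_pmf.expectation p real = 1"
    and gamma: "0 < \<gamma>" "\<gamma> \<le> 1"
    and slow: "slowly_varying L"
    and f: "\<And>s. 0 \<le> s \<Longrightarrow> s < 1 \<Longrightarrow> pgf p s = s + (1 - s) powr (\<gamma> + 1) * L (1 / (1 - s))"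
begin

lemma slow_pos: "\<forall>\<^sub>F x in at_top. 0 < L x"
  using slow unfolding slowly_varying_def eventually_at_top_linorder by blast

lemma slow_lim: "0 < c \<Longrightarrow> ((\<lambda>x. L (c * x) / L x) \<longlongrightarrow> 1) at_top"
  using slow unfolding slowly_varying_def by blast

text \<open>
  The function \<open>f(s) - s\<close> is convex, nonnegative and 0 at \<open>s = 1\<close>. Another zero would make it
  vanish on an interval up to 1, where \<open>L\<close> is positive.
\<close>

lemma pgf_gt_arg:
  assumes "0 \<le> u" "u < 1"
  shows "u < pgf p u"
proof (rule ccontr)
  assume "\<not> u < pgf p u"
  then have eq: "pgf p u = u" using pgf_ge_arg[OF critical, of u] assms by simp
  have flat: "pgf p s \<le> s" if s: "u \<le> s" "s < 1" for s
  proof -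
    define w where "w = (s - u) / (1 - u)"
    have w: "0 \<le> w" "w \<le> 1"
      using assms s by (auto simp: w_def field_simps)
    have "w * (1 - u) = s - u" using assms by (simp add: w_def)
    then have s_eq: "s = (1 - w) * u + w * 1" by (simp add: algebra_simps)
    have conv: "s ^ n \<le> (1 - w) * u ^ n + w" for n
    proof (induction n)
      case (Suc n)
      have "s * s ^ n \<le> s * ((1 - w) * u ^ n + w)"
        using Suc s assms by (intro mult_left_mono) auto
      also have "\<dots> = (1 - w) * u ^ Suc n + w - w * (1 - w) * (1 - u) * (1 - u ^ n)"
        by (simp add: s_eq algebra_simps)
      also have "\<dots> \<le> (1 - w) * u ^ Suc n + w"
        using w assms by (simp add: power_le_one)
      finally show ?case by simp
    qed simp
    have "pgf p s \<le> measure_pmf.expectation p (\<lambda>n. (1 - w) * u ^ n + w)"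
      unfolding pgf_def using s assms conv by (intro integral_mono) auto
    also have "\<dots> = (1 - w) * pgf p u + w"
      using assms by (simp add: pgf_def)
    finally show ?thesis using eq s_eq by simp
  qed
  have "\<forall>\<^sub>F x in at_top. 0 < L x \<and> 1 / (1 - u) \<le> x \<and> 1 < x"
    using slow_pos by (intro eventually_conj eventually_ge_at_top eventually_gt_at_top)
  then obtain x where x: "0 < L x" "1 / (1 - u) \<le> x" "1 < x"
    by (auto simp: eventually_at_top_linorder)
  define s where "s = 1 - 1 / x"
  have s: "0 \<le> s" "s < 1" "1 / (1 - s) = x" "u \<le> s" using x assms by (auto simp: s_def field_simps)
  have "0 < (1 - s) powr (\<gamma> + 1) * L x" using x s by simp
  then show False using flat[OF s(4,2)] f[OF s(1,2)] s(3) by simp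
qed

text \<open>
  The function \<open>V\<close> in the variable \<open>y = 1 - 1 / x\<close>, in which it is an antiderivative.
\<close>

definition H :: "real \<Rightarrow> real" where
  "H y = (LINT u:{0..y}|lborel. 1 / (pgf p u - u))"

lemma V_eq_H: "V_fun p x = H (1 - 1 / x)"
  by (simp add: V_fun_def H_def)

lemma continuous_on_integrand:
  assumes "b < 1" shows "continuous_on {0..b} (\<lambda>u. 1 / (pgf p u - u))"
  using pgf_gt_arg assms
  by (intro continuous_intros continuous_on_subset[OF continuous_on_pgf]) force+

lemma H_eq: "b < 1 \<Longrightarrow> H b = integral {0..b} (\<lambda>u. 1 / (pgf p u - u))"
  unfolding H_def
  by (intro set_borel_integral_eq_integral borel_integrable_atLeastAtMost' continuous_on_integrand)

lemma H_0 [simp]: "H 0 = 0"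
  by (simp add: H_eq)

lemma H_derivative_within:
  assumes "0 \<le> y" "y \<le> b" "b < 1"
  shows "(H has_real_derivative 1 / (pgf p y - y)) (at y within {0..b})"
proof -
  have "((\<lambda>y. integral {0..y} (\<lambda>u. 1 / (pgf p u - u))) has_real_derivative 1 / (pgf p y - y)) (at y within {0..b})"
    using assms by (intro integral_has_real_derivative continuous_on_integrand) auto
  then show ?thesis
    unfolding has_field_derivative_def
  proof (rule has_derivative_transform[rotated 2])
    show "y \<in> {0..b}" using assms by simp
    show "H x = integral {0..x} (\<lambda>u. 1 / (pgf p u - u))" if "x \<in> {0..b}" for x
      by (rule H_eq) (use that assms in simp)
  qed
qed

lemma H_derivative:
  assumes "0 < y" "y < 1"
  shows "(H has_real_derivative 1 / (pgf p y - y)) (at y)"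
proof -
  obtain b where b: "y < b" "b < 1" using dense assms(2) by blast
  have "(H has_real_derivative 1 / (pgf p y - y)) (at y within {0<..<b})"
    by (rule DERIV_subset[OF H_derivative_within[of y b]]) (use assms b in auto)
  moreover have "at y within {0<..<b} = at y"
    by (rule at_within_open) (use assms b in auto)
  ultimately show ?thesis by (simp only:)
qed

lemma continuous_on_H: "b < 1 \<Longrightarrow> continuous_on {0..b} H"
  by (rule DERIV_continuous_on) (use H_derivative_within in auto)

lemma H_strict_mono:
  assumes "0 \<le> x" "x < y" "y < 1"
  shows "H x < H y"
proof (rule DERIV_pos_imp_increasing_open[OF assms(2)])
  show "\<exists>d. DERIV H z :> d \<and> 0 < d" if "x < z" "z < y" for z
    using H_derivative[of z] pgf_gt_arg[of z] assms that by (intro exI[of _ "1 / (pgf p z - z)"]) auto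
  show "continuous_on {x..y} H"
    by (rule continuous_on_subset[OF continuous_on_H[OF assms(3)]]) (use assms in auto)
qed

text \<open>
  From \<open>f \<le> 1\<close>, the integrand is at least \<open>1 / (1 - u)\<close>. Hence \<open>V\<close> is unbounded.
\<close>

lemma H_lower: 
  assumes "0 \<le> y" "y < 1" shows "- ln (1 - y) \<le> H y"
proof (cases "y = 0")
  case False
  then have y: "0 < y" using assms by simp
  have "H 0 - - ln (1 - 0) \<le> H y - - ln (1 - y)"
  proof (rule DERIV_nonneg_imp_increasing_open[of 0 y "\<lambda>y. H y - - ln (1 - y)"])
    show "\<exists>d. ((\<lambda>y. H y - - ln (1 - y)) has_real_derivative d) (at z) \<and> 0 \<le> d" if z: "0 < z" "z < y" for z
    proof (intro exI conjI)
      show "((\<lambda>y. H y - - ln (1 - y)) has_real_derivative (1 / (pgf p z - z) - 1 / (1 - z))) (at z)"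
        using z assms by (auto intro!: derivative_eq_intros H_derivative simp: divide_simps)
      have "pgf p z - z \<le> 1 - z" using pgf_le_1[of z] z assms by simp
      then show "0 \<le> 1 / (pgf p z - z) - 1 / (1 - z)"
        using pgf_gt_arg[of z] z assms by (simp add: frac_le)
    qed
    show "continuous_on {0..y} (\<lambda>y. H y - - ln (1 - y))"
      by (intro continuous_intros continuous_on_H) (use assms in auto)
  qed (use y in auto)
  then show ?thesis by simp
qed simp

abbreviation V where "V \<equiv> V_fun p"
abbreviation W where "W \<equiv> W_fun p"

lemma V_1 [simp]: "V 1 = 0"
  by (simp add: V_eq_H)

lemma V_strict_mono: "1 \<le> x \<Longrightarrow> x < y \<Longrightarrow> V x < V y"
  unfolding V_eq_H by (rule H_strict_mono) (auto simp: field_simps)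

lemma V_mono: "1 \<le> x \<Longrightarrow> x \<le> y \<Longrightarrow> V x \<le> V y"
  using V_strict_mono[of x y] by (cases "x = y") auto

lemma V_lower: "1 \<le> x \<Longrightarrow> ln x \<le> V x"
  unfolding V_eq_H using H_lower[of "1 - 1 / x"] by (simp add: ln_div)

lemma V_nonneg: "1 \<le> x \<Longrightarrow> 0 \<le> V x"
  using V_mono[of 1 x] by simp

lemma V_at_top: "filterlim V at_top at_top"
  by (rule filterlim_at_top_mono[OF ln_at_top]) (use V_lower in \<open>auto simp: eventually_at_top_linorder\<close>)

lemma continuous_on_V: "continuous_on {1..b} V"
proof (cases "1 \<le> b")
  case True
  have "continuous_on {1..b} (\<lambda>x. H (1 - 1 / x))"
    by (rule continuous_on_compose2[OF continuous_on_H[of "1 - 1 / b"]])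
       (use True in \<open>auto intro!: continuous_intros simp: frac_le\<close>)
  then show ?thesis by (simp add: V_eq_H)
qed simp

lemma V_inj: "inj_on V {1..}"
proof (rule linorder_inj_onI')
  fix i j :: real assume "i \<in> {1..}" "i < j"
  then show "V i \<noteq> V j" using V_strict_mono[of i j] by auto
qed

lemma V_image: "V ` {1..} = {0..}"
proof (intro equalityI subsetI)
  fix y :: real assume y: "y \<in> {0..}"
  have "\<exists>x\<ge>1. x \<le> exp y \<and> V x = y"
    by (rule IVT'[OF _ _ _ continuous_on_V]) (use y V_lower[of "exp y"] in auto)
  then show "y \<in> V ` {1..}" by auto
qed (auto simp: V_nonneg)

lemma W_ge_1: "0 \<le> y \<Longrightarrow> 1 \<le> W y"
  using the_inv_into_into[OF V_inj _ order_refl, of y] by (simp add: W_fun_def V_image)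

lemma V_W [simp]: "0 \<le> y \<Longrightarrow> V (W y) = y"
  using f_the_inv_into_f[OF V_inj, of y] by (simp add: W_fun_def V_image)

lemma W_V [simp]: "1 \<le> x \<Longrightarrow> W (V x) = x"
  using the_inv_into_f_f[OF V_inj, of x] by (simp add: W_fun_def)

lemma W_less_iff: "0 \<le> x \<Longrightarrow> 0 \<le> y \<Longrightarrow> W x < W y \<longleftrightarrow> x < y"
  using V_strict_mono[of "W x" "W y"] V_mono[of "W y" "W x"] W_ge_1[of x] W_ge_1[of y]
  by (metis V_W not_less)

lemma less_W_iff: "1 \<le> x \<Longrightarrow> 0 \<le> y \<Longrightarrow> x < W y \<longleftrightarrow> V x < y"
  using W_less_iff[of "V x" y] by (simp add: V_nonneg)

lemma W_less_iff': "1 \<le> x \<Longrightarrow> 0 \<le> y \<Longrightarrow> W y < x \<longleftrightarrow> y < V x"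
  using W_less_iff[of y "V x"] by (simp add: V_nonneg)

lemma W_mono: "0 \<le> x \<Longrightarrow> x \<le> y \<Longrightarrow> W x \<le> W y"
  using W_less_iff[of y x] by (simp add: not_less flip: not_less)

lemma W_at_top: "filterlim W at_top at_top"
  unfolding filterlim_at_top
proof
  fix Z :: real
  show "\<forall>\<^sub>F y in at_top. Z \<le> W y"
    using eventually_gt_at_top[of "V (max 1 Z)"] eventually_ge_at_top[of 0]
  proof eventually_elim
    case (elim y)
    then have "max 1 Z < W y" by (subst less_W_iff) auto
    then show ?case by simp
  qed
qed

lemma V_derivative:
  assumes "1 < x"
  shows "(V has_real_derivative 1 / (x powr (1 - \<gamma>) * L x)) (at x)"
proof -
  let ?y = "1 - 1 / x"
  have y: "0 < ?y" "?y < 1" using assms by auto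
  have "((\<lambda>x. H (1 - 1 / x)) has_real_derivative (1 / (pgf p ?y - ?y)) * (1 / x\<^sup>2)) (at x)"
    by (rule DERIV_chain2[where f=H and g="\<lambda>x. 1 - 1 / x", OF H_derivative[OF y]])
       (use assms in \<open>auto intro!: derivative_eq_intros simp: power2_eq_square\<close>)
  moreover have "pgf p ?y - ?y = x powr (- (\<gamma> + 1)) * L x"
  proof -
    have "1 - ?y = 1 / x" "1 / (1 - ?y) = x" using assms by auto
    moreover have "(1 / x) powr (\<gamma> + 1) = x powr (- (\<gamma> + 1))"
      using assms by (simp only: powr_minus inverse_eq_divide powr_divide powr_one_eq_one)
    ultimately show ?thesis using f[of ?y] y by simp
  qed
  then have "(1 / (pgf p ?y - ?y)) * (1 / x\<^sup>2) = 1 / (x powr (1 - \<gamma>) * L x)"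
  proof -
    have "x powr (- (\<gamma> + 1)) * x\<^sup>2 = x powr (1 - \<gamma>)"
      using assms by (simp add: powr_add[symmetric] flip: powr_numeral)
    then show ?thesis using \<open>pgf p ?y - ?y = _\<close> by (simp add: mult.assoc mult.commute mult.left_commute)
  qed
  ultimately show ?thesis by (simp add: V_eq_H[abs_def])
qed

text \<open>
  L'Hospital's rule reduces the claim to the derivative \<open>x powr (\<gamma> - 1) / L x\<close>.
\<close>

lemma V_regularly_varying:
  assumes c: "0 < c"
  shows "((\<lambda>x. V (c * x) / V x) \<longlongrightarrow> c powr \<gamma>) at_top"
proof (rule lhospital_at_top_at_top[OF V_at_top])
  let ?v = "\<lambda>x. 1 / (x powr (1 - \<gamma>) * L x)"
  have ev: "\<forall>\<^sub>F x in at_top. 1 < x \<and> 1 < c * x \<and> 0 < L x \<and> 0 < L (c * x)"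
  proof (intro eventually_conj slow_pos eventually_gt_at_top)
    have cx: "filterlim (\<lambda>x. c * x) at_top at_top"
      by (rule filterlim_tendsto_pos_mult_at_top[OF tendsto_const c filterlim_ident])
    then show "\<forall>\<^sub>F x in at_top. 1 < c * x" by (simp add: filterlim_at_top_dense)
    show "\<forall>\<^sub>F x in at_top. 0 < L (c * x)" by (rule eventually_compose_filterlim[OF slow_pos cx])
  qed
  show "\<forall>\<^sub>F x in at_top. ?v x \<noteq> 0" using ev by eventually_elim auto
  show "\<forall>\<^sub>F x in at_top. DERIV V x :> ?v x" using ev by eventually_elim (auto intro: V_derivative)
  show "\<forall>\<^sub>F x in at_top. DERIV (\<lambda>x. V (c * x)) x :> c * ?v (c * x)"
    using ev
  proof eventually_elim
    case (elim x)
    then have "DERIV (\<lambda>x. V (c * x)) x :> ?v (c * x) * c"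
      by (intro DERIV_chain2[where f=V and g="\<lambda>x. c * x", OF V_derivative]) (auto intro!: derivative_eq_intros)
    then show ?case by (simp add: mult.commute)
  qed
  have "((\<lambda>x. c powr \<gamma> / (L (c * x) / L x)) \<longlongrightarrow> c powr \<gamma> / 1) at_top"
    by (intro tendsto_intros slow_lim c) simp
  moreover have "\<forall>\<^sub>F x in at_top. c powr \<gamma> / (L (c * x) / L x) = c * ?v (c * x) / ?v x"
    using ev
  proof eventually_elim
    case (elim x)
    have "c = c powr \<gamma> * c powr (1 - \<gamma>)" using c by (simp flip: powr_add)
    then show ?case using elim c by (simp add: powr_mult field_simps)
  qed
  ultimately show "((\<lambda>x. c * ?v (c * x) / ?v x) \<longlongrightarrow> c powr \<gamma>) at_top"
    by (simp add: tendsto_cong)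
qed

lemma V_ratio:
  assumes "filterlim x at_top F" "((\<lambda>t. y t / x t) \<longlongrightarrow> k) F" "0 < k"
  shows "((\<lambda>t. V (y t) / V (x t)) \<longlongrightarrow> k powr \<gamma>) F"
proof (rule mono_regularly_varying_ratio[OF _ _ V_regularly_varying assms])
  show "mono_on {1..} V" by (auto intro!: mono_onI V_mono)
  show "\<forall>\<^sub>F x in at_top. 0 < V x" using V_at_top by (simp add: filterlim_at_top_dense)
qed

text \<open>
  A bound \<open>c W(x) < W(y)\<close> means \<open>V(c W(x)) < y\<close>, and the left side is asymptotic to
  \<open>c powr \<gamma>\<close> times \<open>x\<close>.
\<close>

lemma W_ratio:
  assumes x: "filterlim x at_top F" and y: "((\<lambda>t. y t / x t) \<longlongrightarrow> k) F" and k: "0 < k"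
  shows "((\<lambda>t. W (y t) / W (x t)) \<longlongrightarrow> k powr (1 / \<gamma>)) F"
proof -
  let ?k = "k powr (1 / \<gamma>)"
  have kk: "?k powr \<gamma> = k" using gamma k by (simp add: powr_powr)
  have Wx: "filterlim (\<lambda>t. W (x t)) at_top F" by (rule filterlim_compose[OF W_at_top x])
  have lim: "((\<lambda>t. V (c * W (x t)) / x t) \<longlongrightarrow> c powr \<gamma>) F" if "0 < c" for c
  proof -
    have "((\<lambda>t. V (c * W (x t)) / V (W (x t))) \<longlongrightarrow> c powr \<gamma>) F"
      by (rule filterlim_compose[OF V_regularly_varying[OF that] Wx])
    moreover have "\<forall>\<^sub>F t in F. V (c * W (x t)) / V (W (x t)) = V (c * W (x t)) / x t"
      using filterlim_at_top[THEN iffD1, OF x, rule_format, of 0] by eventually_elim simp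
    ultimately show ?thesis by (simp add: tendsto_cong)
  qed
  have k2: "k / 2 < k" using k by simp
  have ypos: "\<forall>\<^sub>F t in F. 0 < y t"
    using order_tendstoD(1)[OF y k2] filterlim_at_top_dense[THEN iffD1, OF x, rule_format, of 0]
  proof eventually_elim
    case (elim t)
    then have "0 < y t / x t" using k by linarith
    then show ?case using elim by (simp add: zero_less_divide_iff)
  qed
  have large: "\<forall>\<^sub>F t in F. 0 < x t \<and> 0 < y t \<and> 1 / c \<le> W (x t)" for c
    using filterlim_at_top_dense[THEN iffD1, OF x, rule_format, of 0] ypos
      filterlim_at_top[THEN iffD1, OF Wx, rule_format, of "1 / c"]
    by eventually_elim simp
  show ?thesis
  proof (rule order_tendstoI)
    fix b assume b: "b < ?k"
    obtain c where c: "max b 0 < c" "c < ?k" using dense[of "max b 0" ?k] b k by auto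
    then have c0: "0 < c" "b < c" by auto
    have ck: "c powr \<gamma> < k" using powr_less_mono2[OF gamma(1), of c ?k] c0 c(2) kk by simp
    obtain e where e: "c powr \<gamma> < e" "e < k" using dense[OF ck] by blast
    show "\<forall>\<^sub>F t in F. b < W (y t) / W (x t)"
      using order_tendstoD(2)[OF lim[OF c0(1)] e(1)] order_tendstoD(1)[OF y e(2)] large[of c]
    proof eventually_elim
      case (elim t)
      then have "V (c * W (x t)) < y t" by (auto simp: divide_less_eq less_divide_eq)
      then have "c * W (x t) < W (y t)" using elim c0 by (subst less_W_iff) (auto simp: field_simps)
      then have "c < W (y t) / W (x t)" using elim W_ge_1[of "x t"] by (simp add: field_simps)
      then show ?case using c0 by simp
    qed
  next
    fix b assume b: "?k < b"
    obtain c where c: "?k < c" "c < b" using dense[OF b] by blast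
    have c0: "0 < c" using c k by (smt (verit) powr_ge_zero)
    have ck: "k < c powr \<gamma>" using powr_less_mono2[OF gamma(1), of ?k c] c kk by simp
    obtain e where e: "k < e" "e < c powr \<gamma>" using dense[OF ck] by blast
    show "\<forall>\<^sub>F t in F. W (y t) / W (x t) < b"
      using order_tendstoD(1)[OF lim[OF c0] e(2)] order_tendstoD(2)[OF y e(1)] large[of c]
    proof eventually_elim
      case (elim t)
      then have "y t < V (c * W (x t))" by (auto simp: divide_less_eq less_divide_eq)
      then have "W (y t) < c * W (x t)" using elim c0 by (subst W_less_iff') (auto simp: field_simps)
      then have "W (y t) / W (x t) < c" using elim W_ge_1[of "x t"] by (simp add: field_simps)
      then show ?case using c by simp
    qed
  qed
qed

end

section \<open>Decay of the survival probability\<close>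

locale regular_immigration = mbp_poisson_immigration M \<mu> p h r T N I \<nu> + critical_offspring p \<gamma> L
  for M :: "'a measure" and \<mu> \<gamma> :: real and p h :: "nat pmf" and r L :: "real \<Rightarrow> real"
    and T :: "nat \<Rightarrow> nat \<Rightarrow> nat list \<Rightarrow> 'a \<Rightarrow> real"
    and N :: "nat \<Rightarrow> nat \<Rightarrow> nat list \<Rightarrow> 'a \<Rightarrow> nat"
    and I :: "nat \<Rightarrow> 'a \<Rightarrow> nat"
    and \<nu> :: "real \<Rightarrow> 'a \<Rightarrow> nat" +
  fixes \<alpha> :: real and l :: "real \<Rightarrow> real"
  assumes alpha: "0 < \<alpha>" "\<alpha> \<le> 1"
    and l_slow: "slowly_varying l"
    and g: "\<And>s. 0 \<le> s \<Longrightarrow> s < 1 \<Longrightarrow> pgf h s = 1 - (1 - s) powr \<alpha> * l (1 / (1 - s))"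
begin

text \<open>
  Along a solution of \<open>F' = \<mu> (f(F) - F)\<close> the antiderivative \<open>H\<close> of \<open>1 / (f - id)\<close> grows at
  the constant rate \<open>\<mu>\<close>.
\<close>

lemma H_branching_pgf:
  assumes t: "0 \<le> t" and s: "0 \<le> s" "s < 1"
  shows "H (branching_pgf \<mu> p t s) = H s + \<mu> * t"
proof -
  let ?F = "\<lambda>t. branching_pgf \<mu> p t s"
  have cont: "continuous_on {0..t} ?F"
    by (rule continuous_on_subset[OF continuous_on_branching_pgf[OF critical s]]) auto
  obtain m where m: "m \<in> {0..t}" "\<And>v. v \<in> {0..t} \<Longrightarrow> ?F v \<le> ?F m"
    using continuous_attains_sup[OF compact_Icc _ cont] t by auto
  have b: "?F m < 1" using branching_pgf_less_1[OF critical s, of m] m by auto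
  have im: "?F ` {0..t} \<subseteq> {0..?F m}"
    using m order_trans[OF s(1) branching_pgf_ge_arg[OF critical s]] by auto
  have der: "((\<lambda>v. H (?F v) - \<mu> * v) has_real_derivative 0) (at v within {0..t})" if v: "v \<in> {0..t}" for v
  proof -
    have "?F v \<in> {0..?F m}" using im v by blast
    then have F: "0 \<le> ?F v" "?F v < 1" "?F v \<le> ?F m" using b by auto
    have "(H has_real_derivative 1 / (pgf p (?F v) - ?F v)) (at (?F v) within ?F ` {0..t})"
      by (rule DERIV_subset[OF H_derivative_within[OF F(1,3) b] im])
    moreover have "(?F has_real_derivative \<mu> * (pgf p (?F v) - ?F v)) (at v within {0..t})"
      by (rule DERIV_subset[OF branching_pgf_ODE[OF critical s]]) (use v in auto)
    ultimately have "((H \<circ> ?F) has_real_derivative 1 / (pgf p (?F v) - ?F v) * (\<mu> * (pgf p (?F v) - ?F v))) (at v within {0..t})"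
      by (rule DERIV_image_chain)
    moreover have "1 / (pgf p (?F v) - ?F v) * (\<mu> * (pgf p (?F v) - ?F v)) = \<mu>"
      using pgf_gt_arg[OF F(1,2)] by simp
    ultimately have "((\<lambda>v. H (?F v)) has_real_derivative \<mu>) (at v within {0..t})" by (simp add: o_def)
    then show ?thesis by (auto intro!: derivative_eq_intros)
  qed
  have "\<exists>c. \<forall>v\<in>{0..t}. H (?F v) - \<mu> * v = c"
    by (rule has_field_derivative_zero_constant) (use der in auto)
  then obtain c where c: "\<And>v. v \<in> {0..t} \<Longrightarrow> H (?F v) - \<mu> * v = c" by blast
  have "H (?F t) - \<mu> * t = H (?F 0) - \<mu> * 0" using c[of t] c[of 0] t by simp
  then show ?thesis by (simp add: branching_pgf_0[OF critical s])
qed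

lemma branching_pgf_eq:
  assumes t: "0 \<le> t" and s: "0 \<le> s" "s < 1"
  shows "branching_pgf \<mu> p t s = 1 - 1 / W (\<mu> * t + V (1 / (1 - s)))"
proof -
  let ?F = "branching_pgf \<mu> p t s"
  have F: "0 \<le> ?F" "?F < 1"
    using branching_pgf_ge_arg[OF critical s, of t] branching_pgf_less_1[OF critical s t] s by auto
  have "V (1 / (1 - ?F)) = \<mu> * t + V (1 / (1 - s))"
    using H_branching_pgf[OF t s] F s by (simp add: V_eq_H)
  then have "W (\<mu> * t + V (1 / (1 - s))) = 1 / (1 - ?F)"
    using W_V[of "1 / (1 - ?F)"] F by (simp add: field_simps)
  then show ?thesis by simp
qed

text \<open>
  The probability that a group keeps a member when each member is kept with probability
  \<open>1 / x\<close>.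
\<close>

definition tail :: "real \<Rightarrow> real" where
  "tail x = 1 - pgf h (1 - 1 / x)"

lemma tail_eq: "1 \<le> x \<Longrightarrow> tail x = x powr (- \<alpha>) * l x"
proof -
  assume x: "1 \<le> x"
  have "1 - (1 - 1 / x) = 1 / x" by simp
  moreover have "(1 / x) powr \<alpha> = x powr (- \<alpha>)"
    using x by (simp only: powr_minus inverse_eq_divide powr_divide powr_one_eq_one)
  ultimately show ?thesis using g[of "1 - 1 / x"] x by (simp add: tail_def)
qed

lemma tail_antimono: "1 \<le> x \<Longrightarrow> x \<le> y \<Longrightarrow> tail y \<le> tail x"
  unfolding tail_def using pgf_mono[of "1 - 1 / x" "1 - 1 / y" h] by (simp add: frac_le)

lemma tail_pos: "1 \<le> x \<Longrightarrow> 0 < tail x"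
proof -
  assume x: "1 \<le> x"
  have "\<forall>\<^sub>F y in at_top. 0 < l y \<and> x \<le> y"
    using l_slow unfolding slowly_varying_def
    by (intro eventually_conj eventually_ge_at_top) (auto simp: eventually_at_top_linorder)
  then obtain y where "0 < l y" "x \<le> y" by (auto simp: eventually_at_top_linorder)
  then have "0 < tail y" using x by (simp add: tail_eq)
  also have "\<dots> \<le> tail x" by (rule tail_antimono) fact+
  finally show ?thesis .
qed

lemma tail_le_1: "1 \<le> x \<Longrightarrow> tail x \<le> 1"
  unfolding tail_def using pgf_nonneg[of "1 - 1 / x" h] by simp

lemma tail_ratio:
  assumes x: "filterlim x at_top F" and y: "((\<lambda>t. y t / x t) \<longlongrightarrow> k) F" and k: "0 < k"
  shows "((\<lambda>t. tail (y t) / tail (x t)) \<longlongrightarrow> k powr (- \<alpha>)) F"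
proof -
  have "((\<lambda>t. (1 / tail (y t)) / (1 / tail (x t))) \<longlongrightarrow> k powr \<alpha>) F"
  proof (rule mono_regularly_varying_ratio[OF _ _ _ x y k])
    show "mono_on {1..} (\<lambda>x. 1 / tail x)"
      by (intro mono_onI frac_le tail_antimono) (auto intro: tail_pos order_trans)
    show "\<forall>\<^sub>F x in at_top. 0 < 1 / tail x"
      using eventually_ge_at_top[of 1] by eventually_elim (simp add: tail_pos)
    fix c :: real assume c: "0 < c"
    have "((\<lambda>x. c powr \<alpha> / (l (c * x) / l x)) \<longlongrightarrow> c powr \<alpha> / 1) at_top"
      using l_slow c unfolding slowly_varying_def by (intro tendsto_intros) auto
    moreover have "\<forall>\<^sub>F x in at_top. c powr \<alpha> / (l (c * x) / l x) = (1 / tail (c * x)) / (1 / tail x)"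
    proof -
      have cx: "filterlim (\<lambda>x. c * x) at_top at_top"
        by (rule filterlim_tendsto_pos_mult_at_top[OF tendsto_const c filterlim_ident])
      have "\<forall>\<^sub>F x in at_top. 1 \<le> c * x" using cx by (simp add: filterlim_at_top)
      with eventually_ge_at_top[of 1] show ?thesis
      proof eventually_elim
        case (elim x)
        then show ?case using c by (simp add: tail_eq powr_mult powr_minus field_simps)
      qed
    qed
    ultimately show "((\<lambda>x. (1 / tail (c * x)) / (1 / tail x)) \<longlongrightarrow> c powr \<alpha>) at_top"
      unfolding div_by_1 by (rule Lim_transform_eventually)
  qed
  then have "((\<lambda>t. inverse ((1 / tail (y t)) / (1 / tail (x t)))) \<longlongrightarrow> inverse (k powr \<alpha>)) F"
    by (rule tendsto_inverse) (use k in simp)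
  then show ?thesis by (simp add: powr_minus)
qed

lemma tail_tendsto_0: "(tail \<longlongrightarrow> 0) at_top"
proof -
  have "((\<lambda>x. 1 - pgf h (1 - 1 / x)) \<longlongrightarrow> 1 - pgf h 1) at_top"
  proof (intro tendsto_intros)
    have lim: "((\<lambda>x::real. 1 - 1 / x) \<longlongrightarrow> 1 - 0) at_top"
      by (intro tendsto_intros real_tendsto_divide_at_top[OF tendsto_const filterlim_ident])
    show "((\<lambda>x. pgf h (1 - 1 / x)) \<longlongrightarrow> pgf h 1) at_top"
    proof (rule continuous_on_tendsto_compose[OF continuous_on_pgf])
      show "\<forall>\<^sub>F x::real in at_top. 1 - 1 / x \<in> {0..1}"
        using eventually_ge_at_top[of 1] by eventually_elim simp
    qed (use lim in auto)
  qed
  then show ?thesis by (simp add: tail_def[abs_def])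
qed

text \<open>
  For \<open>t \<ge> 0\<close> this is the probability that a group has living descendants at age \<open>t\<close>.
\<close>

definition q :: "real \<Rightarrow> real" where "q t = tail (W (\<mu> * t))"

lemma immigrant_q_eq:
  assumes t: "0 \<le> t" and s: "0 \<le> s" "s < 1"
  shows "immigrant_q \<mu> p h t s = q (t + V (1 / (1 - s)) / \<mu>)"
  using rate_pos by (simp add: immigrant_q_def branching_pgf_eq[OF t s] q_def tail_def distrib_left)

lemma immigrant_q_0: "0 \<le> t \<Longrightarrow> immigrant_q \<mu> p h t 0 = q t"
  using immigrant_q_eq[of t 0] by simp

lemma q_pos: "0 \<le> t \<Longrightarrow> 0 < q t"
  unfolding q_def using rate_pos by (intro tail_pos W_ge_1) simp

lemma q_le_1: "0 \<le> t \<Longrightarrow> q t \<le> 1"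
  unfolding q_def using rate_pos by (intro tail_le_1 W_ge_1) simp

lemma q_antimono: "0 \<le> t \<Longrightarrow> t \<le> u \<Longrightarrow> q u \<le> q t"
  unfolding q_def using rate_pos by (intro tail_antimono W_ge_1 W_mono) (auto intro: mult_left_mono)

lemma q_tendsto_0: "(q \<longlongrightarrow> 0) at_top"
  unfolding q_def
  by (rule filterlim_compose[OF tail_tendsto_0 filterlim_compose[OF W_at_top]])
     (rule filterlim_tendsto_pos_mult_at_top[OF tendsto_const rate_pos filterlim_ident])

text \<open>
  The indices \<open>1 / \<gamma>\<close> of \<open>W\<close> and \<open>- \<alpha>\<close> of \<open>tail\<close> multiply.
\<close>

lemma q_ratio:
  assumes x: "filterlim x at_top F" and y: "((\<lambda>t. y t / x t) \<longlongrightarrow> k) F" and k: "0 < k"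
  shows "((\<lambda>t. q (y t) / q (x t)) \<longlongrightarrow> k powr (- \<alpha> / \<gamma>)) F"
proof -
  have mx: "filterlim (\<lambda>t. \<mu> * x t) at_top F"
    by (rule filterlim_tendsto_pos_mult_at_top[OF tendsto_const rate_pos x])
  have "((\<lambda>t. (\<mu> * y t) / (\<mu> * x t)) \<longlongrightarrow> k) F" using y rate_pos by simp
  from W_ratio[OF mx this k]
  have "((\<lambda>t. tail (W (\<mu> * y t)) / tail (W (\<mu> * x t))) \<longlongrightarrow> (k powr (1 / \<gamma>)) powr (- \<alpha>)) F"
    by (intro tail_ratio filterlim_compose[OF W_at_top mx]) (use k in auto)
  then show ?thesis by (simp add: q_def powr_powr)
qed

lemma q_half_bound: "\<forall>\<^sub>F t in at_top. q (t / 2) \<le> ((1 / 2) powr (- \<alpha> / \<gamma>) + 1) * q t"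
proof -
  have "((\<lambda>t::real. (t / 2) / t) \<longlongrightarrow> 1 / 2) at_top"
    by (rule Lim_transform_eventually[OF tendsto_const])
       (use eventually_gt_at_top[of 0] in eventually_elim, simp)
  from q_ratio[OF filterlim_ident this]
  have lim: "((\<lambda>t. q (t / 2) / q t) \<longlongrightarrow> (1 / 2) powr (- \<alpha> / \<gamma>)) at_top" by simp
  have "\<forall>\<^sub>F t in at_top. q (t / 2) / q t < (1 / 2) powr (- \<alpha> / \<gamma>) + 1"
    by (rule order_tendstoD(2)[OF lim]) simp
  with eventually_gt_at_top[of 0] show ?thesis
  proof eventually_elim
    case (elim t)
    then show ?case using q_pos[of t] by (simp add: divide_less_eq)
  qed
qed

end

section \<open>Convolution of regularly varying functions\<close>

text \<open>
  Here \<open>t - u = c t\<close> with \<open>c\<close> depending on \<open>t\<close>, which calls for uniform convergence.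
\<close>

lemma regularly_varying_shift:
  assumes L: "slowly_varying L" and r: "\<And>t. 0 < t \<Longrightarrow> r t = t powr (- \<theta>) * L t"
    and u: "0 \<le> u"
  shows "((\<lambda>t. r (t - u) / r t) \<longlongrightarrow> 1) at_top"
proof -
  have c: "((\<lambda>t. 1 - u / t) \<longlongrightarrow> 1 - 0) at_top"
    by (intro tendsto_intros real_tendsto_divide_at_top[OF tendsto_const filterlim_ident])
  have Lpos: "\<forall>\<^sub>F t in at_top. 0 < L t"
    using L unfolding slowly_varying_def eventually_at_top_linorder by blast
  have large: "\<forall>\<^sub>F t in at_top. 0 < t \<and> 2 * u \<le> t \<and> u < t"
    by (intro eventually_conj eventually_gt_at_top eventually_ge_at_top)
  have Lc: "((\<lambda>t. L ((1 - u / t) * t) / L t) \<longlongrightarrow> 1) at_top"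
  proof (rule tendstoI)
    fix e :: real assume "0 < e"
    from slowly_varying_uniform[OF L this] large
    show "\<forall>\<^sub>F t in at_top. dist (L ((1 - u / t) * t) / L t) 1 < e"
    proof eventually_elim
      case (elim t)
      then have "1 - u / t \<in> {1/2..1}" using u by (auto simp: field_simps)
      then show ?case using elim by (simp add: dist_real_def)
    qed
  qed
  have "((\<lambda>t. (1 - u / t) powr (- \<theta>) * (L ((1 - u / t) * t) / L t)) \<longlongrightarrow> (1 - 0) powr (- \<theta>) * 1) at_top"
    by (intro tendsto_mult tendsto_powr c tendsto_const Lc) simp
  moreover have "\<forall>\<^sub>F t in at_top. (1 - u / t) powr (- \<theta>) * (L ((1 - u / t) * t) / L t) = r (t - u) / r t"
    using large Lpos
  proof eventually_elim
    case (elim t)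
    have "(1 - u / t) * t = t - u" using elim by (simp add: field_simps)
    moreover have "(t - u) powr (- \<theta>) = (1 - u / t) powr (- \<theta>) * t powr (- \<theta>)"
      unfolding calculation[symmetric] by (rule powr_mult)
    ultimately show ?case using elim by (simp add: r)
  qed
  ultimately show ?thesis by (simp add: tendsto_cong)
qed

lemma regularly_varying_half_bound:
  assumes L: "slowly_varying L" and r: "\<And>t. 0 < t \<Longrightarrow> r t = t powr (- \<theta>) * L t" and \<theta>: "0 \<le> \<theta>"
  shows "\<forall>\<^sub>F t in at_top. \<forall>v\<in>{t/2..t}. r v \<le> 2 * 2 powr \<theta> * r t"
proof -
  have Lpos: "\<forall>\<^sub>F t in at_top. 0 < L t"
    using L unfolding slowly_varying_def eventually_at_top_linorder by blast
  from slowly_varying_uniform[OF L zero_less_one] Lpos eventually_gt_at_top[of 0]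
  show ?thesis
  proof eventually_elim
    case (elim t)
    show ?case
    proof
      fix v assume v: "v \<in> {t/2..t}"
      define c where "c = v / t"
      have c: "c \<in> {1/2..1}" "v = c * t" "0 < v" "0 < c" using v elim by (auto simp: c_def field_simps)
      have "\<bar>L (c * t) / L t - 1\<bar> < 1" using elim c by blast
      then have "L v / L t \<le> 2" using c by simp
      then have Lv: "L v \<le> 2 * L t" using elim by (simp add: divide_le_eq)
      have "c powr (- \<theta>) \<le> (1/2) powr (- \<theta>)"
        using c \<theta> by (intro powr_mono2') auto
      also have "(1/2) powr (- \<theta>) = 2 powr \<theta>" by (simp add: powr_minus powr_divide)
      finally have cp: "c powr (- \<theta>) \<le> 2 powr \<theta>" .
      have "r v = c powr (- \<theta>) * t powr (- \<theta>) * L v" using c elim by (simp add: r powr_mult)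
      also have "\<dots> \<le> c powr (- \<theta>) * t powr (- \<theta>) * (2 * L t)" by (intro mult_left_mono Lv) auto
      also have "\<dots> = c powr (- \<theta>) * (2 * r t)" using elim by (simp add: r)
      also have "\<dots> \<le> 2 powr \<theta> * (2 * r t)" using elim by (intro mult_right_mono cp) (simp add: r)
      finally show "r v \<le> 2 * 2 powr \<theta> * r t" by simp
    qed
  qed
qed

lemma regularly_varying_pos:
  assumes L: "slowly_varying L" and r: "\<And>t. 0 < t \<Longrightarrow> r t = t powr (- \<theta>) * L t"
  shows "\<forall>\<^sub>F t in at_top. 0 < r t"
proof -
  have Lpos: "\<forall>\<^sub>F t in at_top. 0 < L t"
    using L unfolding slowly_varying_def eventually_at_top_linorder by blast
  from this eventually_gt_at_top[of 0] show ?thesis by eventually_elim (simp add: r)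
qed

text \<open>
  The principle of one big jump: the convolution is cut at \<open>t / 2\<close>, and in each half the factor with the
  large argument is divided by its value at \<open>t\<close> and stays bounded, by \<open>K\<close> or \<open>K'\<close>, so that
  dominated convergence applies. The kernel \<open>k t\<close> varies with \<open>t\<close> so as to cover arguments
  \<open>s\<close> of the generating function that tend to 1.
\<close>

lemma convolution_split:
  fixes \<rho> q m :: "real \<Rightarrow> real" and k :: "real \<Rightarrow> real \<Rightarrow> real"
  assumes \<rho>: "integrable lborel \<rho>" "\<And>u. 0 \<le> \<rho> u" "\<And>u. u < 0 \<Longrightarrow> \<rho> u = 0"
    and \<rho>_pos: "\<forall>\<^sub>F t in at_top. 0 < \<rho> t"
    and \<rho>_half: "\<forall>\<^sub>F t in at_top. \<forall>v\<in>{t/2..t}. \<rho> v \<le> K * \<rho> t"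
    and \<rho>_shift: "\<And>u. 0 \<le> u \<Longrightarrow> ((\<lambda>t. \<rho> (t - u) / \<rho> t) \<longlongrightarrow> 1) at_top"
    and q: "integrable lborel q" "\<And>u. u < 0 \<Longrightarrow> q u = 0" "\<And>u. 0 \<le> u \<Longrightarrow> 0 < q u"
      "\<And>u v. 0 \<le> u \<Longrightarrow> u \<le> v \<Longrightarrow> q v \<le> q u"
    and q_half: "\<forall>\<^sub>F t in at_top. q (t / 2) \<le> K' * q t"
    and k: "\<And>t. k t \<in> borel_measurable borel" "\<And>t u. 0 \<le> k t u" "\<And>t u. k t u \<le> q u"
    and k_lim: "\<And>u. 0 \<le> u \<Longrightarrow> ((\<lambda>t. k t u) \<longlongrightarrow> m u) at_top" and k_inf: "m \<in> borel_measurable borel" "\<And>u. u < 0 \<Longrightarrow> m u = 0"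
    and k_shift: "\<And>u. 0 \<le> u \<Longrightarrow> ((\<lambda>t. k t (t - u) / q t) \<longlongrightarrow> \<kappa>) at_top"
  obtains A B where "(A \<longlongrightarrow> (\<integral>u. m u \<partial>lborel)) at_top" "(B \<longlongrightarrow> \<kappa> * (\<integral>u. \<rho> u \<partial>lborel)) at_top"
    "\<forall>\<^sub>F t in at_top. (\<integral>u. \<rho> u * k t (t - u) \<partial>lborel) = \<rho> t * A t + q t * B t"
proof
  note [measurable] = borel_measurable_integrable[OF \<rho>(1), simplified] borel_measurable_integrable[OF q(1), simplified] k(1) k_inf(1)
  let ?A = "\<lambda>t u. indicator {..<t/2} u * (\<rho> (t - u) / \<rho> t * k t u)"
  let ?B = "\<lambda>t u. indicator {..t/2} u * (\<rho> u * (k t (t - u) / q t))"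
  have k_neg: "k t u = 0" if "u < 0" for t u using k(2,3)[of t u] q(2)[OF that] by simp
  have q0: "0 \<le> q u" for u using q(2)[of u] q(3)[of u] by (cases "u < 0") auto
  have u_large: "\<forall>\<^sub>F t in at_top. u < t / 2" for u :: real
    using eventually_gt_at_top[of "2 * u"] by eventually_elim simp
  show "((\<lambda>t. \<integral>u. ?A t u \<partial>lborel) \<longlongrightarrow> (\<integral>u. m u \<partial>lborel)) at_top"
  proof (rule integral_dominated_convergence_at_top[where w="\<lambda>u. K * q u"])
    show "integrable lborel (\<lambda>u. K * q u)" using q(1) by simp
    show "\<forall>\<^sub>F t in at_top. AE u in lborel. norm (?A t u) \<le> K * q u"
      using \<rho>_half \<rho>_pos eventually_gt_at_top[of 0]
    proof eventually_elim
      case (elim t)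
      have "\<rho> t \<le> K * \<rho> t" using elim by auto
      then have K: "0 \<le> K" using elim by (simp add: mult_le_cancel_right1)
      show ?case
      proof (intro AE_I2)
        fix u
        show "norm (?A t u) \<le> K * q u"
        proof (cases "0 \<le> u \<and> u < t / 2")
          case True
          then have "\<rho> (t - u) / \<rho> t \<le> K" using elim by (auto simp: divide_le_eq)
          then have "\<rho> (t - u) / \<rho> t * k t u \<le> K * q u"
            using k(2,3)[of t u] K \<rho>(2) by (intro mult_mono) auto
          then show ?thesis using True k(2)[of t u] \<rho>(2)[of "t - u"] \<rho>(2)[of t] by (simp add: indicator_def)
        qed (use k_neg K q0[of u] in \<open>auto simp: indicator_def\<close>)
      qed
    qed
    show "AE u in lborel. ((\<lambda>t. ?A t u) \<longlongrightarrow> m u) at_top"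
    proof (intro AE_I2)
      fix u :: real
      show "((\<lambda>t. ?A t u) \<longlongrightarrow> m u) at_top"
      proof (cases "0 \<le> u")
        case True
        have "((\<lambda>t. \<rho> (t - u) / \<rho> t * k t u) \<longlongrightarrow> 1 * m u) at_top"
          by (intro tendsto_mult \<rho>_shift k_lim True)
        moreover have "\<forall>\<^sub>F t in at_top. \<rho> (t - u) / \<rho> t * k t u = ?A t u"
          using u_large[of u] by eventually_elim simp
        ultimately show ?thesis unfolding mult_1_left by (rule Lim_transform_eventually)
      qed (simp add: k_neg k_inf)
    qed
  qed measurable
  show "((\<lambda>t. \<integral>u. ?B t u \<partial>lborel) \<longlongrightarrow> \<kappa> * (\<integral>u. \<rho> u \<partial>lborel)) at_top"
    unfolding integral_mult_right_zero[symmetric]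
  proof (rule integral_dominated_convergence_at_top[where w="\<lambda>u. K' * \<rho> u"])
    show "integrable lborel (\<lambda>u. K' * \<rho> u)" using \<rho>(1) by simp
    show "\<forall>\<^sub>F t in at_top. AE u in lborel. norm (?B t u) \<le> K' * \<rho> u"
      using q_half eventually_gt_at_top[of 0]
    proof eventually_elim
      case (elim t)
      have qt: "0 < q t" using q(3) elim by simp
      have "q t \<le> K' * q t" using elim q(4)[of "t/2" t] by simp
      then have K: "0 \<le> K'" using qt by (simp add: mult_le_cancel_right1)
      show ?case
      proof (intro AE_I2)
        fix u
        show "norm (?B t u) \<le> K' * \<rho> u"
        proof (cases "u \<le> t / 2")
          case True
          have "k t (t - u) \<le> q (t - u)" by (rule k(3))
          also have "\<dots> \<le> q (t / 2)" using True elim by (intro q(4)) auto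
          also have "\<dots> \<le> K' * q t" using elim by simp
          finally have "k t (t - u) / q t \<le> K'" using qt by (simp add: divide_le_eq)
          then have "\<rho> u * (k t (t - u) / q t) \<le> \<rho> u * K'" by (intro mult_left_mono \<rho>(2))
          then show ?thesis using True k(2)[of t "t - u"] \<rho>(2)[of u] qt by (simp add: mult.commute)
        qed (use K \<rho>(2)[of u] in simp)
      qed
    qed
    show "AE u in lborel. ((\<lambda>t. ?B t u) \<longlongrightarrow> \<kappa> * \<rho> u) at_top"
    proof (intro AE_I2)
      fix u :: real
      show "((\<lambda>t. ?B t u) \<longlongrightarrow> \<kappa> * \<rho> u) at_top"
      proof (cases "0 \<le> u")
        case True
        have "((\<lambda>t. \<rho> u * (k t (t - u) / q t)) \<longlongrightarrow> \<rho> u * \<kappa>) at_top"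
          by (intro tendsto_mult tendsto_const k_shift True)
        moreover have "\<forall>\<^sub>F t in at_top. \<rho> u * (k t (t - u) / q t) = ?B t u"
          using u_large[of u] by eventually_elim simp
        ultimately show ?thesis unfolding mult.commute[of \<kappa>] by (rule Lim_transform_eventually)
      qed (simp add: \<rho>(3))
    qed
  qed measurable
  show "\<forall>\<^sub>F t in at_top. (\<integral>u. \<rho> u * k t (t - u) \<partial>lborel) = \<rho> t * (\<integral>u. ?A t u \<partial>lborel) + q t * (\<integral>u. ?B t u \<partial>lborel)"
    using \<rho>_pos eventually_gt_at_top[of 0]
  proof eventually_elim
    case (elim t)
    have qt: "0 < q t" using q(3) elim by simp
    have int: "integrable lborel (\<lambda>u. \<rho> u * k t (t - u))"
    proof (rule Bochner_Integration.integrable_bound[OF integrable_mult_left[OF \<rho>(1), of "q 0"]])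
      have "k t (t - u) \<le> q 0" for u
        using k(3)[of t "t - u"] q(4)[of 0 "t - u"] k_neg[of "t - u" t] q0[of 0] by (cases "t - u < 0") auto
      then show "AE u in lborel. norm (\<rho> u * k t (t - u)) \<le> norm (\<rho> u * q 0)"
        using \<rho>(2) k(2) q0 by (intro AE_I2) (auto simp: abs_mult intro!: mult_left_mono)
    qed measurable
    have i1: "integrable lborel (\<lambda>u. indicator {t/2<..} u *\<^sub>R (\<rho> u * k t (t - u)))"
      "integrable lborel (\<lambda>u. indicator {..t/2} u *\<^sub>R (\<rho> u * k t (t - u)))"
      by (rule integrable_mult_indicator[OF _ int], simp)+
    have "(\<integral>u. \<rho> u * k t (t - u) \<partial>lborel) =
        (\<integral>u. indicator {t/2<..} u *\<^sub>R (\<rho> u * k t (t - u)) + indicator {..t/2} u *\<^sub>R (\<rho> u * k t (t - u)) \<partial>lborel)"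
      by (intro Bochner_Integration.integral_cong) (auto simp: indicator_def)
    also have "\<dots> = (\<integral>u. indicator {t/2<..} u *\<^sub>R (\<rho> u * k t (t - u)) \<partial>lborel) +
        (\<integral>u. indicator {..t/2} u *\<^sub>R (\<rho> u * k t (t - u)) \<partial>lborel)"
      by (rule Bochner_Integration.integral_add[OF i1])
    also have "(\<integral>u. indicator {t/2<..} u *\<^sub>R (\<rho> u * k t (t - u)) \<partial>lborel) =
        (\<integral>u. indicator {t/2<..} (t - u) *\<^sub>R (\<rho> (t - u) * k t u) \<partial>lborel)"
      by (subst lborel_integral_real_affine[where c="-1" and t=t]) auto
    also have "\<dots> = (\<integral>u. \<rho> t * ?A t u \<partial>lborel)"
      using elim by (intro Bochner_Integration.integral_cong) (auto simp: indicator_def)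
    also have "(\<integral>u. indicator {..t/2} u *\<^sub>R (\<rho> u * k t (t - u)) \<partial>lborel) = (\<integral>u. q t * ?B t u \<partial>lborel)"
      using qt by (intro Bochner_Integration.integral_cong) auto
    finally show ?case by simp
  qed
qed


lemma one_minus_exp_ratio:
  fixes x y :: "'b \<Rightarrow> real"
  assumes x: "(x \<longlongrightarrow> 0) F" and y: "(y \<longlongrightarrow> 0) F" and xy: "((\<lambda>t. x t / y t) \<longlongrightarrow> c) F"
    and nz: "\<forall>\<^sub>F t in F. y t \<noteq> 0"
  shows "((\<lambda>t. (1 - exp (- x t)) / (1 - exp (- y t))) \<longlongrightarrow> c) F"
proof -
  define g where "g z = (if z = 0 then 1 else (1 - exp (- z)) / z)" for z :: real
  have "((\<lambda>z. (1 - exp (- z)) / z) \<longlongrightarrow> 1) (at (0::real))"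
  proof -
    have "((\<lambda>z::real. 1 - exp (- z)) has_real_derivative 1) (at 0)"
      by (auto intro!: derivative_eq_intros)
    then show ?thesis by (simp add: has_field_derivative_iff)
  qed
  then have "(g \<longlongrightarrow> 1) (at 0)"
    by (rule Lim_transform_eventually) (auto simp: g_def eventually_at_filter)
  then have g: "isCont g 0" by (simp add: isCont_def g_def)
  have gl: "((\<lambda>t. g (z t)) \<longlongrightarrow> 1) F" if "(z \<longlongrightarrow> 0) F" for z
    using isCont_tendsto_compose[OF g that] by (simp add: g_def)
  have eq: "1 - exp (- z) = z * g z" for z by (simp add: g_def)
  have "((\<lambda>t. x t / y t * (g (x t) / g (y t))) \<longlongrightarrow> c * (1 / 1)) F"
    by (intro tendsto_mult xy tendsto_divide gl x y) simp
  then show ?thesis unfolding eq by (simp add: times_divide_times_eq)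
qed

lemma weighted_ratio_limit:
  fixes f g :: "real \<Rightarrow> real"
  assumes g: "\<forall>\<^sub>F t in at_top. 0 < g t" and fg: "((\<lambda>t. f t / g t) \<longlongrightarrow> d) at_top"
    and A: "(A \<longlongrightarrow> a) at_top" and B: "(B \<longlongrightarrow> b) at_top"
    and A': "(A' \<longlongrightarrow> a') at_top" and B': "(B' \<longlongrightarrow> b') at_top" and nz: "d * a' + b' \<noteq> 0"
  shows "((\<lambda>t. (f t * A t + g t * B t) / (f t * A' t + g t * B' t)) \<longlongrightarrow> (d * a + b) / (d * a' + b')) at_top"
proof -
  have "((\<lambda>t. (f t / g t * A t + B t) / (f t / g t * A' t + B' t)) \<longlongrightarrow> (d * a + b) / (d * a' + b')) at_top"
    by (intro tendsto_intros fg A B A' B' nz)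
  moreover have "\<forall>\<^sub>F t in at_top. (f t / g t * A t + B t) / (f t / g t * A' t + B' t) =
      (f t * A t + g t * B t) / (f t * A' t + g t * B' t)"
    using g
  proof eventually_elim
    case (elim t)
    have "f t * A t + g t * B t = g t * (f t / g t * A t + B t)" "f t * A' t + g t * B' t = g t * (f t / g t * A' t + B' t)"
      using elim by (simp_all add: distrib_left)
    then show ?case using elim by simp
  qed
  ultimately show ?thesis by (rule Lim_transform_eventually)
qed

section \<open>Absence of atoms in the limit law\<close>

text \<open>
  Expanding \<open>exp (- z y)\<close> at the centre gives a power series in the largest disc around it inside the
  right half-plane; such discs exhaust the half-plane.
\<close>

lemma laplace_transform_holomorphic:
  fixes D :: "real measure" and lam :: real
  assumes D: "real_distribution D" "AE y in D. 0 \<le> y" and lam: "0 < lam"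
  shows "(\<lambda>z. \<integral>y. exp (- z * complex_of_real y) \<partial>D) holomorphic_on ball (complex_of_real lam) lam"
proof (rule power_series_holomorphic)
  interpret D: real_distribution D by fact
  fix z assume z: "z \<in> ball (complex_of_real lam) lam"
  define w where "w = complex_of_real lam - z"
  have w: "norm w < lam" using z by (simp add: w_def dist_norm)
  define f where "f n y = (w * complex_of_real y) ^ n /\<^sub>R fact n * complex_of_real (exp (- lam * y))" for n :: nat and y :: real
  have f_meas [measurable]: "f n \<in> borel_measurable borel" for n
    unfolding f_def by measurable
  have f_sums: "(\<lambda>n. f n y) sums exp (- z * complex_of_real y)" for y
  proof -
    have "(\<lambda>n. f n y) sums (exp (w * complex_of_real y) * complex_of_real (exp (- lam * y)))"
      unfolding f_def by (intro sums_mult2 exp_converges)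
    also have "exp (w * complex_of_real y) * complex_of_real (exp (- lam * y)) = exp (- z * complex_of_real y)"
      by (simp add: w_def algebra_simps flip: exp_of_real exp_add)
    finally show ?thesis .
  qed
  have nf: "norm (f n y) = (norm w * y) ^ n /\<^sub>R fact n * exp (- lam * y)" if "0 \<le> y" for n y
    using that by (simp add: f_def norm_mult norm_power)
  have nsums: "(\<lambda>n. norm (f n y)) sums exp ((norm w - lam) * y)" if "0 \<le> y" for y
  proof -
    have "(\<lambda>n. (norm w * y) ^ n /\<^sub>R fact n * exp (- lam * y)) sums (exp (norm w * y) * exp (- lam * y))"
      by (intro sums_mult2 exp_converges)
    then show ?thesis using that by (simp add: nf algebra_simps flip: exp_add)
  qed
  have part: "(\<Sum>n<m. norm (f n y)) \<le> 1" if "0 \<le> y" for m y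
  proof -
    have "(\<Sum>n<m. norm (f n y)) \<le> exp ((norm w - lam) * y)"
      using sum_le_suminf[OF sums_summable[OF nsums[OF that]], of "{..<m}"] sums_unique[OF nsums[OF that]] by simp
    also have "\<dots> \<le> 1" using w that by (simp add: mult_nonpos_nonneg)
    finally show ?thesis .
  qed
  have one: "norm (f n y) \<le> 1" if "0 \<le> y" for n y
    using part[OF that, of "Suc n"] sum_nonneg[of "{..<n}" "\<lambda>n. norm (f n y)"] by simp
  have int: "integrable D (f n)" for n
    by (rule D.integrable_const_bound[where B=1]) (use D(2) one in auto)
  have "(\<lambda>n. \<integral>y. f n y \<partial>D) sums (\<integral>y. (\<Sum>n. f n y) \<partial>D)"
  proof (rule sums_integral[OF int])
    show "AE y in D. summable (\<lambda>n. norm (f n y))" using D(2) by eventually_elim (rule sums_summable[OF nsums])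
    show "summable (\<lambda>n. \<integral>y. norm (f n y) \<partial>D)"
    proof (rule summableI_nonneg_bounded[where x=1])
      fix m
      have "(\<Sum>n<m. \<integral>y. norm (f n y) \<partial>D) = (\<integral>y. (\<Sum>n<m. norm (f n y)) \<partial>D)"
        using int by (subst Bochner_Integration.integral_sum) auto
      also have "\<dots> \<le> 1"
        by (rule D.integral_le_const) (use int D(2) part in \<open>auto\<close>)
      finally show "(\<Sum>n<m. \<integral>y. norm (f n y) \<partial>D) \<le> 1" .
    qed auto
  qed
  moreover have "(\<integral>y. (\<Sum>n. f n y) \<partial>D) = (\<integral>y. exp (- z * complex_of_real y) \<partial>D)"
    using sums_unique[OF f_sums] by simp
  moreover have "(\<integral>y. f n y \<partial>D) = (\<integral>y. (- complex_of_real y) ^ n /\<^sub>R fact n * complex_of_real (exp (- lam * y)) \<partial>D) * (z - complex_of_real lam) ^ n" for n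
  proof -
    have "f n y = (- complex_of_real y) ^ n /\<^sub>R fact n * complex_of_real (exp (- lam * y)) * (z - complex_of_real lam) ^ n" for y
    proof -
      have "(w * complex_of_real y) ^ n = (- complex_of_real y) ^ n * (z - complex_of_real lam) ^ n"
        by (simp add: w_def algebra_simps flip: power_mult_distrib)
      then show ?thesis by (simp add: f_def scaleR_conv_of_real)
    qed
    then show ?thesis by simp
  qed
  ultimately show "(\<lambda>n. (\<integral>y. (- complex_of_real y) ^ n /\<^sub>R fact n * complex_of_real (exp (- lam * y)) \<partial>D) * (z - complex_of_real lam) ^ n)
      sums (\<integral>y. exp (- z * complex_of_real y) \<partial>D)" by simp
qed

text \<open>
  The branch of \<open>z powr \<gamma>\<close> that is holomorphic in the right half-plane.
\<close>

definition ml_power :: "real \<Rightarrow> complex \<Rightarrow> complex" where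
  "ml_power \<gamma> z = exp (of_real \<gamma> * Ln z)"

text \<open>
  With \<open>w = z powr \<gamma>\<close> the transform of \<open>D\<close> reads \<open>1 - (1 - 1 / (1 + w)) powr \<beta>\<close>, where
  \<open>\<beta> = \<alpha> / \<gamma>\<close>. In this form all bases of powers have positive real part.
\<close>

definition ml_transform :: "real \<Rightarrow> real \<Rightarrow> complex \<Rightarrow> complex" where
  "ml_transform \<gamma> \<beta> z = 1 - exp (of_real \<beta> * Ln (1 - 1 / (1 + ml_power \<gamma> z)))"

lemma Re_ml_power:
  assumes "0 < Re z" "0 < \<gamma>" "\<gamma> \<le> 1"
  shows "0 < Re (ml_power \<gamma> z)"
proof -
  have "z \<noteq> 0" using assms by auto
  have "\<bar>Im (Ln z)\<bar> < pi / 2" using Re_Ln_pos_lt[OF \<open>z \<noteq> 0\<close>] assms by simp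
  then have "\<bar>\<gamma> * Im (Ln z)\<bar> < pi / 2"
    using assms mult_right_mono[of \<gamma> 1 "\<bar>Im (Ln z)\<bar>"] by (simp add: abs_mult)
  then have "0 < cos (\<gamma> * Im (Ln z))" by (intro cos_gt_zero_pi) (auto simp: abs_less_iff)
  then show ?thesis by (simp add: ml_power_def Re_exp)
qed

lemma Re_ml_base:
  assumes "0 < Re w"
  shows "0 < Re (1 - 1 / (1 + w))" "1 + w \<noteq> 0"
proof -
  show nz: "1 + w \<noteq> 0" using assms by (auto simp: complex_eq_iff)
  have "1 \<le> norm (1 + w)" using complex_Re_le_cmod[of "1 + w"] assms by simp
  have "Re (1 / (1 + w)) = (1 + Re w) / (norm (1 + w))\<^sup>2"
    by (simp add: Re_divide cmod_power2)
  also have "\<dots> < 1"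
  proof -
    have "1 + Re w < (1 + Re w)\<^sup>2" using assms by (simp add: power2_eq_square algebra_simps add_pos_pos)
    also have "\<dots> \<le> (norm (1 + w))\<^sup>2" by (simp add: cmod_power2)
    finally show ?thesis using nz by (simp add: divide_less_eq)
  qed
  finally show "0 < Re (1 - 1 / (1 + w))" by simp
qed

lemma not_nonpos_Reals: "0 < Re z \<Longrightarrow> z \<notin> \<real>\<^sub>\<le>\<^sub>0"
  by (auto simp: complex_nonpos_Reals_iff)

lemma ml_transform_holomorphic:
  assumes "0 < \<gamma>" "\<gamma> \<le> 1" "\<And>z. z \<in> A \<Longrightarrow> 0 < Re z"
  shows "ml_transform \<gamma> \<beta> holomorphic_on A"
  unfolding ml_transform_def ml_power_def
  using Re_ml_base[OF Re_ml_power[OF assms(3,1,2)]] assms not_nonpos_Reals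
  by (intro holomorphic_intros) (auto simp: ml_power_def)

lemma ml_transform_real:
  assumes "0 < x" "0 < \<gamma>"
  shows "ml_transform \<gamma> \<beta> (complex_of_real x) = complex_of_real (1 - x powr (\<gamma> * \<beta>) / (1 + x powr \<gamma>) powr \<beta>)"
proof -
  let ?a = "x powr \<gamma>"
  have a: "0 < ?a" using assms by simp
  have p: "ml_power \<gamma> (complex_of_real x) = complex_of_real ?a"
    using assms by (simp add: ml_power_def Ln_of_real powr_def flip: exp_of_real)
  have q: "1 - 1 / (1 + complex_of_real ?a) = complex_of_real (?a / (1 + ?a))"
  proof -
    have "1 - 1 / (1 + b) = b / (1 + b)" if "0 < b" for b :: real using that by (simp add: field_simps)
    then have "1 - 1 / (1 + ?a) = ?a / (1 + ?a)" using a by blast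
    then have "complex_of_real (1 - 1 / (1 + ?a)) = complex_of_real (?a / (1 + ?a))" by (rule arg_cong)
    then show ?thesis by (simp only: of_real_diff of_real_divide of_real_add of_real_1)
  qed
  have "exp (of_real \<beta> * Ln (complex_of_real (?a / (1 + ?a)))) = complex_of_real ((?a / (1 + ?a)) powr \<beta>)"
    using a by (subst Ln_of_real) (auto simp: powr_def add_pos_pos simp flip: exp_of_real)
  moreover have "(?a / (1 + ?a)) powr \<beta> = x powr (\<gamma> * \<beta>) / (1 + ?a) powr \<beta>"
    using a by (simp add: powr_divide powr_powr)
  ultimately show ?thesis unfolding ml_transform_def p q by simp
qed

lemma ml_transform_tendsto_0:
  assumes "0 < \<gamma>"
  shows "(\<lambda>k. ml_transform \<gamma> \<beta> (Complex 1 (real k))) \<longlonglongrightarrow> 0"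
proof -
  have "filterlim (\<lambda>k. norm (Complex 1 (real k))) at_top sequentially"
  proof (rule filterlim_at_top_mono[OF filterlim_real_sequentially])
    show "\<forall>\<^sub>F k in sequentially. real k \<le> norm (Complex 1 (real k))"
      using abs_Im_le_cmod[of "Complex 1 (real _)"] by (auto intro!: always_eventually)
  qed
  then have "filterlim (\<lambda>k. exp (\<gamma> * ln (norm (Complex 1 (real k))))) at_top sequentially"
    by (intro filterlim_compose[OF exp_at_top] filterlim_tendsto_pos_mult_at_top[OF tendsto_const assms]
          filterlim_compose[OF ln_at_top])
  moreover have "norm (ml_power \<gamma> (Complex 1 (real k))) = exp (\<gamma> * ln (norm (Complex 1 (real k))))" for k
  proof -
    have "Complex 1 (real k) \<noteq> 0" by (simp add: complex_eq_iff)
    then show ?thesis by (simp add: ml_power_def norm_exp_eq_Re)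
  qed
  ultimately have "filterlim (\<lambda>k. ml_power \<gamma> (Complex 1 (real k))) at_infinity sequentially"
    by (simp add: filterlim_norm_at_top_imp_at_infinity)
  then have "filterlim (\<lambda>k. 1 + ml_power \<gamma> (Complex 1 (real k))) at_infinity sequentially"
    by (rule tendsto_add_filterlim_at_infinity[OF tendsto_const])
  then have "(\<lambda>k. 1 / (1 + ml_power \<gamma> (Complex 1 (real k)))) \<longlonglongrightarrow> 0"
    by (rule tendsto_divide_0[OF tendsto_const])
  then have "(\<lambda>k. 1 - exp (of_real \<beta> * Ln (1 - 1 / (1 + ml_power \<gamma> (Complex 1 (real k)))))) \<longlonglongrightarrow> 1 - exp (of_real \<beta> * Ln (1 - 0))"
    by (intro tendsto_intros) auto
  then show ?thesis by (simp add: ml_transform_def)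
qed

lemma geometric_average_tendsto:
  fixes w :: complex
  assumes "norm w = 1"
  shows "(\<lambda>n. (\<Sum>j<n. w ^ j) / of_nat n) \<longlonglongrightarrow> (if w = 1 then 1 else 0)"
proof (cases "w = 1")
  case True
  have "\<forall>\<^sub>F n in sequentially. 1 = (\<Sum>j<n. w ^ j) / of_nat n"
    using eventually_gt_at_top[of 0] by eventually_elim (simp add: True)
  then show ?thesis using True by (simp add: Lim_transform_eventually[OF tendsto_const])
next
  case False
  have "(\<lambda>n. (\<Sum>j<n. w ^ j) / of_nat n) \<longlonglongrightarrow> 0"
  proof (rule Lim_null_comparison[OF _ lim_const_over_n[of "2 / norm (1 - w)"]])
    show "\<forall>\<^sub>F n in sequentially. norm ((\<Sum>j<n. w ^ j) / of_nat n) \<le> 2 / norm (1 - w) / real n"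
    proof (intro always_eventually allI)
      fix n
      have "norm (\<Sum>j<n. w ^ j) = norm (1 - w ^ n) / norm (1 - w)"
        using False by (simp add: sum_gp_strict norm_divide)
      also have "\<dots> \<le> 2 / norm (1 - w)"
        using norm_triangle_ineq4[of 1 "w ^ n"] assms by (intro divide_right_mono) (auto simp: norm_power)
      finally show "norm ((\<Sum>j<n. w ^ j) / of_nat n) \<le> 2 / norm (1 - w) / real n"
        using divide_right_mono[of _ _ "real n"] by (simp only: norm_divide norm_of_nat of_nat_0_le_iff)
    qed
  qed
  then show ?thesis using False by simp
qed

text \<open>
  Wiener's argument, along integers and on the line \<open>Re z = 1\<close>. The averages of the powers of
  \<open>exp (i (x - y))\<close> tend to the indicator of \<open>y\<close> being congruent to \<open>x\<close> modulo
  \<open>2 \<pi>\<close>. If the transform vanishes at infinity, then so does the integral of \<open>exp (- y)\<close> over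
  this progression, to which an atom at \<open>x\<close> would contribute.
\<close>

lemma vanishing_transform_no_atom:
  fixes D :: "real measure"
  assumes D: "real_distribution D" "AE y in D. 0 \<le> y"
    and lim: "(\<lambda>k. \<integral>y. exp (- Complex 1 (real k) * complex_of_real y) \<partial>D) \<longlonglongrightarrow> 0"
  shows "measure D {x} = 0"
proof -
  interpret D: real_distribution D by fact
  define w where "w y = exp (\<i> * complex_of_real (x - y))" for y
  have nw: "norm (w y) = 1" for y by (simp add: w_def)
  have w_meas [measurable]: "w \<in> borel_measurable borel"
    unfolding w_def by measurable
  define G where "G k = (\<integral>y. complex_of_real (exp (- y)) * w y ^ k \<partial>D)" for k :: nat
  have intG: "integrable D (\<lambda>y. complex_of_real (exp (- y)) * w y ^ k)" for k
    by (rule D.integrable_const_bound[where B=1]) (use D(2) in \<open>auto simp: norm_mult norm_power nw\<close>)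
  have G: "norm (G k) = norm (\<integral>y. exp (- Complex 1 (real k) * complex_of_real y) \<partial>D)" for k
  proof -
    have "complex_of_real (exp (- y)) * w y ^ k = exp (\<i> * of_real (real k * x)) * exp (- Complex 1 (real k) * complex_of_real y)" for y
      by (simp add: w_def exp_of_nat_mult[symmetric] algebra_simps Complex_eq flip: exp_of_real exp_add)
    then have "G k = exp (\<i> * of_real (real k * x)) * (\<integral>y. exp (- Complex 1 (real k) * complex_of_real y) \<partial>D)"
      unfolding G_def by simp
    then show ?thesis by (simp add: norm_mult)
  qed
  have ind_meas: "(\<lambda>y. if w y = 1 then 1 else 0 :: complex) \<in> borel_measurable D"
    by (intro measurable_If measurable_const) measurable
  let ?P = "\<integral>y. exp (- y) * (if w y = 1 then 1 else 0) \<partial>D"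
  have intP: "integrable D (\<lambda>y. exp (- y) * (if w y = 1 then 1 else 0 :: real))"
    by (rule D.integrable_const_bound[where B=1]) (use D(2) in \<open>auto\<close>)
  have small: "?P \<le> e" if e: "0 < e" for e
  proof -
    have "(\<lambda>k. norm (G k)) \<longlonglongrightarrow> 0" using lim by (simp add: G tendsto_norm_zero)
    then obtain m where m: "\<And>k. m \<le> k \<Longrightarrow> norm (G k) < e"
      using LIMSEQ_D[OF _ e, of "\<lambda>k. norm (G k)" 0] by auto
    have avg: "(\<integral>y. complex_of_real (exp (- y)) * (w y ^ m * ((\<Sum>j<n. w y ^ j) / of_nat n)) \<partial>D) = (\<Sum>j<n. G (m + j)) / of_nat n" for n
    proof -
      have "(\<Sum>j<n. G (m + j)) / of_nat n = (\<integral>y. (\<Sum>j<n. complex_of_real (exp (- y)) * w y ^ (m + j)) \<partial>D) / of_nat n"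
        unfolding G_def using intG by (subst Bochner_Integration.integral_sum) auto
      also have "\<dots> = (\<integral>y. (\<Sum>j<n. complex_of_real (exp (- y)) * w y ^ (m + j)) / of_nat n \<partial>D)" by simp
      finally have "(\<integral>y. (\<Sum>j<n. complex_of_real (exp (- y)) * w y ^ (m + j)) / of_nat n \<partial>D) = (\<Sum>j<n. G (m + j)) / of_nat n"
        by (rule sym)
      moreover have "(\<Sum>j<n. complex_of_real (exp (- y)) * w y ^ (m + j)) / of_nat n =
          complex_of_real (exp (- y)) * (w y ^ m * ((\<Sum>j<n. w y ^ j) / of_nat n))" for y
        by (simp add: power_add sum_distrib_left mult_ac)
      ultimately show ?thesis by (simp only:)
    qed
    have "(\<lambda>n. \<integral>y. complex_of_real (exp (- y)) * (w y ^ m * ((\<Sum>j<n. w y ^ j) / of_nat n)) \<partial>D) \<longlonglongrightarrow>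
       (\<integral>y. complex_of_real (exp (- y)) * (w y ^ m * (if w y = 1 then 1 else 0)) \<partial>D)"
    proof (rule integral_dominated_convergence[where w="\<lambda>_. 1"])
      show "AE y in D. (\<lambda>n. complex_of_real (exp (- y)) * (w y ^ m * ((\<Sum>j<n. w y ^ j) / of_nat n))) \<longlonglongrightarrow>
          complex_of_real (exp (- y)) * (w y ^ m * (if w y = 1 then 1 else 0))"
        by (intro AE_I2 tendsto_mult tendsto_const geometric_average_tendsto nw)
      fix n
      have avg1: "norm ((\<Sum>j<n. w y ^ j) / of_nat n) \<le> 1" for y
      proof -
        have "norm (\<Sum>j<n. w y ^ j) \<le> (\<Sum>j<n. norm (w y ^ j))" by (rule norm_sum)
        also have "\<dots> = real n" by (simp add: norm_power nw)
        finally show ?thesis by (cases "n = 0") (auto simp: norm_divide divide_le_eq)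
      qed
      show "AE y in D. norm (complex_of_real (exp (- y)) * (w y ^ m * ((\<Sum>j<n. w y ^ j) / of_nat n))) \<le> 1"
        using D(2)
      proof eventually_elim
        case (elim y)
        show ?case
          unfolding norm_mult norm_power nw power_one mult_1_left
          by (intro mult_le_one avg1) (use elim in auto)
      qed
    qed (use ind_meas in measurable)
    moreover have "(\<integral>y. complex_of_real (exp (- y)) * (w y ^ m * (if w y = 1 then 1 else 0)) \<partial>D) = complex_of_real ?P"
      unfolding integral_complex_of_real[symmetric]
      by (intro Bochner_Integration.integral_cong) auto
    ultimately have "(\<lambda>n. (\<Sum>j<n. G (m + j)) / of_nat n) \<longlonglongrightarrow> complex_of_real ?P" unfolding avg by simp
    then have "norm (complex_of_real ?P) \<le> e"
    proof (rule Lim_norm_ubound[rotated])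
      show "\<forall>\<^sub>F n in sequentially. norm ((\<Sum>j<n. G (m + j)) / of_nat n) \<le> e"
      proof (intro always_eventually allI)
        fix n
        have "norm (\<Sum>j<n. G (m + j)) \<le> (\<Sum>j<n. norm (G (m + j)))" by (rule norm_sum)
        also have "\<dots> \<le> (\<Sum>j<n. e)" by (rule sum_mono[OF less_imp_le[OF m]]) simp
        finally show "norm ((\<Sum>j<n. G (m + j)) / of_nat n) \<le> e"
          using e by (cases "n = 0") (auto simp: norm_divide divide_le_eq mult.commute)
      qed
    qed simp
    then show ?thesis by (simp add: abs_le_iff)
  qed
  have "measure D {x} * exp (- x) = (\<integral>y. exp (- x) * indicator {x} y \<partial>D)" by (simp add: mult.commute)
  also have "\<dots> \<le> ?P"
  proof (intro integral_mono intP)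
    show "integrable D (\<lambda>y. exp (- x) * indicator {x} y :: real)"
      by (intro integrable_mult_right D.integrable_const_bound[where B=1]) auto
    show "exp (- x) * indicator {x} y \<le> exp (- y) * (if w y = 1 then 1 else 0)" for y
      by (auto simp: indicator_def w_def)
  qed
  finally have "measure D {x} * exp (- x) \<le> 0"
    using small by (meson dense_ge order_trans)
  then have "measure D {x} \<le> 0" by (simp add: mult_le_0_iff)
  then show ?thesis using measure_nonneg[of D "{x}"] by linarith
qed

text \<open>
  Analytic continuation from the positive reals gives the transform on the line \<open>Re z = 1\<close>.
\<close>

lemma D_law_no_atom:
  fixes D :: "real measure"
  assumes D: "real_distribution D" "measure D {..<0} = 0" and \<gamma>: "0 < \<gamma>" "\<gamma> \<le> 1"
    and lt: "\<And>s. 0 < s \<Longrightarrow> (\<integral>y. exp (- s * y) \<partial>D) = 1 - s powr \<alpha> / (1 + s powr \<gamma>) powr (\<alpha> / \<gamma>)"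
  shows "measure D {x} = 0"
proof (rule vanishing_transform_no_atom[OF D(1)])
  interpret D: real_distribution D by fact
  have "{..<0} \<in> null_sets D" using D(2) by (simp add: null_sets_def D.emeasure_eq_measure)
  then show D0: "AE y in D. 0 \<le> y" by (rule AE_I') auto
  have eq: "(\<integral>y. exp (- Complex 1 (real k) * complex_of_real y) \<partial>D) = ml_transform \<gamma> (\<alpha> / \<gamma>) (Complex 1 (real k))" for k
  proof -
    let ?\<phi> = "\<lambda>z. \<integral>y. exp (- z * complex_of_real y) \<partial>D"
    \<comment> \<open>so large that the disc of radius \<open>c\<close> around \<open>c\<close> contains \<open>Complex 1 (real k)\<close>\<close>
    define c where "c = 1 + (real k)\<^sup>2"
    have c: "0 < c" by (simp add: c_def add_pos_nonneg)
    let ?S = "ball (complex_of_real c) c"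
    have Re: "0 < Re z" if "z \<in> ?S" for z
      using that complex_Re_le_cmod[of "complex_of_real c - z"] by (simp add: dist_norm)
    have "(\<lambda>z. ?\<phi> z - ml_transform \<gamma> (\<alpha> / \<gamma>) z) (Complex 1 (real k)) = 0"
    proof (rule analytic_continuation[where f="\<lambda>z. ?\<phi> z - ml_transform \<gamma> (\<alpha> / \<gamma>) z" and w="Complex 1 (real k)" and S="?S" and U="complex_of_real ` {0<..<c}" and \<xi>="complex_of_real (c/2)"])
      show "(\<lambda>z. ?\<phi> z - ml_transform \<gamma> (\<alpha> / \<gamma>) z) holomorphic_on ?S"
        using Re by (intro holomorphic_on_diff laplace_transform_holomorphic D(1) D0 c ml_transform_holomorphic \<gamma>)
      show "complex_of_real ` {0<..<c} \<subseteq> ?S"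
        by (auto simp: dist_norm simp flip: of_real_diff)
      show "complex_of_real (c/2) \<in> ?S" using c by (simp add: dist_norm flip: of_real_diff)
      show "complex_of_real (c/2) islimpt complex_of_real ` {0<..<c}"
      proof (rule islimpt_isCont_image)
        show "c/2 islimpt {0<..<c}" using c by (simp add: islimpt_greaterThanLessThan1 open_imp_islimpt)
        show "\<forall>\<^sub>F y in at (c/2). complex_of_real y \<noteq> complex_of_real (c/2)"
          unfolding of_real_eq_iff by (simp add: eventually_at_filter)
      qed auto
      show "?\<phi> z - ml_transform \<gamma> (\<alpha> / \<gamma>) z = 0" if z: "z \<in> complex_of_real ` {0<..<c}" for z
      proof -
        obtain s where s: "z = complex_of_real s" "0 < s" using z by auto
        have "?\<phi> z = complex_of_real (\<integral>y. exp (- s * y) \<partial>D)"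
          unfolding integral_complex_of_real[symmetric] by (simp add: s flip: exp_of_real)
        then show ?thesis using ml_transform_real[OF s(2) \<gamma>(1), of "\<alpha> / \<gamma>"] lt[OF s(2)] \<gamma>(1) by (simp add: s(1))
      qed
      show "Complex 1 (real k) \<in> ?S"
      proof -
        have "(norm (complex_of_real c - Complex 1 (real k)))\<^sup>2 = (c - 1)\<^sup>2 + (real k)\<^sup>2"
          by (simp add: cmod_power2)
        also have "\<dots> < c\<^sup>2" using c by (simp add: c_def power2_eq_square algebra_simps)
        finally show ?thesis using c by (simp add: dist_norm power2_less_imp_less)
      qed
    qed auto
    then show ?thesis by simp
  qed
  show "(\<lambda>k. \<integral>y. exp (- Complex 1 (real k) * complex_of_real y) \<partial>D) \<longlonglongrightarrow> 0"
    unfolding eq by (rule ml_transform_tendsto_0[OF \<gamma>(1)])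
qed

section \<open>Convergence of Laplace transforms\<close>

text \<open>
  Laplace transforms at integers are the moments of \<open>exp (- X)\<close>, which lies in \<open>[0,1]\<close>; by the
  theorem of Weierstrass their convergence extends to all continuous functions. The limit law is a
  mixture of an atom at 0, of weight \<open>a\<close>, and \<open>D\<close>.
\<close>

lemma exp_transform_continuous_convergence:
  fixes N :: "'t \<Rightarrow> 'b measure" and X :: "'t \<Rightarrow> 'b \<Rightarrow> real" and D :: "real measure"
  assumes N: "\<forall>\<^sub>F t in F. prob_space (N t) \<and> X t \<in> borel_measurable (N t) \<and> (\<forall>\<omega>\<in>space (N t). 0 \<le> X t \<omega>)"
    and D: "real_distribution D" "measure D {..<0} = 0" and ab: "0 \<le> a" "0 \<le> b" "a + b = 1"
    and conv: "\<And>k::nat. 1 \<le> k \<Longrightarrow>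
      ((\<lambda>t. \<integral>\<omega>. exp (- real k * X t \<omega>) \<partial>N t) \<longlongrightarrow> a + b * (\<integral>y. exp (- real k * y) \<partial>D)) F"
    and \<phi>: "continuous_on {0..1} \<phi>"
  shows "((\<lambda>t. \<integral>\<omega>. \<phi> (exp (- X t \<omega>)) \<partial>N t) \<longlongrightarrow> a * \<phi> 1 + b * (\<integral>y. \<phi> (exp (- max 0 y)) \<partial>D)) F"
proof (rule tendstoI)
  interpret D: real_distribution D by fact
  have D0: "AE y in D. 0 \<le> y"
  proof -
    have "{..<0} \<in> null_sets D" using D(2) by (simp add: null_sets_def D.emeasure_eq_measure)
    then show ?thesis by (rule AE_I') auto
  qed
  fix e :: real assume e: "0 < e"
  obtain g where g: "real_polynomial_function g" "\<And>u. u \<in> {0..1} \<Longrightarrow> \<bar>\<phi> u - g u\<bar> < e / 3"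
    using Stone_Weierstrass_real_polynomial_function[OF compact_Icc \<phi>, of "e / 3"] e by auto
  then obtain c n where c: "g = (\<lambda>u. \<Sum>i\<le>n. c i * u ^ i)"
    using real_polynomial_function_iff_sum by auto
  have g_exp: "g (exp (- z)) = (\<Sum>i\<le>n. c i * exp (- real i * z))" for z
    by (simp add: c exp_of_nat_mult[symmetric])
  have ab1: "0 \<le> b" "b \<le> 1" using ab by auto
  have cphi: "(\<lambda>u. \<phi> (max 0 (min 1 u))) \<in> borel_measurable borel"
    by (intro borel_measurable_continuous_onI continuous_on_compose2[OF \<phi>] continuous_intros) auto
  have bnd: "\<exists>B. \<forall>u\<in>{0..1}. \<bar>\<phi> u\<bar> \<le> B"
    using compact_continuous_image[OF \<phi> compact_Icc] by (auto simp: bounded_iff dest!: compact_imp_bounded)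
  then obtain B where B: "\<And>u. u \<in> {0..1} \<Longrightarrow> \<bar>\<phi> u\<bar> \<le> B" by blast
  let ?\<Lambda> = "a * g 1 + b * (\<integral>y. g (exp (- max 0 y)) \<partial>D)"
  \<comment> \<open>needed on the spaces \<open>N t\<close> and, with \<open>Z = max 0\<close>, on \<open>D\<close>\<close>
  have close: "\<bar>(\<integral>\<omega>. \<phi> (exp (- Z \<omega>)) \<partial>K) - (\<integral>\<omega>. g (exp (- Z \<omega>)) \<partial>K)\<bar> \<le> e / 3"
    if K: "prob_space K" and Z: "Z \<in> borel_measurable K" "\<And>\<omega>. \<omega> \<in> space K \<Longrightarrow> 0 \<le> Z \<omega>" for K :: "'k measure" and Z
  proof -
    interpret K: prob_space K by fact
    have u: "exp (- Z \<omega>) \<in> {0..1}" if "\<omega> \<in> space K" for \<omega> using Z(2)[OF that] by simp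
    have m1: "(\<lambda>\<omega>. \<phi> (exp (- Z \<omega>))) \<in> borel_measurable K"
    proof (rule measurable_cong[THEN iffD1])
      show "(\<lambda>\<omega>. \<phi> (max 0 (min 1 (exp (- Z \<omega>))))) \<in> borel_measurable K"
        using Z(1) by (intro measurable_compose[OF _ cphi]) measurable
    qed (use u in auto)
    have i1: "integrable K (\<lambda>\<omega>. \<phi> (exp (- Z \<omega>)))"
      by (rule K.integrable_const_bound[where B=B, OF _ m1]) (use B u in auto)
    have i2: "integrable K (\<lambda>\<omega>. g (exp (- Z \<omega>)))"
    proof -
      have "integrable K (\<lambda>\<omega>. exp (- real i * Z \<omega>))" for i
        by (rule K.integrable_const_bound[where B=1]) (use Z in auto)
      then show ?thesis unfolding g_exp by auto
    qed
    have "\<bar>(\<integral>\<omega>. \<phi> (exp (- Z \<omega>)) - g (exp (- Z \<omega>)) \<partial>K)\<bar> \<le> (\<integral>\<omega>. \<bar>\<phi> (exp (- Z \<omega>)) - g (exp (- Z \<omega>))\<bar> \<partial>K)"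
      by (rule integral_abs_bound)
    also have "\<dots> \<le> (\<integral>\<omega>. e / 3 \<partial>K)"
      by (intro integral_mono integrable_abs Bochner_Integration.integrable_diff i1 i2) (use g(2)[OF u] in \<open>auto intro: less_imp_le\<close>)
    finally show ?thesis using i1 i2 by (simp add: K.prob_space)
  qed
  have gD: "(\<integral>y. g (exp (- max 0 y)) \<partial>D) = (\<Sum>i\<le>n. c i * (\<integral>y. exp (- real i * y) \<partial>D))"
  proof -
    have i: "integrable D (\<lambda>y. exp (- real i * y))" for i
      by (rule D.integrable_const_bound[where B=1]) (use D0 in auto)
    have "(\<integral>y. g (exp (- max 0 y)) \<partial>D) = (\<integral>y. (\<Sum>i\<le>n. c i * exp (- real i * y)) \<partial>D)"
      by (rule integral_cong_AE) (use D0 in \<open>auto simp: g_exp max_def\<close>)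
    then show ?thesis using i by simp
  qed
  have "((\<lambda>t. \<integral>\<omega>. g (exp (- X t \<omega>)) \<partial>N t) \<longlongrightarrow> ?\<Lambda>) F"
  proof -
    have lim: "((\<lambda>t. \<integral>\<omega>. exp (- real i * X t \<omega>) \<partial>N t) \<longlongrightarrow> a + b * (\<integral>y. exp (- real i * y) \<partial>D)) F" for i
    proof (cases "i = 0")
      case True
      have "\<forall>\<^sub>F t in F. 1 = (\<integral>\<omega>. exp (- real i * X t \<omega>) \<partial>N t)"
        using N by eventually_elim (simp add: True prob_space.prob_space)
      then show ?thesis using ab True
        by (intro Lim_transform_eventually[OF tendsto_const]) (simp add: D.prob_space[simplified])
    qed (use conv in simp)
    have "((\<lambda>t. \<Sum>i\<le>n. c i * (\<integral>\<omega>. exp (- real i * X t \<omega>) \<partial>N t)) \<longlongrightarrow>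
        (\<Sum>i\<le>n. c i * (a + b * (\<integral>y. exp (- real i * y) \<partial>D)))) F"
      by (intro tendsto_intros lim)
    then have "((\<lambda>t. \<Sum>i\<le>n. c i * (\<integral>\<omega>. exp (- real i * X t \<omega>) \<partial>N t)) \<longlongrightarrow> ?\<Lambda>) F"
      unfolding gD by (simp add: c distrib_left sum.distrib sum_distrib_left sum_distrib_right mult_ac)
    moreover have "\<forall>\<^sub>F t in F. (\<Sum>i\<le>n. c i * (\<integral>\<omega>. exp (- real i * X t \<omega>) \<partial>N t)) = (\<integral>\<omega>. g (exp (- X t \<omega>)) \<partial>N t)"
      using N
    proof eventually_elim
      case (elim t)
      then interpret K: prob_space "N t" by simp
      have "integrable (N t) (\<lambda>\<omega>. exp (- real i * X t \<omega>))" for i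
        by (rule K.integrable_const_bound[where B=1]) (use elim in auto)
      then show ?case unfolding g_exp by simp
    qed
    ultimately show ?thesis by (rule Lim_transform_eventually)
  qed
  then have "\<forall>\<^sub>F t in F. \<bar>(\<integral>\<omega>. g (exp (- X t \<omega>)) \<partial>N t) - ?\<Lambda>\<bar> < e / 3"
    using e tendstoD[of _ ?\<Lambda> F "e / 3"] by (simp add: dist_real_def)
  with N show "\<forall>\<^sub>F t in F. dist (\<integral>\<omega>. \<phi> (exp (- X t \<omega>)) \<partial>N t) (a * \<phi> 1 + b * (\<integral>y. \<phi> (exp (- max 0 y)) \<partial>D)) < e"
  proof eventually_elim
    case (elim t)
    have 1: "\<bar>(\<integral>\<omega>. \<phi> (exp (- X t \<omega>)) \<partial>N t) - (\<integral>\<omega>. g (exp (- X t \<omega>)) \<partial>N t)\<bar> \<le> e / 3"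
      using elim by (intro close) auto
    have 2: "\<bar>(\<integral>y. \<phi> (exp (- max 0 y)) \<partial>D) - (\<integral>y. g (exp (- max 0 y)) \<partial>D)\<bar> \<le> e / 3"
      by (intro close D.prob_space_axioms) auto
    have 3: "\<bar>\<phi> 1 - g 1\<bar> \<le> e / 3" using g(2)[of 1] by simp
    have "\<bar>(a * \<phi> 1 + b * (\<integral>y. \<phi> (exp (- max 0 y)) \<partial>D)) - ?\<Lambda>\<bar> =
        \<bar>a * (\<phi> 1 - g 1) + b * ((\<integral>y. \<phi> (exp (- max 0 y)) \<partial>D) - (\<integral>y. g (exp (- max 0 y)) \<partial>D))\<bar>"
      by (simp add: algebra_simps)
    also have "\<dots> \<le> a * (e / 3) + b * (e / 3)"
      using ab mult_left_mono[OF 3, of a] mult_left_mono[OF 2, of b]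
      by (intro order_trans[OF abs_triangle_ineq]) (simp add: abs_mult)
    also have "\<dots> = e / 3" using ab(3) by (simp flip: distrib_right)
    finally show ?case using 1 elim unfolding dist_real_def by linarith
  qed
qed

text \<open>
  The indicator of \<open>X \<le> x\<close> is squeezed between two ramps, and \<open>x\<close> is a point of continuity.
\<close>

lemma laplace_cdf_convergence:
  fixes N :: "'t \<Rightarrow> 'b measure" and X :: "'t \<Rightarrow> 'b \<Rightarrow> real" and D :: "real measure"
  assumes N: "\<forall>\<^sub>F t in F. prob_space (N t) \<and> X t \<in> borel_measurable (N t) \<and> (\<forall>\<omega>\<in>space (N t). 0 \<le> X t \<omega>)"
    and D: "real_distribution D" "measure D {..<0} = 0" and ab: "0 \<le> a" "0 \<le> b" "a + b = 1"
    and conv: "\<And>k::nat. 1 \<le> k \<Longrightarrow>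
      ((\<lambda>t. \<integral>\<omega>. exp (- real k * X t \<omega>) \<partial>N t) \<longlongrightarrow> a + b * (\<integral>y. exp (- real k * y) \<partial>D)) F"
    and x: "0 < x" "measure D {x} = 0"
  shows "((\<lambda>t. measure (N t) {\<omega>\<in>space (N t). X t \<omega> \<le> x}) \<longlongrightarrow> a + b * cdf D x) F"
proof -
  interpret D: real_distribution D by fact
  have cont: "isCont (cdf D) x" using x(2) by (simp add: D.isCont_cdf)
  have D0: "AE y in D. 0 \<le> y"
  proof -
    have "{..<0} \<in> null_sets D" using D(2) by (simp add: null_sets_def D.emeasure_eq_measure)
    then show ?thesis by (rule AE_I') auto
  qed
  \<comment> \<open>a ramp, as a function of exp (-y): 1 for y \<le> v, 0 for y \<ge> w\<close>
  define \<phi> where "\<phi> v w u = max 0 (min 1 ((u - exp (- w)) / (exp (- v) - exp (- w))))" for v w u :: real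
  have \<phi>_cont: "continuous_on {0..1} (\<phi> v w)" if "v < w" for v w
    unfolding \<phi>_def using that by (intro continuous_intros) auto
  have \<phi>01: "0 \<le> \<phi> v w u" "\<phi> v w u \<le> 1" for v w u by (auto simp: \<phi>_def)
  have \<phi>1: "\<phi> v w (exp (- y)) = 1" if "v < w" "y \<le> v" for v w y
    using that by (simp add: \<phi>_def le_divide_eq)
  have \<phi>0: "\<phi> v w (exp (- y)) = 0" if "v < w" "w \<le> y" for v w y
    using that by (simp add: \<phi>_def divide_le_0_iff)
  have \<phi>_mono: "\<phi> v w (exp (- y)) \<le> indicator {..w} y" "indicator {..v} y \<le> \<phi> v w (exp (- y))" if "v < w" for v w y
    using \<phi>01[of v w "exp (- y)"] \<phi>1[OF that, of y] \<phi>0[OF that, of y] by (auto simp: indicator_def)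
  have \<phi>_meas: "\<phi> v w \<in> borel_measurable borel" for v w
    unfolding \<phi>_def by measurable
  have ineq: "measure K {\<omega>\<in>space K. Z \<omega> \<le> v} \<le> (\<integral>\<omega>. \<phi> v w (exp (- Z \<omega>)) \<partial>K)"
     "(\<integral>\<omega>. \<phi> v w (exp (- Z \<omega>)) \<partial>K) \<le> measure K {\<omega>\<in>space K. Z \<omega> \<le> w}"
    if K: "prob_space K" and Z: "Z \<in> borel_measurable K" and vw: "v < w" for K :: "'k measure" and Z v w
  proof -
    interpret K: prob_space K by fact
    have [measurable]: "Z \<in> borel_measurable K" by fact
    have i: "integrable K (\<lambda>\<omega>. \<phi> v w (exp (- Z \<omega>)))"
      by (rule K.integrable_const_bound[where B=1]) (use \<phi>01 in \<open>auto intro!: measurable_compose[OF _ \<phi>_meas]\<close>)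
    have ind: "integrable K (\<lambda>\<omega>. indicator {..c} (Z \<omega>) :: real)" "(\<integral>\<omega>. indicator {..c} (Z \<omega>) \<partial>K) = measure K {\<omega>\<in>space K. Z \<omega> \<le> c}" for c
    proof -
      show "integrable K (\<lambda>\<omega>. indicator {..c} (Z \<omega>) :: real)"
        by (rule K.integrable_const_bound[where B=1]) auto
      have "(\<integral>\<omega>. indicator {..c} (Z \<omega>) \<partial>K) = (\<integral>\<omega>. indicat_real {\<omega>\<in>space K. Z \<omega> \<le> c} \<omega> \<partial>K)"
        by (intro Bochner_Integration.integral_cong) (auto simp: indicator_def)
      then show "(\<integral>\<omega>. indicator {..c} (Z \<omega>) \<partial>K) = measure K {\<omega>\<in>space K. Z \<omega> \<le> c}" by simp
    qed
    show "measure K {\<omega>\<in>space K. Z \<omega> \<le> v} \<le> (\<integral>\<omega>. \<phi> v w (exp (- Z \<omega>)) \<partial>K)"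
      unfolding ind(2)[symmetric] by (intro integral_mono ind(1) i \<phi>_mono vw)
    show "(\<integral>\<omega>. \<phi> v w (exp (- Z \<omega>)) \<partial>K) \<le> measure K {\<omega>\<in>space K. Z \<omega> \<le> w}"
      unfolding ind(2)[symmetric] by (intro integral_mono ind(1) i \<phi>_mono vw)
  qed
  have lim: "((\<lambda>t. \<integral>\<omega>. \<phi> v w (exp (- X t \<omega>)) \<partial>N t) \<longlongrightarrow> a + b * (\<integral>y. \<phi> v w (exp (- max 0 y)) \<partial>D)) F"
    if "v < w" "0 \<le> v" for v w
    using exp_transform_continuous_convergence[OF N D ab conv \<phi>_cont[OF that(1)]] \<phi>1[OF that(1), of 0] that by simp
  have cdf_max: "measure D {y\<in>space D. max 0 y \<le> v} = cdf D v" if "0 \<le> v" for v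
    using that by (simp add: cdf_def atMost_def)
  show ?thesis
  proof (rule order_tendstoI)
    fix c assume c: "c < a + b * cdf D x"
    have "((\<lambda>v. a + b * cdf D v) \<longlongrightarrow> a + b * cdf D x) (at_left x)"
      using cont by (intro tendsto_intros) (simp add: isCont_def filterlim_at_split)
    then have "\<forall>\<^sub>F v in at_left x. c < a + b * cdf D v \<and> 0 < v \<and> v < x"
      using eventually_at_left_real[OF x(1)] by (intro eventually_conj order_tendstoD(1)[OF _ c]) (auto elim: eventually_mono)
    then obtain v where v: "c < a + b * cdf D v" "0 < v" "v < x"
      using eventually_happens'[OF trivial_limit_at_left_real] by blast
    have "cdf D v \<le> (\<integral>y. \<phi> v x (exp (- max 0 y)) \<partial>D)"
      using ineq(1)[OF D.prob_space_axioms, of "max 0" v x] v cdf_max[of v] by simp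
    then have "c < a + b * (\<integral>y. \<phi> v x (exp (- max 0 y)) \<partial>D)"
      using v(1) ab mult_left_mono[of "cdf D v" _ b] by fastforce
    from order_tendstoD(1)[OF lim[OF v(3) less_imp_le[OF v(2)]] this] N
    show "\<forall>\<^sub>F t in F. c < measure (N t) {\<omega> \<in> space (N t). X t \<omega> \<le> x}"
    proof eventually_elim
      case (elim t)
      then show ?case using ineq(2)[of "N t" "X t" v x] v by auto
    qed
  next
    fix c assume c: "a + b * cdf D x < c"
    have "((\<lambda>v. a + b * cdf D v) \<longlongrightarrow> a + b * cdf D x) (at_right x)"
      using cont by (intro tendsto_intros) (simp add: isCont_def filterlim_at_split)
    then have "\<forall>\<^sub>F v in at_right x. a + b * cdf D v < c \<and> x < v"
      by (intro eventually_conj order_tendstoD(2)[OF _ c] eventually_at_right_less)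
    then obtain v where v: "a + b * cdf D v < c" "x < v"
      using eventually_happens'[OF trivial_limit_at_right_real] by blast
    have "(\<integral>y. \<phi> x v (exp (- max 0 y)) \<partial>D) \<le> cdf D v"
      using ineq(2)[OF D.prob_space_axioms, of "max 0" x v] v x cdf_max[of v] by simp
    then have "a + b * (\<integral>y. \<phi> x v (exp (- max 0 y)) \<partial>D) < c"
      using v(1) ab mult_left_mono[of _ "cdf D v" b] by fastforce
    from order_tendstoD(2)[OF lim[OF v(2) less_imp_le[OF x(1)]] this] N
    show "\<forall>\<^sub>F t in F. measure (N t) {\<omega> \<in> space (N t). X t \<omega> \<le> x} < c"
    proof eventually_elim
      case (elim t)
      then show ?case using ineq(1)[of "N t" "X t" x v] v by auto
    qed
  qed
qed

text \<open>
  Helly's selection theorem for the laws of \<open>exp (- X n)\<close>, which are tight as laws on \<open>[0,1]\<close>.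
  The limit of \<open>\<psi>\<close> at 0 shows that no mass of the limit sits at \<open>exp (- X) = 0\<close>, that is, at infinity.
\<close>

lemma laplace_limit_exists:
  fixes N :: "nat \<Rightarrow> 'b measure" and X :: "nat \<Rightarrow> 'b \<Rightarrow> real" and \<psi> :: "real \<Rightarrow> real"
  assumes N: "\<And>n. prob_space (N n)" "\<And>n. X n \<in> borel_measurable (N n)" "\<And>n \<omega>. \<omega> \<in> space (N n) \<Longrightarrow> 0 \<le> X n \<omega>"
    and conv: "\<And>s. 0 < s \<Longrightarrow> (\<lambda>n. \<integral>\<omega>. exp (- s * X n \<omega>) \<partial>N n) \<longlonglongrightarrow> \<psi> s"
    and \<psi>: "(\<psi> \<longlongrightarrow> 1) (at_right 0)"
  obtains D where "real_distribution D" "measure D {..<0} = 0" "\<And>s. 0 < s \<Longrightarrow> (\<integral>y. exp (- s * y) \<partial>D) = \<psi> s"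
proof -
  define U where "U n = distr (N n) borel (\<lambda>\<omega>. exp (- X n \<omega>))" for n
  have meas: "(\<lambda>\<omega>. exp (- X n \<omega>)) \<in> borel_measurable (N n)" for n using N(2) by measurable
  have rd: "real_distribution (U n)" for n
    unfolding U_def using prob_space.real_distribution_distr[OF N(1) meas] .
  have tight: "tight U"
    unfolding tight_def
  proof (intro conjI allI impI rd)
    fix e :: real assume "0 < e"
    have "measure (U n) {-1<..1} = 1" for n
    proof -
      interpret prob_space "N n" by (rule N)
      have "(\<lambda>\<omega>. exp (- X n \<omega>)) -` {-1<..1} \<inter> space (N n) = space (N n)"
      proof -
        have "-1 < exp z" for z :: real using exp_gt_zero[of z] by linarith
        then show ?thesis using N(3) by auto
      qed
      then show ?thesis unfolding U_def using meas by (simp add: measure_distr prob_space)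
    qed
    then show "\<exists>a b. a < b \<and> (\<forall>n. 1 - e < measure (U n) {a<..b})"
      using \<open>0 < e\<close> by (intro exI[of _ "-1"] exI[of _ 1]) auto
  qed
  obtain r D' where r: "strict_mono r" and D': "real_distribution D'" and weak: "weak_conv_m (U \<circ> id \<circ> r) D'"
    using tight_imp_convergent_subsubsequence[OF tight strict_mono_id] by blast
  interpret D': real_distribution D' by fact
  define c where "c u = max 0 (min 1 u)" for u :: real
  have c01: "0 \<le> c u" "c u \<le> 1" for u by (auto simp: c_def)
  have c_meas [measurable]: "c \<in> borel_measurable borel" unfolding c_def by measurable
  have pow: "(\<integral>u. c u powr s \<partial>D') = \<psi> s" if s: "0 < s" for s
  proof -
    have "(\<lambda>n. \<integral>u. c u powr s \<partial>(U \<circ> id \<circ> r) n) \<longlonglongrightarrow> (\<integral>u. c u powr s \<partial>D')"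
    proof (rule weak_conv_imp_integral_bdd_continuous_conv[OF _ D' weak, where B=1])
      show "isCont (\<lambda>u. c u powr s) u" for u
      proof -
        have "continuous_on UNIV (\<lambda>u. c u powr s)"
          unfolding c_def using s by (intro continuous_on_powr' continuous_intros) auto
        then show ?thesis by (simp add: continuous_on_eq_continuous_at)
      qed
      show "norm (c u powr s) \<le> 1" for u using c01[of u] s by (simp add: powr_le1)
    qed (use rd in simp)
    moreover have "(\<integral>u. c u powr s \<partial>(U \<circ> id \<circ> r) n) = (\<integral>\<omega>. exp (- s * X (r n) \<omega>) \<partial>N (r n))" for n
    proof -
      have "(\<integral>u. c u powr s \<partial>(U \<circ> id \<circ> r) n) = (\<integral>\<omega>. c (exp (- X (r n) \<omega>)) powr s \<partial>N (r n))"
        unfolding U_def o_def id_def by (rule integral_distr[OF meas]) measurable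
      also have "\<dots> = (\<integral>\<omega>. exp (- s * X (r n) \<omega>) \<partial>N (r n))"
        using N(3) by (intro Bochner_Integration.integral_cong) (auto simp: c_def powr_def)
      finally show ?thesis .
    qed
    ultimately have "(\<lambda>n. \<integral>\<omega>. exp (- s * X (r n) \<omega>) \<partial>N (r n)) \<longlonglongrightarrow> (\<integral>u. c u powr s \<partial>D')" by simp
    moreover have "(\<lambda>n. \<integral>\<omega>. exp (- s * X (r n) \<omega>) \<partial>N (r n)) \<longlonglongrightarrow> \<psi> s"
      using LIMSEQ_subseq_LIMSEQ[OF conv[OF s] r] by (simp add: o_def)
    ultimately show ?thesis by (rule LIMSEQ_unique)
  qed
  have pos: "AE u in D'. 0 < u"
  proof -
    have at0: "filterlim (\<lambda>n. 1 / real (Suc n)) (at_right 0) sequentially"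
      using LIMSEQ_Suc[OF lim_const_over_n[of "1::real"]] by (auto simp: filterlim_at intro!: always_eventually)
    have "(\<lambda>n. \<integral>u. c u powr (1 / real (Suc n)) \<partial>D') \<longlonglongrightarrow> (\<integral>u. indicator {0<..} u \<partial>D')"
    proof (rule integral_dominated_convergence[where w="\<lambda>_. 1"])
      show "AE u in D'. (\<lambda>n. c u powr (1 / real (Suc n))) \<longlonglongrightarrow> indicator {0<..} u"
      proof (intro AE_I2)
        fix u
        show "(\<lambda>n. c u powr (1 / real (Suc n))) \<longlonglongrightarrow> indicator {0<..} u"
        proof (cases "0 < u")
          case True
          then have "0 < c u" by (simp add: c_def)
          then have "(\<lambda>n. c u powr (1 / real (Suc n))) \<longlonglongrightarrow> c u powr 0"
            using LIMSEQ_Suc[OF lim_const_over_n[of "1::real"]] by (intro tendsto_intros) auto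
          then show ?thesis using True \<open>0 < c u\<close> by simp
        qed (simp add: c_def)
      qed
    qed (use c01 in \<open>auto simp: powr_le1\<close>)
    moreover have "(\<lambda>n. \<integral>u. c u powr (1 / real (Suc n)) \<partial>D') \<longlonglongrightarrow> 1"
      using filterlim_compose[OF \<psi> at0] by (simp add: pow)
    ultimately have "D'.prob {0<..} = 1" by (simp add: LIMSEQ_unique)
    then show ?thesis using D'.prob_eq_1[of "{0<..}"] by simp
  qed
  define D where "D = distr D' borel (\<lambda>u. - ln (c u))"
  have Dm: "(\<lambda>u. - ln (c u)) \<in> borel_measurable D'" by measurable
  have "real_distribution D" unfolding D_def by (rule D'.real_distribution_distr[OF Dm])
  moreover have "measure D {..<0} = 0"
  proof -
    have "(\<lambda>u. - ln (c u)) -` {..<0} \<inter> space D' = {}"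
    proof -
      have "ln (c u) \<le> 0" for u using c01[of u] by (cases "c u = 0") (auto simp: ln_le_zero_iff)
      then have "\<not> - ln (c u) < 0" for u by (simp add: not_less)
      then show ?thesis by auto
    qed
    then show ?thesis unfolding D_def using Dm by (simp add: measure_distr)
  qed
  moreover have "(\<integral>y. exp (- s * y) \<partial>D) = \<psi> s" if s: "0 < s" for s
  proof -
    have "(\<integral>y. exp (- s * y) \<partial>D) = (\<integral>u. exp (- s * - ln (c u)) \<partial>D')"
      unfolding D_def by (rule integral_distr[OF Dm]) measurable
    also have "\<dots> = (\<integral>u. c u powr s \<partial>D')"
      by (rule integral_cong_AE) (use pos in \<open>auto simp: c_def powr_def max_def\<close>)
    finally show ?thesis using pow[OF s] by simp
  qed
  ultimately show ?thesis by (rule that)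
qed

section \<open>Conditional limit theorems\<close>

lemma (in prob_space) integral_uniform_measure_real:
  fixes f :: "'a \<Rightarrow> real"
  assumes A: "A \<in> events" "0 < prob A" and f: "f \<in> borel_measurable M"
  shows "(\<integral>\<omega>. f \<omega> \<partial>uniform_measure M A) = (\<integral>\<omega>. indicator A \<omega> * f \<omega> \<partial>M) / prob A"
proof -
  have "uniform_measure M A = density M (\<lambda>x. ennreal (indicator A x / prob A))"
    unfolding uniform_measure_def
  proof (rule density_cong)
    show "AE x in M. indicator A x / emeasure M A = ennreal (indicator A x / prob A)"
      using A by (intro AE_I2) (auto simp: emeasure_eq_measure indicator_def divide_ennreal[symmetric])
  qed (use A in auto)
  then have "(\<integral>\<omega>. f \<omega> \<partial>uniform_measure M A) = (\<integral>\<omega>. (indicator A \<omega> / prob A) * f \<omega> \<partial>M)"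
    using A f by (simp add: integral_real_density)
  then show ?thesis by simp
qed

lemma (in prob_space) prob_positive_count:
  assumes Z: "Z \<in> measurable M (count_space UNIV)"
  shows "prob {\<omega>\<in>space M. 0 < Z \<omega>} = 1 - (\<integral>\<omega>. (0::real) ^ Z \<omega> \<partial>M)"
proof -
  have [measurable]: "Z \<in> measurable M (count_space UNIV)" by fact
  have "(\<integral>\<omega>. (0::real) ^ Z \<omega> \<partial>M) = (\<integral>\<omega>. indicat_real {\<omega>\<in>space M. Z \<omega> = 0} \<omega> \<partial>M)"
    by (intro Bochner_Integration.integral_cong) (auto simp: indicator_def power_0_left)
  also have "\<dots> = prob {\<omega>\<in>space M. Z \<omega> = 0}" by simp
  finally have eq: "(\<integral>\<omega>. (0::real) ^ Z \<omega> \<partial>M) = prob {\<omega>\<in>space M. Z \<omega> = 0}" .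
  have "{\<omega>\<in>space M. 0 < Z \<omega>} = space M - {\<omega>\<in>space M. Z \<omega> = 0}" by auto
  then show ?thesis unfolding eq by (simp add: prob_compl)
qed

text \<open>
  As \<open>0 ^ 0 = 1\<close>, the expectation of \<open>0 ^ Z\<close> is the probability of \<open>Z = 0\<close>.
\<close>

lemma (in prob_space) conditional_pgf:
  assumes Z: "Z \<in> measurable M (count_space UNIV)" and s: "0 \<le> s" "s \<le> 1"
    and pos: "(\<integral>\<omega>. (0::real) ^ Z \<omega> \<partial>M) < 1"
  shows "(\<integral>\<omega>. s ^ Z \<omega> \<partial>uniform_measure M {\<omega>\<in>space M. 0 < Z \<omega>}) =
    1 - (1 - (\<integral>\<omega>. s ^ Z \<omega> \<partial>M)) / (1 - (\<integral>\<omega>. (0::real) ^ Z \<omega> \<partial>M))"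
proof -
  have [measurable]: "Z \<in> measurable M (count_space UNIV)" by fact
  let ?A = "{\<omega>\<in>space M. 0 < Z \<omega>}"
  have A: "?A \<in> events" by measurable
  note pA = prob_positive_count[OF Z]
  have int: "integrable M (\<lambda>\<omega>. c ^ Z \<omega>)" if "0 \<le> c" "c \<le> 1" for c :: real
    by (rule integrable_const_bound[where B=1]) (use that in \<open>auto simp: power_le_one\<close>)
  have "(\<integral>\<omega>. s ^ Z \<omega> \<partial>uniform_measure M ?A) = (\<integral>\<omega>. indicator ?A \<omega> * s ^ Z \<omega> \<partial>M) / prob ?A"
    by (rule integral_uniform_measure_real[OF A]) (use pA pos in auto)
  also have "(\<integral>\<omega>. indicator ?A \<omega> * s ^ Z \<omega> \<partial>M) = (\<integral>\<omega>. s ^ Z \<omega> - 0 ^ Z \<omega> \<partial>M)"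
    by (intro Bochner_Integration.integral_cong) (auto simp: indicator_def power_0_left)
  also have "\<dots> = (\<integral>\<omega>. s ^ Z \<omega> \<partial>M) - (\<integral>\<omega>. 0 ^ Z \<omega> \<partial>M)"
    using int s by (intro Bochner_Integration.integral_diff) auto
  finally show ?thesis unfolding pA using pos by (simp add: field_simps)
qed

lemma exp_scaled_count:
  "exp (- c * (real n / w)) = exp (- c / w) ^ n"
  by (simp add: exp_of_nat_mult[symmetric] mult.commute)

context regular_immigration
begin

text \<open>
  The limit of \<open>q(t;s) / q(t)\<close> for \<open>s = exp (- x / W(\<mu> t))\<close>.
\<close>

definition \<kappa> :: "real \<Rightarrow> real" where
  "\<kappa> x = x powr \<alpha> / (1 + x powr \<gamma>) powr (\<alpha> / \<gamma>)"

text \<open>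
  The argument at which the generating function of \<open>Z\<close> is the Laplace transform of
  \<open>Z / W(\<mu> t)\<close> at \<open>x\<close>.
\<close>

definition scaled_arg :: "real \<Rightarrow> real \<Rightarrow> real" where
  "scaled_arg x t = exp (- x / W (\<mu> * t))"

text \<open>
  A group evaluated at \<open>s\<close> instead of 0 looks older by this amount: \<open>q(t;s) = q(t + time_shift s)\<close>.
\<close>

definition time_shift :: "real \<Rightarrow> real" where
  "time_shift s = V (1 / (1 - s)) / \<mu>"

lemma time_shift_nonneg: "0 \<le> s \<Longrightarrow> s < 1 \<Longrightarrow> 0 \<le> time_shift s"
  unfolding time_shift_def using rate_pos by (intro divide_nonneg_pos V_nonneg) auto

lemma scaled_arg_bounds:
  assumes "0 < x" "0 \<le> t"
  shows "0 \<le> scaled_arg x t" "scaled_arg x t < 1"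
proof -
  have "0 < W (\<mu> * t)" using W_ge_1[of "\<mu> * t"] rate_pos assms by simp
  then show "0 \<le> scaled_arg x t" "scaled_arg x t < 1" using assms by (auto simp: scaled_arg_def)
qed

lemma Wmu_at_top: "filterlim (\<lambda>t. W (\<mu> * t)) at_top at_top"
  by (intro filterlim_compose[OF W_at_top] filterlim_tendsto_pos_mult_at_top[OF tendsto_const rate_pos filterlim_ident])

text \<open>
  For \<open>s = scaled_arg x t\<close> one has \<open>1 / (1 - s)\<close> asymptotic to \<open>W(\<mu> t) / x\<close>, and \<open>V\<close>
  varies regularly with index \<open>\<gamma>\<close>.
\<close>

lemma scaled_time_shift:
  assumes x: "0 < x"
  shows "((\<lambda>t. time_shift (scaled_arg x t) / t) \<longlongrightarrow> x powr (- \<gamma>)) at_top"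
proof -
  have z: "((\<lambda>z::real. (1 - exp (- z)) / z) \<longlongrightarrow> 1) (at 0)"
  proof -
    have "((\<lambda>z::real. 1 - exp (- z)) has_real_derivative 1) (at 0)"
      by (auto intro!: derivative_eq_intros)
    then show ?thesis by (simp add: has_field_derivative_iff)
  qed
  have Wpos: "\<forall>\<^sub>F t in at_top. 0 < W (\<mu> * t)"
    using Wmu_at_top by (simp add: filterlim_at_top_dense)
  have "filterlim (\<lambda>t. x / W (\<mu> * t)) (at 0) at_top"
    unfolding filterlim_at
    by (intro conjI real_tendsto_divide_at_top[OF tendsto_const Wmu_at_top] eventually_mono[OF Wpos]) (use x in auto)
  from filterlim_compose[OF z this]
  have "((\<lambda>t. 1 / (x * ((1 - exp (- (x / W (\<mu> * t)))) / (x / W (\<mu> * t))))) \<longlongrightarrow> 1 / (x * 1)) at_top"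
    using x by (intro tendsto_intros) auto
  moreover have "\<forall>\<^sub>F t in at_top. 1 / (x * ((1 - exp (- (x / W (\<mu> * t)))) / (x / W (\<mu> * t)))) =
      (1 / (1 - scaled_arg x t)) / W (\<mu> * t)"
    using Wpos by eventually_elim (use x in \<open>simp add: scaled_arg_def\<close>)
  ultimately have "((\<lambda>t. (1 / (1 - scaled_arg x t)) / W (\<mu> * t)) \<longlongrightarrow> 1 / x) at_top"
    unfolding mult_1_right by (rule Lim_transform_eventually)
  from V_ratio[OF Wmu_at_top this]
  have "((\<lambda>t. V (1 / (1 - scaled_arg x t)) / V (W (\<mu> * t))) \<longlongrightarrow> (1 / x) powr \<gamma>) at_top"
    using x by simp
  moreover have "\<forall>\<^sub>F t in at_top. V (1 / (1 - scaled_arg x t)) / V (W (\<mu> * t)) = time_shift (scaled_arg x t) / t"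
    using eventually_gt_at_top[of 0] by eventually_elim (use rate_pos in \<open>simp add: time_shift_def\<close>)
  ultimately have "((\<lambda>t. time_shift (scaled_arg x t) / t) \<longlongrightarrow> (1 / x) powr \<gamma>) at_top"
    by (rule Lim_transform_eventually)
  then show ?thesis using x by (simp add: powr_divide powr_minus inverse_eq_divide)
qed

lemma \<kappa>_eq:
  assumes "0 < x" shows "(1 + x powr (- \<gamma>)) powr (- \<alpha> / \<gamma>) = \<kappa> x"
proof -
  have "1 + x powr (- \<gamma>) = (1 + x powr \<gamma>) / x powr \<gamma>"
    using assms by (simp add: powr_minus divide_simps)
  then have "(1 + x powr (- \<gamma>)) powr (- \<alpha> / \<gamma>) = (1 + x powr \<gamma>) powr (- \<alpha> / \<gamma>) / (x powr \<gamma>) powr (- \<alpha> / \<gamma>)"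
    using assms by (simp add: powr_divide)
  also have "\<dots> = \<kappa> x"
    using gamma by (simp add: \<kappa>_def powr_powr powr_minus field_simps)
  finally show ?thesis .
qed

lemma q_shift_ratio:
  assumes "((\<lambda>t. c t / t) \<longlongrightarrow> a) at_top" "0 \<le> a"
  shows "((\<lambda>t. q (t - u + c t) / q t) \<longlongrightarrow> (1 + a) powr (- \<alpha> / \<gamma>)) at_top"
proof (rule q_ratio[OF filterlim_ident])
  have "((\<lambda>t. 1 - u / t + c t / t) \<longlongrightarrow> 1 - 0 + a) at_top"
    by (intro tendsto_intros assms real_tendsto_divide_at_top[OF tendsto_const filterlim_ident])
  moreover have "\<forall>\<^sub>F t in at_top. 1 - u / t + c t / t = (t - u + c t) / t"
    using eventually_gt_at_top[of 0] by eventually_elim (simp add: field_simps)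
  ultimately show "((\<lambda>t. (t - u + c t) / t) \<longlongrightarrow> 1 + a) at_top"
    unfolding diff_0_right by (rule Lim_transform_eventually)
qed (use assms in simp)

lemma \<kappa>_at_0: "(\<kappa> \<longlongrightarrow> 0) (at_right 0)"
proof (rule tendsto_sandwich[OF _ _ tendsto_const])
  show "\<forall>\<^sub>F x in at_right 0. 0 \<le> \<kappa> x" by (simp add: \<kappa>_def)
  show "\<forall>\<^sub>F x in at_right 0. \<kappa> x \<le> x powr \<alpha>"
  proof (intro always_eventually allI)
    fix x :: real
    have "1 \<le> (1 + x powr \<gamma>) powr (\<alpha> / \<gamma>)" using alpha gamma by (intro ge_one_powr_ge_zero) auto
    then show "\<kappa> x \<le> x powr \<alpha>" unfolding \<kappa>_def by (simp add: divide_le_eq mult_left_le_imp_le mult_le_cancel_left1)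
  qed
  have "((\<lambda>x. x powr \<alpha>) \<longlongrightarrow> 0 powr \<alpha>) (at_right (0::real))"
    using alpha by (intro tendsto_powr') (auto intro: tendsto_ident_at eventually_at_right_less[THEN eventually_mono])
  then show "((\<lambda>x. x powr \<alpha>) \<longlongrightarrow> 0) (at_right (0::real))" by simp
qed

lemma group_total_measurable: "group_total 1 t \<in> measurable M (count_space UNIV)"
  by (rule measurable_Sig_imp[OF group_sources_proper[OF order_refl] measurable_group_total_fixed[OF order_refl]])

text \<open>
  The first group, observed at age \<open>n\<close>, scaled by \<open>W(\<mu> n)\<close> and conditioned on survival,
  has a Laplace transform that tends to \<open>1 - \<kappa>\<close>.
\<close>

lemma D_law_exists: obtains D where "is_D_law \<alpha> \<gamma> D"
proof -
  define N' where "N' n = uniform_measure M {\<omega>\<in>space M. 0 < group_total 1 (real n) \<omega>}" for n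
  define X where "X n \<omega> = real (group_total 1 (real n) \<omega>) / W (\<mu> * real n)" for n \<omega>
  have pgf: "(\<integral>\<omega>. s ^ group_total 1 t \<omega> \<partial>M) = 1 - immigrant_q \<mu> p h t s" if "0 \<le> s" "s \<le> 1" for s t
    using group_pgf[OF order_refl that] by (simp add: immigrant_q_def)
  have pgf0: "(\<integral>\<omega>. (0::real) ^ group_total 1 t \<omega> \<partial>M) = 1 - q t" if "0 \<le> t" for t
    using pgf[of 0 t] immigrant_q_0[OF that] by simp
  have events: "{\<omega>\<in>space M. 0 < group_total 1 t \<omega>} \<in> events" for t
    using group_total_measurable[of t] by measurable
  have prob: "prob {\<omega>\<in>space M. 0 < group_total 1 t \<omega>} = q t" if "0 \<le> t" for t
    using prob_positive_count[OF group_total_measurable] pgf0[OF that] by simp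
  have ps: "prob_space (N' n)" for n
    unfolding N'_def using prob[of "real n"] q_pos[of "real n"]
    by (intro prob_space_uniform_measure) (auto simp: emeasure_eq_measure)
  have Xm: "X n \<in> borel_measurable (N' n)" for n
  proof -
    have "X n \<in> borel_measurable M"
      unfolding X_def using measurable_compose[OF group_total_measurable[of "real n"], of "\<lambda>k. real k / W (\<mu> * real n)" borel] by simp
    then show ?thesis by (simp add: N'_def)
  qed
  have Wp: "0 < W (\<mu> * t)" if "0 \<le> t" for t
    using W_ge_1[of "\<mu> * t"] rate_pos that by simp
  have X0: "0 \<le> X n \<omega>" for n \<omega> using Wp[of "real n"] by (simp add: X_def)
  have conv: "(\<lambda>n. \<integral>\<omega>. exp (- x * X n \<omega>) \<partial>N' n) \<longlonglongrightarrow> 1 - \<kappa> x" if x: "0 < x" for x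
  proof -
    have eq: "(\<integral>\<omega>. exp (- x * X n \<omega>) \<partial>N' n) = 1 - q (real n - 0 + time_shift (scaled_arg x (real n))) / q (real n)" for n
    proof -
      have s: "0 \<le> scaled_arg x (real n)" "scaled_arg x (real n) < 1" using scaled_arg_bounds[OF x] by auto
      have "(\<integral>\<omega>. exp (- x * X n \<omega>) \<partial>N' n) = (\<integral>\<omega>. scaled_arg x (real n) ^ group_total 1 (real n) \<omega> \<partial>N' n)"
        by (simp only: X_def exp_scaled_count scaled_arg_def)
      also have "\<dots> = 1 - (1 - (1 - immigrant_q \<mu> p h (real n) (scaled_arg x (real n)))) / (1 - (1 - q (real n)))"
        unfolding N'_def using conditional_pgf[OF group_total_measurable[of "real n"] s(1) less_imp_le[OF s(2)]]
          q_pos[of "real n"]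
        by (simp only: pgf0[OF of_nat_0_le_iff] pgf[OF s(1) less_imp_le[OF s(2)]])
           (simp add: pgf0[OF of_nat_0_le_iff])
      finally show ?thesis using immigrant_q_eq[OF _ s, of "real n"] by (simp add: time_shift_def)
    qed
    have "((\<lambda>t. q (t - 0 + time_shift (scaled_arg x t)) / q t) \<longlongrightarrow> \<kappa> x) at_top"
      using q_shift_ratio[OF scaled_time_shift[OF x], of 0] \<kappa>_eq[OF x] by simp
    from filterlim_compose[OF this filterlim_real_sequentially] show ?thesis
      unfolding eq by (intro tendsto_intros)
  qed
  have "((\<lambda>x. 1 - \<kappa> x) \<longlongrightarrow> 1 - 0) (at_right 0)" by (intro tendsto_intros \<kappa>_at_0)
  then have psi: "((\<lambda>x. 1 - \<kappa> x) \<longlongrightarrow> 1) (at_right 0)" by simp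
  obtain D where D: "real_distribution D" "measure D {..<0} = 0" "\<And>s. 0 < s \<Longrightarrow> (\<integral>y. exp (- s * y) \<partial>D) = 1 - \<kappa> s"
    using laplace_limit_exists[of N' X "\<lambda>x. 1 - \<kappa> x", OF ps Xm X0 conv psi] by blast
  then have "is_D_law \<alpha> \<gamma> D" unfolding is_D_law_def \<kappa>_def by simp
  then show ?thesis by (rule that)
qed

end

locale integrable_immigration = regular_immigration M \<mu> \<gamma> p h r L T N I \<nu> \<alpha> l
  for M :: "'a measure" and \<mu> \<gamma> :: real and p h :: "nat pmf" and r L :: "real \<Rightarrow> real"
    and T :: "nat \<Rightarrow> nat \<Rightarrow> nat list \<Rightarrow> 'a \<Rightarrow> real"
    and N :: "nat \<Rightarrow> nat \<Rightarrow> nat list \<Rightarrow> 'a \<Rightarrow> nat"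
    and I :: "nat \<Rightarrow> 'a \<Rightarrow> nat"
    and \<nu> :: "real \<Rightarrow> 'a \<Rightarrow> nat" and \<alpha> :: real and l :: "real \<Rightarrow> real" +
  fixes \<theta> :: real and L\<^sub>R :: "real \<Rightarrow> real"
  assumes LR_slow: "slowly_varying L\<^sub>R" and theta: "0 \<le> \<theta>"
    and r_form: "\<And>t. 0 < t \<Longrightarrow> r t = t powr (- \<theta>) * L\<^sub>R t"
    and r_int: "set_integrable lborel {0..} r"
    and q_int: "set_integrable lborel {0..} q"
begin

abbreviation Y :: "real \<Rightarrow> 'a \<Rightarrow> nat" where "Y \<equiv> immigration_process T N I \<nu>"

definition R where "R = (LINT t:{0..}|lborel. r t)"
definition Q where "Q = (LINT t:{0..}|lborel. q t)"

definition exponent :: "real \<Rightarrow> real \<Rightarrow> real" where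
  "exponent t s = (LINT u:{0..t}|lborel. r u * immigrant_q \<mu> p h (t - u) s)"

lemma Y_pgf: "0 \<le> t \<Longrightarrow> 0 \<le> s \<Longrightarrow> s < 1 \<Longrightarrow> (\<integral>\<omega>. s ^ Y t \<omega> \<partial>M) = exp (- exponent t s)"
  unfolding exponent_def by (rule immigration_pgf[OF critical])

lemma r_pos: "\<forall>\<^sub>F t in at_top. 0 < r t"
  by (rule regularly_varying_pos[OF LR_slow r_form])

lemma r_half: "\<forall>\<^sub>F t in at_top. \<forall>v\<in>{t/2..t}. r v \<le> 2 * 2 powr \<theta> * r t"
  by (rule regularly_varying_half_bound[OF LR_slow r_form theta])

lemma r_shift: "0 \<le> u \<Longrightarrow> ((\<lambda>t. r (t - u) / r t) \<longlongrightarrow> 1) at_top"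
  by (rule regularly_varying_shift[OF LR_slow r_form])

lemma q_ev_pos: "\<forall>\<^sub>F t in at_top. 0 < q t"
  using eventually_ge_at_top[of 0] by eventually_elim (rule q_pos)

lemma exponent_eq:
  assumes t: "0 \<le> t" and s: "0 \<le> s" "s < 1"
  shows "exponent t s = (\<integral>u. (indicator {0..} u * r u) * (indicator {0..} (t - u) * q (t - u + time_shift s)) \<partial>lborel)"
  unfolding exponent_def set_lebesgue_integral_def
  by (intro Bochner_Integration.integral_cong)
     (auto simp: indicator_def immigrant_q_eq[OF _ s] time_shift_def)

lemma q_borel: "(\<lambda>u. indicator {0..} u * q (u + c)) \<in> borel_measurable borel" if "0 \<le> c"
proof -
  have s0: "(\<lambda>t. branching_pgf \<mu> p t 0) \<in> borel_measurable borel"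
    by (rule borel_measurable_branching_pgf[OF rate_pos])
  have "(\<lambda>t. 1 - pgf h (branching_pgf \<mu> p (t + c) 0)) \<in> borel_measurable borel"
    by (intro borel_measurable_diff borel_measurable_const measurable_compose[OF measurable_compose[OF _ s0] borel_measurable_pgf]) measurable
  then have "(\<lambda>u. indicator {0..} u * (1 - pgf h (branching_pgf \<mu> p (u + c) 0))) \<in> borel_measurable borel"
    by measurable
  moreover have "(\<lambda>u. indicator {0..} u * (1 - pgf h (branching_pgf \<mu> p (u + c) 0))) = (\<lambda>u. indicator {0..} u * q (u + c))"
    using immigrant_q_0 that by (auto simp: fun_eq_iff indicator_def immigrant_q_def)
  ultimately show ?thesis by (simp only:)
qed

text \<open>
  The constant \<open>a\<close> measures the time shift relative to \<open>t\<close>: it is 0 for a fixed argument and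
  \<open>x powr (- \<gamma>)\<close> for the scaled one.
\<close>

lemma exponent_split:
  assumes s: "\<And>t. 0 \<le> s t" "\<And>t. s t < 1"
    and shift: "((\<lambda>t. time_shift (s t) / t) \<longlongrightarrow> a) at_top" "0 \<le> a"
    and lim: "\<And>u. 0 \<le> u \<Longrightarrow> ((\<lambda>t. q (u + time_shift (s t))) \<longlongrightarrow> m u) at_top"
    and m: "(\<lambda>u. indicator {0..} u * m u) \<in> borel_measurable borel"
  obtains A B where "(A \<longlongrightarrow> (LINT u:{0..}|lborel. m u)) at_top" "(B \<longlongrightarrow> (1 + a) powr (- \<alpha> / \<gamma>) * R) at_top"
    "\<forall>\<^sub>F t in at_top. exponent t (s t) = r t * A t + q t * B t"
proof -
  let ?\<rho> = "\<lambda>u. indicator {0..} u * r u" and ?q = "\<lambda>u. indicator {0..} u * q u"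
  let ?k = "\<lambda>t u. indicator {0..} u * q (u + time_shift (s t))"
  have ts: "0 \<le> time_shift (s t)" for t by (rule time_shift_nonneg[OF s])
  have ge: "\<forall>\<^sub>F t in at_top. u \<le> t" for u :: real by (rule eventually_ge_at_top)
  obtain A B where A: "(A \<longlongrightarrow> (\<integral>u. indicator {0..} u * m u \<partial>lborel)) at_top"
    and B: "(B \<longlongrightarrow> (1 + a) powr (- \<alpha> / \<gamma>) * (\<integral>u. ?\<rho> u \<partial>lborel)) at_top"
    and eq: "\<forall>\<^sub>F t in at_top. (\<integral>u. ?\<rho> u * ?k t (t - u) \<partial>lborel) = ?\<rho> t * A t + ?q t * B t"
  proof (rule convolution_split[of ?\<rho> "2 * 2 powr \<theta>" ?q "(1 / 2) powr (- \<alpha> / \<gamma>) + 1" ?k "\<lambda>u. indicator {0..} u * m u" "(1 + a) powr (- \<alpha> / \<gamma>)"])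
    show "integrable lborel ?\<rho>" "integrable lborel ?q"
      using r_int q_int by (simp_all add: set_integrable_def)
    show "0 \<le> ?\<rho> u" for u using arrivals_facts(4) by (simp add: indicator_def)
    show "\<forall>\<^sub>F t in at_top. 0 < ?\<rho> t" using r_pos ge[of 0] by eventually_elim simp
    show "\<forall>\<^sub>F t in at_top. \<forall>v\<in>{t/2..t}. ?\<rho> v \<le> 2 * 2 powr \<theta> * ?\<rho> t"
      using r_half ge[of 0] by eventually_elim simp
    show "((\<lambda>t. ?\<rho> (t - u) / ?\<rho> t) \<longlongrightarrow> 1) at_top" if "0 \<le> u" for u
    proof (rule Lim_transform_eventually[OF r_shift[OF that]])
      show "\<forall>\<^sub>F t in at_top. r (t - u) / r t = ?\<rho> (t - u) / ?\<rho> t"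
        using ge[of u] ge[of 0] by eventually_elim simp
    qed
    show "?q v \<le> ?q u" if "0 \<le> u" "u \<le> v" for u v using q_antimono[OF that] that by simp
    show "\<forall>\<^sub>F t in at_top. ?q (t / 2) \<le> ((1 / 2) powr (- \<alpha> / \<gamma>) + 1) * ?q t"
      using q_half_bound ge[of 0] by eventually_elim simp
    show "?k t \<in> borel_measurable borel" for t by (rule q_borel[OF ts])
    show "0 \<le> ?k t u" "?k t u \<le> ?q u" for t u
      using q_pos[of "u + time_shift (s t)"] q_antimono[of u "u + time_shift (s t)"] ts[of t]
      by (auto simp: indicator_def)
    show "((\<lambda>t. ?k t u) \<longlongrightarrow> indicator {0..} u * m u) at_top" if "0 \<le> u" for u
      using lim[OF that] that by simp
    show "((\<lambda>t. ?k t (t - u) / ?q t) \<longlongrightarrow> (1 + a) powr (- \<alpha> / \<gamma>)) at_top" if "0 \<le> u" for u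
    proof (rule Lim_transform_eventually[OF q_shift_ratio[OF shift, of u]])
      show "\<forall>\<^sub>F t in at_top. q (t - u + time_shift (s t)) / q t = ?k t (t - u) / ?q t"
        using ge[of u] ge[of 0] by eventually_elim simp
    qed
  qed (use q_pos m in \<open>auto simp: indicator_def\<close>)
  have "\<forall>\<^sub>F t in at_top. exponent t (s t) = r t * A t + q t * B t"
    using eq ge[of 0] by eventually_elim (simp add: exponent_eq s)
  then show ?thesis using A B that by (simp add: set_lebesgue_integral_def R_def)
qed

lemma time_shift_0 [simp]: "time_shift 0 = 0"
  by (simp add: time_shift_def)

lemma exponent_split_fixed:
  assumes s: "0 \<le> s" "s < 1"
  obtains A B where "(A \<longlongrightarrow> immigrant_Delta \<mu> p h s) at_top" "(B \<longlongrightarrow> R) at_top"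
    "\<forall>\<^sub>F t in at_top. exponent t s = r t * A t + q t * B t"
proof (rule exponent_split[of "\<lambda>_. s" 0 "\<lambda>u. q (u + time_shift s)"])
  show "((\<lambda>t. time_shift s / t) \<longlongrightarrow> 0) at_top"
    by (rule real_tendsto_divide_at_top[OF tendsto_const filterlim_ident])
  show "(\<lambda>u. indicator {0..} u * q (u + time_shift s)) \<in> borel_measurable borel"
    by (rule q_borel[OF time_shift_nonneg[OF s]])
  fix A B assume "(A \<longlongrightarrow> (LINT u:{0..}|lborel. q (u + time_shift s))) at_top"
    and B: "(B \<longlongrightarrow> (1 + 0) powr (- \<alpha> / \<gamma>) * R) at_top"
    and "\<forall>\<^sub>F t in at_top. exponent t s = r t * A t + q t * B t"
  moreover have "(LINT u:{0..}|lborel. q (u + time_shift s)) = immigrant_Delta \<mu> p h s"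
    unfolding immigrant_Delta_def set_lebesgue_integral_def
    by (intro Bochner_Integration.integral_cong) (auto simp: indicator_def immigrant_q_eq[OF _ s] time_shift_def)
  ultimately show thesis by (intro that) auto
qed (use s in auto)

lemma Delta_0: "immigrant_Delta \<mu> p h 0 = Q"
  unfolding immigrant_Delta_def Q_def set_lebesgue_integral_def
  by (intro Bochner_Integration.integral_cong) (auto simp: indicator_def immigrant_q_0)

text \<open>
  The time shift tends to infinity, hence recent arrivals do not contribute: \<open>A\<close> tends to 0.
\<close>

lemma exponent_split_scaled:
  assumes x: "0 < x"
  obtains A B where "(A \<longlongrightarrow> 0) at_top" "(B \<longlongrightarrow> \<kappa> x * R) at_top"
    "\<forall>\<^sub>F t in at_top. exponent t (scaled_arg x t) = r t * A t + q t * B t"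
proof -
  \<comment> \<open>the argument is only a number in [0,1) for t \<ge> 0\<close>
  define s where "s t = scaled_arg x (max 0 t)" for t
  have s: "0 \<le> s t" "s t < 1" for t using scaled_arg_bounds[OF x, of "max 0 t"] by (auto simp: s_def)
  have ev: "\<forall>\<^sub>F t in at_top. scaled_arg x t = s t"
    using eventually_ge_at_top[of 0] by eventually_elim (simp add: s_def)
  have shift: "((\<lambda>t. time_shift (s t) / t) \<longlongrightarrow> x powr (- \<gamma>)) at_top"
    by (rule Lim_transform_eventually[OF scaled_time_shift[OF x]]) (use ev in \<open>auto elim: eventually_mono\<close>)
  have "filterlim (\<lambda>t. time_shift (s t) / t * t) at_top at_top"
    by (rule filterlim_tendsto_pos_mult_at_top[OF shift _ filterlim_ident]) (use x in simp)
  then have ts_top: "filterlim (\<lambda>t. time_shift (s t)) at_top at_top"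
    by (rule filterlim_cong[THEN iffD1, OF refl refl, rotated])
       (use eventually_gt_at_top[of 0] in eventually_elim, simp)
  show ?thesis
  proof (rule exponent_split[OF s shift, of "\<lambda>_. 0"])
    show "((\<lambda>t. q (u + time_shift (s t))) \<longlongrightarrow> 0) at_top" for u
      by (rule filterlim_compose[OF q_tendsto_0 filterlim_tendsto_add_at_top[OF tendsto_const ts_top]])
    fix A B assume "(A \<longlongrightarrow> (LINT u:{0..}|lborel. 0)) at_top"
      and B: "(B \<longlongrightarrow> (1 + x powr (- \<gamma>)) powr (- \<alpha> / \<gamma>) * R) at_top"
      and eq: "\<forall>\<^sub>F t in at_top. exponent t (s t) = r t * A t + q t * B t"
    moreover have "\<forall>\<^sub>F t in at_top. exponent t (scaled_arg x t) = r t * A t + q t * B t"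
      using eq ev by eventually_elim simp
    ultimately show thesis
      using B[unfolded \<kappa>_eq[OF x]] by (intro that) (auto simp: set_lebesgue_integral_def)
  qed auto
qed

lemma exponent_nonneg: "0 \<le> t \<Longrightarrow> 0 \<le> s \<Longrightarrow> s < 1 \<Longrightarrow> 0 \<le> exponent t s"
  unfolding exponent_eq
  using arrivals_facts(4) less_imp_le[OF q_pos] time_shift_nonneg
  by (intro Bochner_Integration.integral_nonneg) (auto simp: indicator_def)

lemma exponent_0_tendsto: "((\<lambda>t. exponent t 0) \<longlongrightarrow> 0) at_top"
proof -
  have m: "(\<lambda>u. indicator {0..} u * q (u + 0)) \<in> borel_measurable borel" by (rule q_borel) simp
  have rm: "(\<lambda>u. indicator {0..} u * r u) \<in> borel_measurable borel"
    using r_int by (simp add: set_integrable_def)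
  have "((\<lambda>t. \<integral>u. (indicator {0..} u * r u) * (indicator {0..} (t - u) * q (t - u + 0)) \<partial>lborel) \<longlongrightarrow> integral\<^sup>L (lborel :: real measure) (\<lambda>_. 0)) at_top"
  proof (rule integral_dominated_convergence_at_top[where f="\<lambda>_::real. 0::real" and w="\<lambda>u. indicator {0..} u * r u"])
    show "integrable lborel (\<lambda>u. indicator {0..} u * r u)" using r_int by (simp add: set_integrable_def)
    show "\<forall>\<^sub>F t in at_top. AE u in lborel. norm ((indicator {0..} u * r u) * (indicator {0..} (t - u) * q (t - u + 0))) \<le> indicator {0..} u * r u"
      using q_pos q_le_1 arrivals_facts(4)
      by (intro always_eventually allI AE_I2) (auto simp: indicator_def abs_mult less_imp_le intro!: mult_left_le)
    show "AE u in lborel. ((\<lambda>t. (indicator {0..} u * r u) * (indicator {0..} (t - u) * q (t - u + 0))) \<longlongrightarrow> 0) at_top"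
    proof (intro AE_I2)
      fix u
      have "((\<lambda>t. (indicator {0..} u * r u) * q (- u + t)) \<longlongrightarrow> (indicator {0..} u * r u) * 0) at_top"
        by (intro tendsto_intros filterlim_compose[OF q_tendsto_0 filterlim_tendsto_add_at_top[OF tendsto_const filterlim_ident]])
      moreover have "\<forall>\<^sub>F t in at_top. (indicator {0..} u * r u) * q (- u + t) = (indicator {0..} u * r u) * (indicator {0..} (t - u) * q (t - u + 0))"
        using eventually_ge_at_top[of u] by eventually_elim simp
      ultimately show "((\<lambda>t. (indicator {0..} u * r u) * (indicator {0..} (t - u) * q (t - u + 0))) \<longlongrightarrow> 0) at_top"
        unfolding mult_zero_right by (rule Lim_transform_eventually)
    qed
    show "(\<lambda>u. (indicator {0..} u * r u) * (indicator {0..} (t - u) * q (t - u + 0))) \<in> borel_measurable lborel" for t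
    proof -
      have "(\<lambda>u. indicator {0..} (t - u) * q (t - u + 0)) \<in> borel_measurable borel"
        by (rule measurable_compose[OF _ m]) measurable
      from borel_measurable_times[OF rm this] show ?thesis by (simp only: measurable_lborel2)
    qed
  qed simp
  moreover have "\<forall>\<^sub>F t in at_top. (\<integral>u. (indicator {0..} u * r u) * (indicator {0..} (t - u) * q (t - u + 0)) \<partial>lborel) = exponent t 0"
    using eventually_ge_at_top[of 0] by eventually_elim (simp add: exponent_eq)
  ultimately show ?thesis unfolding Bochner_Integration.integral_zero by (rule Lim_transform_eventually)
qed

lemma exponent_antimono:
  assumes t: "0 \<le> t" and s: "0 \<le> s" "s < 1"
  shows "exponent t s \<le> exponent t 0"
proof -
  have "s ^ Y t \<omega> \<ge> 0 ^ Y t \<omega>" for \<omega> using s by (intro power_mono) auto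
  then have "(\<integral>\<omega>. 0 ^ Y t \<omega> \<partial>M) \<le> (\<integral>\<omega>. s ^ Y t \<omega> \<partial>M)"
    using s by (intro integral_mono integrable_const_bound[where B=1])
      (auto simp: power_le_one intro!: measurable_compose[OF measurable_immigration[OF t]])
  then show ?thesis using Y_pgf[OF t, of 0] Y_pgf[OF t s] by simp
qed

lemma exponent_tendsto_0:
  assumes "\<forall>\<^sub>F t in at_top. 0 \<le> s t \<and> s t < 1"
  shows "((\<lambda>t. exponent t (s t)) \<longlongrightarrow> 0) at_top"
proof (rule tendsto_sandwich[OF _ _ tendsto_const exponent_0_tendsto])
  show "\<forall>\<^sub>F t in at_top. 0 \<le> exponent t (s t)" "\<forall>\<^sub>F t in at_top. exponent t (s t) \<le> exponent t 0"
    using assms eventually_ge_at_top[of 0]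
    by (eventually_elim, simp add: exponent_nonneg exponent_antimono)+
qed

lemma Q_pos: "0 < Q"
proof -
  have "(\<integral>u. indicator {0..1} (u::real) * q 1 \<partial>lborel) \<le> (\<integral>u. indicator {0..} u * q u \<partial>lborel)"
  proof (rule integral_mono)
    show "integrable lborel (\<lambda>u. indicator {0..} u * q u)" using q_int by (simp add: set_integrable_def)
    show "indicator {0..1} u * q 1 \<le> indicator {0..} u * q u" for u
      using q_antimono[of u 1] q_pos[of u] by (auto simp: indicator_def)
  qed simp
  then show ?thesis using q_pos[of 1] by (simp add: Q_def set_lebesgue_integral_def)
qed

lemma R_pos: "0 < R"
proof (rule ccontr)
  have nn: "0 \<le> indicator {0..} u * r u" for u using arrivals_facts(4) by (simp add: indicator_def)
  have int: "integrable lborel (\<lambda>u. indicator {0..} u * r u)" using r_int by (simp add: set_integrable_def)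
  assume "\<not> 0 < R"
  moreover have "0 \<le> (\<integral>u. indicator {0..} u * r u \<partial>lborel)"
    by (rule Bochner_Integration.integral_nonneg) (rule nn)
  ultimately have "(\<integral>u. indicator {0..} u * r u \<partial>lborel) = 0"
    by (simp add: R_def set_lebesgue_integral_def)
  then have ae: "AE u in lborel. indicator {0..} u * r u = 0"
    using integral_nonneg_eq_0_iff_AE[OF int] nn by simp
  obtain a where a: "\<And>t. a \<le> t \<Longrightarrow> 0 < r t" using r_pos by (auto simp: eventually_at_top_linorder)
  have "AE u in lborel. u \<notin> {max a 0..max a 0 + 1}"
    using ae by eventually_elim (use a in \<open>fastforce simp: indicator_def\<close>)
  then have "{max a 0..max a 0 + 1} \<in> null_sets lborel"
    by (subst AE_iff_null_sets) auto
  then show False by (simp add: null_sets_def)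
qed

definition survivors :: "real \<Rightarrow> 'a measure" where
  "survivors t = uniform_measure M {\<omega>\<in>space M. 0 < Y t \<omega>}"

lemma exponent_0_pos: "\<forall>\<^sub>F t in at_top. 0 < exponent t 0"
proof (rule exponent_split_fixed[OF order_refl zero_less_one])
  fix A B assume A: "(A \<longlongrightarrow> immigrant_Delta \<mu> p h 0) at_top" and B: "(B \<longlongrightarrow> R) at_top"
    and eq: "\<forall>\<^sub>F t in at_top. exponent t 0 = r t * A t + q t * B t"
  have "\<forall>\<^sub>F t in at_top. 0 < A t" "\<forall>\<^sub>F t in at_top. 0 < B t"
    by (rule order_tendstoD(1)[OF A], simp add: Delta_0 Q_pos, rule order_tendstoD(1)[OF B], rule R_pos)
  with eq r_pos q_ev_pos show ?thesis by eventually_elim (simp add: add_pos_pos)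
qed

lemma conditional_pgf_Y:
  assumes t: "0 \<le> t" and pos: "0 < exponent t 0" and s: "0 \<le> s" "s < 1"
  shows "(\<integral>\<omega>. s ^ Y t \<omega> \<partial>survivors t) = 1 - (1 - exp (- exponent t s)) / (1 - exp (- exponent t 0))"
  unfolding survivors_def
  using conditional_pgf[OF measurable_immigration[OF t] s(1) less_imp_le[OF s(2)]] Y_pgf[OF t s] Y_pgf[OF t, of 0] pos by simp

lemma survivors_prob_space:
  assumes t: "0 \<le> t" and pos: "0 < exponent t 0"
  shows "prob_space (survivors t)"
  unfolding survivors_def
  using prob_positive_count[OF measurable_immigration[OF t]] Y_pgf[OF t, of 0] pos
  by (intro prob_space_uniform_measure) (auto simp: emeasure_eq_measure)

lemma conditional_limit:
  assumes s: "\<forall>\<^sub>F t in at_top. 0 \<le> s t \<and> s t < 1"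
    and lim: "((\<lambda>t. exponent t (s t) / exponent t 0) \<longlongrightarrow> c) at_top"
  shows "((\<lambda>t. \<integral>\<omega>. s t ^ Y t \<omega> \<partial>survivors t) \<longlongrightarrow> 1 - c) at_top"
proof -
  have "((\<lambda>t. 1 - (1 - exp (- exponent t (s t))) / (1 - exp (- exponent t 0))) \<longlongrightarrow> 1 - c) at_top"
    by (intro tendsto_intros one_minus_exp_ratio exponent_tendsto_0 s lim exponent_0_tendsto)
       (use exponent_0_pos in \<open>auto elim: eventually_mono\<close>)
  moreover have "\<forall>\<^sub>F t in at_top. 1 - (1 - exp (- exponent t (s t))) / (1 - exp (- exponent t 0)) = (\<integral>\<omega>. s t ^ Y t \<omega> \<partial>survivors t)"
    using s exponent_0_pos eventually_ge_at_top[of 0] by eventually_elim (simp add: conditional_pgf_Y)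
  ultimately show ?thesis by (rule Lim_transform_eventually)
qed

lemma exponent_ratio_fixed:
  assumes s: "0 \<le> s" "s < 1" and d: "((\<lambda>t. r t / q t) \<longlongrightarrow> d) at_top" "0 \<le> d"
  shows "((\<lambda>t. exponent t s / exponent t 0) \<longlongrightarrow> (d * immigrant_Delta \<mu> p h s + R) / (d * Q + R)) at_top"
proof -
  obtain A B where AB: "(A \<longlongrightarrow> immigrant_Delta \<mu> p h s) at_top" "(B \<longlongrightarrow> R) at_top"
    "\<forall>\<^sub>F t in at_top. exponent t s = r t * A t + q t * B t" by (rule exponent_split_fixed[OF s])
  obtain A' B' where AB': "(A' \<longlongrightarrow> immigrant_Delta \<mu> p h 0) at_top" "(B' \<longlongrightarrow> R) at_top"
    "\<forall>\<^sub>F t in at_top. exponent t 0 = r t * A' t + q t * B' t" by (rule exponent_split_fixed[OF order_refl zero_less_one])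
  have nz: "d * immigrant_Delta \<mu> p h 0 + R \<noteq> 0"
    using d(2) Q_pos R_pos by (simp add: Delta_0 add_nonneg_pos less_imp_neq[symmetric])
  have "\<forall>\<^sub>F t in at_top. (r t * A t + q t * B t) / (r t * A' t + q t * B' t) = exponent t s / exponent t 0"
    using AB(3) AB'(3) by eventually_elim simp
  with weighted_ratio_limit[OF q_ev_pos d(1) AB(1,2) AB'(1,2) nz] show ?thesis
    unfolding Delta_0 by (rule Lim_transform_eventually)
qed

lemma exponent_ratio_recent:
  assumes s: "0 \<le> s" "s < 1" and d: "((\<lambda>t. q t / r t) \<longlongrightarrow> 0) at_top"
  shows "((\<lambda>t. exponent t s / exponent t 0) \<longlongrightarrow> immigrant_Delta \<mu> p h s / Q) at_top"
proof -
  obtain A B where AB: "(A \<longlongrightarrow> immigrant_Delta \<mu> p h s) at_top" "(B \<longlongrightarrow> R) at_top"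
    "\<forall>\<^sub>F t in at_top. exponent t s = r t * A t + q t * B t" by (rule exponent_split_fixed[OF s])
  obtain A' B' where AB': "(A' \<longlongrightarrow> immigrant_Delta \<mu> p h 0) at_top" "(B' \<longlongrightarrow> R) at_top"
    "\<forall>\<^sub>F t in at_top. exponent t 0 = r t * A' t + q t * B' t" by (rule exponent_split_fixed[OF order_refl zero_less_one])
  have nz: "0 * R + immigrant_Delta \<mu> p h 0 \<noteq> 0" using Q_pos by (simp add: Delta_0)
  have "\<forall>\<^sub>F t in at_top. (q t * B t + r t * A t) / (q t * B' t + r t * A' t) = exponent t s / exponent t 0"
    using AB(3) AB'(3) by eventually_elim (simp add: add.commute)
  with weighted_ratio_limit[OF r_pos d AB(2,1) AB'(2,1) nz] show ?thesis
    unfolding Delta_0 mult_zero_left add_0_left by (rule Lim_transform_eventually)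
qed

lemma exponent_ratio_scaled:
  assumes x: "0 < x" and d: "((\<lambda>t. r t / q t) \<longlongrightarrow> d) at_top" "0 \<le> d"
  shows "((\<lambda>t. exponent t (scaled_arg x t) / exponent t 0) \<longlongrightarrow> \<kappa> x * R / (d * Q + R)) at_top"
proof -
  obtain A B where AB: "(A \<longlongrightarrow> 0) at_top" "(B \<longlongrightarrow> \<kappa> x * R) at_top"
    "\<forall>\<^sub>F t in at_top. exponent t (scaled_arg x t) = r t * A t + q t * B t" by (rule exponent_split_scaled[OF x])
  obtain A' B' where AB': "(A' \<longlongrightarrow> immigrant_Delta \<mu> p h 0) at_top" "(B' \<longlongrightarrow> R) at_top"
    "\<forall>\<^sub>F t in at_top. exponent t 0 = r t * A' t + q t * B' t" by (rule exponent_split_fixed[OF order_refl zero_less_one])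
  have nz: "d * immigrant_Delta \<mu> p h 0 + R \<noteq> 0"
    using d(2) Q_pos R_pos by (simp add: Delta_0 add_nonneg_pos less_imp_neq[symmetric])
  have "\<forall>\<^sub>F t in at_top. (r t * A t + q t * B t) / (r t * A' t + q t * B' t) = exponent t (scaled_arg x t) / exponent t 0"
    using AB(3) AB'(3) by eventually_elim simp
  with weighted_ratio_limit[OF q_ev_pos d(1) AB(1,2) AB'(1,2) nz] show ?thesis
    unfolding Delta_0 mult_zero_right add_0_left by (rule Lim_transform_eventually)
qed

lemma cond_expectation_survivors:
  "cond_expectation M X (\<lambda>\<omega>. 0 < Y t \<omega>) = (\<integral>\<omega>. X \<omega> \<partial>survivors t)"
  by (simp add: cond_expectation_def survivors_def)

lemma conditional_pgf_limit:
  assumes s: "0 \<le> s" "s < 1" and lim: "((\<lambda>t. exponent t s / exponent t 0) \<longlongrightarrow> c) at_top"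
  shows "((\<lambda>t. cond_expectation M (\<lambda>\<omega>. s ^ Y t \<omega>) (\<lambda>\<omega>. 0 < Y t \<omega>)) \<longlongrightarrow> 1 - c) at_top"
  unfolding cond_expectation_survivors by (rule conditional_limit) (use s lim in auto)

text \<open>
  The case \<open>d = 0\<close> is that of an intensity negligible against \<open>q\<close>. Recent arrivals appear in the
  limit as an atom at 0, because their descendants are not of the order of \<open>W(\<mu> t)\<close>.
\<close>

lemma scaled_conditional_cdf_limit:
  assumes d: "((\<lambda>t. r t / q t) \<longlongrightarrow> d) at_top" "0 \<le> d" and D: "is_D_law \<alpha> \<gamma> D" and x: "0 < x"
  shows "((\<lambda>t. \<P>(\<omega> in M. real (Y t \<omega>) / W (\<mu> * t) \<le> x \<bar> 0 < Y t \<omega>)) \<longlongrightarrow> (d * Q + R * cdf D x) / (d * Q + R)) at_top"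
proof -
  have D': "real_distribution D" "measure D {..<0} = 0"
    "\<And>s. 0 < s \<Longrightarrow> (\<integral>y. exp (- s * y) \<partial>D) = 1 - s powr \<alpha> / (1 + s powr \<gamma>) powr (\<alpha> / \<gamma>)"
    using D by (auto simp: is_D_law_def)
  have dQ: "0 \<le> d * Q" "0 < d * Q + R" using d(2) Q_pos R_pos by (auto simp: add_nonneg_pos)
  let ?a = "d * Q / (d * Q + R)" and ?b = "R / (d * Q + R)"
  let ?X = "\<lambda>t \<omega>. real (Y t \<omega>) / W (\<mu> * t)"
  have ab: "0 \<le> ?a" "0 \<le> ?b" "?a + ?b = 1" using dQ R_pos by (auto simp flip: add_divide_distrib)
  have Wp: "0 < W (\<mu> * t)" if "0 \<le> t" for t using W_ge_1[of "\<mu> * t"] rate_pos that by simp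
  have Xm: "?X t \<in> borel_measurable M" if "0 \<le> t" for t
    using measurable_compose[OF measurable_immigration[OF that], of "\<lambda>k. real k / W (\<mu> * t)" borel] by simp
  have "((\<lambda>t. measure (survivors t) {\<omega>\<in>space (survivors t). ?X t \<omega> \<le> x}) \<longlongrightarrow> ?a + ?b * cdf D x) at_top"
  proof (rule laplace_cdf_convergence[OF _ D'(1,2) ab _ x])
    show "\<forall>\<^sub>F t in at_top. prob_space (survivors t) \<and> ?X t \<in> borel_measurable (survivors t) \<and> (\<forall>\<omega>\<in>space (survivors t). 0 \<le> ?X t \<omega>)"
      using exponent_0_pos eventually_ge_at_top[of 0]
    proof eventually_elim
      case (elim t)
      then show ?case using survivors_prob_space[OF elim(2,1)] Xm[OF elim(2)] Wp[OF elim(2)]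
        by (simp add: survivors_def)
    qed
    show "measure D {x} = 0" by (rule D_law_no_atom[OF D'(1,2) gamma D'(3)])
    fix k :: nat assume "1 \<le> k"
    then have k: "0 < real k" by simp
    have "((\<lambda>t. \<integral>\<omega>. scaled_arg (real k) t ^ Y t \<omega> \<partial>survivors t) \<longlongrightarrow> 1 - \<kappa> (real k) * R / (d * Q + R)) at_top"
      by (rule conditional_limit[OF _ exponent_ratio_scaled[OF k d]])
         (use eventually_ge_at_top[of 0] in \<open>eventually_elim, auto intro: scaled_arg_bounds[OF k]\<close>)
    moreover have "1 - \<kappa> (real k) * R / (d * Q + R) = ?a + ?b * (\<integral>y. exp (- real k * y) \<partial>D)"
      unfolding D'(3)[OF k] using ab(3) by (simp add: \<kappa>_def algebra_simps)
    ultimately show "((\<lambda>t. \<integral>\<omega>. exp (- real k * ?X t \<omega>) \<partial>survivors t) \<longlongrightarrow> ?a + ?b * (\<integral>y. exp (- real k * y) \<partial>D)) at_top"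
      by (simp only: exp_scaled_count scaled_arg_def)
  qed
  moreover have "\<forall>\<^sub>F t in at_top. measure (survivors t) {\<omega>\<in>space (survivors t). ?X t \<omega> \<le> x} =
      \<P>(\<omega> in M. ?X t \<omega> \<le> x \<bar> 0 < Y t \<omega>)"
    using eventually_ge_at_top[of 0]
  proof eventually_elim
    case (elim t)
    have [measurable]: "Y t \<in> measurable M (count_space UNIV)" "?X t \<in> borel_measurable M"
      using measurable_immigration Xm elim by auto
    have "Measurable.pred M (\<lambda>\<omega>. ?X t \<omega> \<le> x)" "Measurable.pred M (\<lambda>\<omega>. 0 < Y t \<omega>)" by measurable
    from measure_uniform_measure_eq_cond_prob[OF this] show ?case by (simp only: survivors_def)
  qed
  moreover have "?a + ?b * cdf D x = (d * Q + R * cdf D x) / (d * Q + R)"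
    by (simp add: add_divide_distrib)
  ultimately show ?thesis by (simp add: Lim_transform_eventually)
qed

lemma D_law_cdf_0:
  assumes "is_D_law \<alpha> \<gamma> D" shows "cdf D 0 = 0"
proof -
  have D': "real_distribution D" "measure D {..<0} = 0"
    "\<And>s. 0 < s \<Longrightarrow> (\<integral>y. exp (- s * y) \<partial>D) = 1 - s powr \<alpha> / (1 + s powr \<gamma>) powr (\<alpha> / \<gamma>)"
    using assms by (auto simp: is_D_law_def)
  interpret D: real_distribution D by fact
  have "{..0} = {..<0} \<union> {0::real}" by auto
  then have "measure D {..0} = measure D {..<0} + measure D {0}"
    by (simp only:) (rule D.finite_measure_Union, auto)
  then show ?thesis using D_law_no_atom[OF D'(1,2) gamma D'(3), of 0] D'(2) by (simp add: cdf_def)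
qed

text \<open>
  The point \<open>x = 0\<close> is treated apart: under the condition \<open>Y > 0\<close> the probability is 0, and so is
  \<open>cdf D 0\<close>.
\<close>

lemma scaled_conditional_cdf_0:
  assumes "0 \<le> t"
  shows "\<P>(\<omega> in M. real (Y t \<omega>) / W (\<mu> * t) \<le> 0 \<bar> 0 < Y t \<omega>) = 0"
proof -
  have "0 < W (\<mu> * t)" using W_ge_1[of "\<mu> * t"] rate_pos assms by simp
  then have "{\<omega>\<in>space M. real (Y t \<omega>) / W (\<mu> * t) \<le> 0 \<and> 0 < Y t \<omega>} = {}"
    by (auto simp: divide_le_0_iff)
  then show ?thesis unfolding cond_prob_def by (simp only: measure_empty div_0)
qed

end

theorem theorem5p1:
  fixes M :: "'a measure" and \<mu> \<alpha> \<gamma> \<theta> Q R :: real and p h :: "nat pmf"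
    and r L l L\<^sub>R q :: "real \<Rightarrow> real"
    and T :: "nat \<Rightarrow> nat \<Rightarrow> nat list \<Rightarrow> 'a \<Rightarrow> real"
    and N :: "nat \<Rightarrow> nat \<Rightarrow> nat list \<Rightarrow> 'a \<Rightarrow> nat"
    and I :: "nat \<Rightarrow> 'a \<Rightarrow> nat"
    and \<nu> :: "real \<Rightarrow> 'a \<Rightarrow> nat"
    and Y :: "real \<Rightarrow> 'a \<Rightarrow> nat"
  assumes model: "mbp_poisson_immigration M \<mu> p h r T N I \<nu>"
    and Y: "Y = immigration_process T N I \<nu>"
    and critical: "measure_pmf.expectation p real = 1"
    and gamma: "0 < \<gamma>" "\<gamma> \<le> 1"
    and alpha: "0 < \<alpha>" "\<alpha> \<le> 1"
    and slow: "slowly_varying L" "slowly_varying l" "slowly_varying L\<^sub>R"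
    and f: "\<And>s. 0 \<le> s \<Longrightarrow> s < 1 \<Longrightarrow> pgf p s = s + (1 - s) powr (\<gamma> + 1) * L (1 / (1 - s))"
    and g: "\<And>s. 0 \<le> s \<Longrightarrow> s < 1 \<Longrightarrow> pgf h s = 1 - (1 - s) powr \<alpha> * l (1 / (1 - s))"
    and r: "\<And>t. 0 < t \<Longrightarrow> r t = t powr (- \<theta>) * L\<^sub>R t"
    and theta: "1 \<le> \<theta>"
    and R: "set_integrable lborel {0..} r" "R = (LINT t:{0..}|lborel. r t)"
    and alpha_gamma: "1 \<le> \<alpha> / \<gamma>"
    and q: "q = (\<lambda>t. immigrant_q \<mu> p h t 0)"
    and Q: "set_integrable lborel {0..} q" "Q = (LINT t:{0..}|lborel. q t)"
  shows
    "(q \<in> o[at_top](r) \<longrightarrow>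
        (\<forall>s. 0 \<le> s \<and> s < 1 \<longrightarrow>
          ((\<lambda>t. cond_expectation M (\<lambda>\<omega>. s ^ Y t \<omega>) (\<lambda>\<omega>. 0 < Y t \<omega>))
             \<longlongrightarrow> 1 - immigrant_Delta \<mu> p h s / Q) at_top)) \<and>
     (\<exists>D. is_D_law \<alpha> \<gamma> D \<and>
        (r \<in> o[at_top](q) \<longrightarrow>
          (\<forall>x\<ge>0.
            ((\<lambda>t. \<P>(\<omega> in M. real (Y t \<omega>) / W_fun p (\<mu> * t) \<le> x \<bar> 0 < Y t \<omega>))
               \<longlongrightarrow> cdf D x) at_top)) \<and>
        (\<forall>d>0. ((\<lambda>t. r t / q t) \<longlongrightarrow> d) at_top \<longrightarrow>
          (\<forall>s. 0 \<le> s \<and> s < 1 \<longrightarrow>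
            ((\<lambda>t. cond_expectation M (\<lambda>\<omega>. s ^ Y t \<omega>) (\<lambda>\<omega>. 0 < Y t \<omega>))
               \<longlongrightarrow> d * Q / (d * Q + R) * (1 - immigrant_Delta \<mu> p h s / Q)) at_top) \<and>
          (\<forall>x>0.
            ((\<lambda>t. \<P>(\<omega> in M. real (Y t \<omega>) / W_fun p (\<mu> * t) \<le> x \<bar> 0 < Y t \<omega>))
               \<longlongrightarrow> (d * Q + R * cdf D x) / (d * Q + R)) at_top)))"
proof -
  interpret mbp_poisson_immigration M \<mu> p h r T N I \<nu> by (rule model)
  interpret regular_immigration M \<mu> \<gamma> p h r L T N I \<nu> \<alpha> l
    by unfold_locales (use critical gamma slow f alpha g in auto)
  let ?q = "regular_immigration.q \<mu> p h"
  have q_eq: "q t = ?q t" if "0 \<le> t" for t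
    unfolding q by (rule immigrant_q_0[OF that])
  have q_ind: "(\<lambda>t. indicator {0..} t *\<^sub>R q t) = (\<lambda>t. indicator {0..} t *\<^sub>R ?q t)"
    using q_eq by (auto simp: indicator_def)
  have q_int: "set_integrable lborel {0..} ?q"
    using Q(1) unfolding set_integrable_def q_ind .
  interpret integrable_immigration M \<mu> \<gamma> p h r L T N I \<nu> \<alpha> l \<theta> L\<^sub>R
  proof unfold_locales
    show "slowly_varying L\<^sub>R" "set_integrable lborel {0..} r" "set_integrable lborel {0..} ?q" by fact+
    show "0 \<le> \<theta>" using theta by simp
    show "r t = t powr (- \<theta>) * L\<^sub>R t" if "0 < t" for t by (rule r[OF that])
  qed
  let ?R = "integrable_immigration.R r" and ?Q = "integrable_immigration.Q \<mu> p h"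
  have R_eq: "R = ?R" using R(2) by (simp add: R_def)
  have Q_eq: "Q = ?Q" unfolding Q(2) Q_def set_lebesgue_integral_def q_ind ..
  have ev0: "\<forall>\<^sub>F t in at_top. (0::real) \<le> t" by (rule eventually_ge_at_top)
  have ev_q: "\<forall>\<^sub>F t in at_top. q t = ?q t" using ev0 by eventually_elim (rule q_eq)
  obtain D where D: "is_D_law \<alpha> \<gamma> D" by (rule D_law_exists)
  have pgf_recent: "((\<lambda>t. cond_expectation M (\<lambda>\<omega>. s ^ Y t \<omega>) (\<lambda>\<omega>. 0 < Y t \<omega>))
             \<longlongrightarrow> 1 - immigrant_Delta \<mu> p h s / Q) at_top"
    if o: "q \<in> o[at_top](r)" and s: "0 \<le> s" "s < 1" for s
  proof -
    have "((\<lambda>t. ?q t / r t) \<longlongrightarrow> 0) at_top"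
      by (rule Lim_transform_eventually[OF smalloD_tendsto[OF o]]) (use ev_q in \<open>auto elim: eventually_mono\<close>)
    from conditional_pgf_limit[OF s exponent_ratio_recent[OF s this]]
    show ?thesis by (simp only: Y Q_eq)
  qed
  have cdf_balanced: "((\<lambda>t. \<P>(\<omega> in M. real (Y t \<omega>) / W_fun p (\<mu> * t) \<le> x \<bar> 0 < Y t \<omega>))
               \<longlongrightarrow> (d * Q + R * cdf D x) / (d * Q + R)) at_top"
    if d: "((\<lambda>t. r t / q t) \<longlongrightarrow> d) at_top" "0 \<le> d" and x: "0 < x" for d x
  proof -
    have "((\<lambda>t. r t / ?q t) \<longlongrightarrow> d) at_top"
      by (rule Lim_transform_eventually[OF d(1)]) (use ev_q in \<open>auto elim: eventually_mono\<close>)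
    from scaled_conditional_cdf_limit[OF this d(2) D x] show ?thesis by (simp only: Y Q_eq R_eq)
  qed
  have cdf_early: "((\<lambda>t. \<P>(\<omega> in M. real (Y t \<omega>) / W_fun p (\<mu> * t) \<le> x \<bar> 0 < Y t \<omega>)) \<longlongrightarrow> cdf D x) at_top"
    if o: "r \<in> o[at_top](q)" and x: "0 \<le> x" for x
  proof (cases "x = 0")
    case True
    have "\<forall>\<^sub>F t in at_top. 0 = \<P>(\<omega> in M. real (Y t \<omega>) / W_fun p (\<mu> * t) \<le> x \<bar> 0 < Y t \<omega>)"
      using ev0
    proof eventually_elim
      case (elim t)
      show ?case unfolding Y True by (rule scaled_conditional_cdf_0[OF elim, symmetric])
    qed
    then show ?thesis unfolding True D_law_cdf_0[OF D] by (rule Lim_transform_eventually[OF tendsto_const])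
  next
    case False
    then show ?thesis using cdf_balanced[OF smalloD_tendsto[OF o] order_refl, of x] x R_pos by (simp add: R_eq)
  qed
  have pgf_balanced: "((\<lambda>t. cond_expectation M (\<lambda>\<omega>. s ^ Y t \<omega>) (\<lambda>\<omega>. 0 < Y t \<omega>))
               \<longlongrightarrow> d * Q / (d * Q + R) * (1 - immigrant_Delta \<mu> p h s / Q)) at_top"
    if d: "0 < d" "((\<lambda>t. r t / q t) \<longlongrightarrow> d) at_top" and s: "0 \<le> s" "s < 1" for d s
  proof -
    have "((\<lambda>t. r t / ?q t) \<longlongrightarrow> d) at_top"
      by (rule Lim_transform_eventually[OF d(2)]) (use ev_q in \<open>auto elim: eventually_mono\<close>)
    from conditional_pgf_limit[OF s exponent_ratio_fixed[OF s this less_imp_le[OF d(1)]]]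
    have "((\<lambda>t. cond_expectation M (\<lambda>\<omega>. s ^ Y t \<omega>) (\<lambda>\<omega>. 0 < Y t \<omega>))
        \<longlongrightarrow> 1 - (d * immigrant_Delta \<mu> p h s + R) / (d * Q + R)) at_top"
      by (simp only: Y Q_eq R_eq)
    moreover have "1 - (d * immigrant_Delta \<mu> p h s + R) / (d * Q + R) =
        d * Q / (d * Q + R) * (1 - immigrant_Delta \<mu> p h s / Q)"
    proof -
      have QR: "0 < Q" "0 < d * Q + R" using Q_pos R_pos d(1) by (auto simp: Q_eq R_eq add_pos_pos)
      then have "1 - (d * immigrant_Delta \<mu> p h s + R) / (d * Q + R) = (d * Q - d * immigrant_Delta \<mu> p h s) / (d * Q + R)"
        by (simp add: diff_divide_eq_iff)
      also have "d * Q - d * immigrant_Delta \<mu> p h s = d * Q * (1 - immigrant_Delta \<mu> p h s / Q)"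
        using QR by (simp add: right_diff_distrib)
      finally show ?thesis by simp
    qed
    ultimately show ?thesis by simp
  qed
  show ?thesis
    using pgf_recent cdf_early pgf_balanced cdf_balanced D by (blast intro: less_imp_le)
qed

end
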